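(* Let $G\supset G'$ be a real reductive linear Lie group and an algebraic reductive subgroup, and let $(\lambda,\nu)\in\mathfrak j_{\mathbb C}^\vee/W(\mathfrak j_{\mathbb C})\times(\mathfrak j'_{\mathbb C})^\vee/W(\mathfrak j'_{\mathbb C})$ be a pair of $(\mathfrak Z_G,\mathfrak Z_{G'})$-infinitesimal characters. The multiplication map $$\varphi:G\times G'\to G,\qquad (g,h)\mapsto gh^{-1}$$ induces the following linear isomorphism $$\varphi^*:\operatorname{Sh}(\lambda,\nu)\overset\sim\to\operatorname{Hom}_{K\times K'}\big(\mathbf 1\boxtimes\mathbf 1,\;C^\infty((G\times G')/\operatorname{diag}G';\chi^L_{\lambda,\nu})\big),$$ where $\mathbf 1$ denotes the trivial one-dimensional representation of the group $K$ (or that of $K'$).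
   Context: $K$ is a maximal compact subgroup of $G$ such that $K':=K\cap G'$ is a maximal compact subgroup of $G'$; $\mathfrak g\supset\mathfrak g'$ are the Lie algebras of $G\supset G'$. For $X\in\mathfrak g$ and $f\in C^\infty(G)$: $(L_Xf)(g)=\frac{d}{dt}|_{t=0}f(\exp(-tX)g)$, $(R_Xf)(g)=\frac{d}{dt}|_{t=0}f(g\exp(tX))$, and these actions are extended to the universal enveloping algebra $U(\mathfrak g_{\mathbb C})$; the same notation is used for other Lie groups. $\mathfrak Z_G:=U(\mathfrak g_{\mathbb C})^G$ is the algebra of $\operatorname{Ad}(G)$-invariant elements of $U(\mathfrak g_{\mathbb C})$. With $\mathfrak j$ a Cartan subalgebra of $\mathfrak g$ and $W(\mathfrak j_{\mathbb C}):=N_{\widetilde G}(\mathfrak j_{\mathbb C})/Z_{\widetilde G}(\mathfrak j_{\mathbb C})$ ($\widetilde G$ the group generated by $\operatorname{Ad}(G)$ and $\operatorname{Int}(\mathfrak g_{\mathbb C})$), the Harish-Chandra isomorphism identifies algebra homomorphisms $\chi_\lambda:\mathfrak Z_G\to\mathbb C$ with $\lambda\in\mathfrak j_{\mathbb C}^\vee/W(\mathfrak j_{\mathbb C})$; similarly for $G'$, with Cartan subalgebra $\mathfrak j'$ of $\mathfrak g'$ and $\nu\in(\mathfrak j'_{\mathbb C})^\vee/W(\mathfrak j'_{\mathbb C})$. $\chi_{\lambda,\nu}$ is the corresponding character of $\mathfrak Z_{G\times G'}\simeq\mathfrak Z_G\otimes\mathfrak Z_{G'}$. $\operatorname{Sh}(\lambda,\nu)$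 is the space of Shintani functions, i.e. of $f\in C^\infty(G)$ with $f(k'gk)=f(g)$ ($k'\in K'$, $k\in K$), $R_uf=\chi_\lambda(u)f$ ($u\in\mathfrak Z_G$), and $L_vf=\chi_\nu(v)f$ ($v\in\mathfrak Z_{G'}$). $C^\infty((G\times G')/\operatorname{diag}G';\chi^L_{\lambda,\nu})$ is the space of smooth functions $F$ on $(G\times G')/\operatorname{diag}G'$, where $\operatorname{diag}G'=\{(x,x):x\in G'\}$, with $L_uF=\chi_{\lambda,\nu}(u)F$ for all $u\in\mathfrak Z_{G\times G'}$; $G\times G'$ acts on it by left translation. $\operatorname{Hom}_{K\times K'}(\mathbf 1\boxtimes\mathbf 1,V)$ is identified with the space of $(K\times K')$-fixed vectors of $V$. The map $\varphi^*$ is the pull-back of functions, $\varphi^*f=f\circ\varphi$.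
   Formalization: The map φ is taken to be (g,h) ↦ hg⁻¹ instead of gh⁻¹: with the stated conventions gh⁻¹ fails (G=GL(1,R), G'=1, f(x)=|x|^s has R-eigenvalue s, but its pull-back has L-eigenvalue −s). *)

theory Defs
  imports
    "HOL-Analysis.Analysis"
    "HOL-Algebra.QuotRing"
    "HOL-Library.Function_Algebras"
begin

section \<open>Linear groups and their Lie algebras\<close>

definition GL :: "('a::field^'n^'n) monoid" where
  "GL = \<lparr>carrier = {A. invertible A}, mult = (**), one = mat 1\<rparr>"

primrec mpow :: "'a::semiring_1^'n^'n \<Rightarrow> nat \<Rightarrow> 'a^'n^'n" where
  "mpow A 0 = mat 1"
| "mpow A (Suc k) = A ** mpow A k"

definition mexp :: "real^'n^'n \<Rightarrow> real^'n^'n" where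
  "mexp A = (\<Sum>k. mpow A k /\<^sub>R fact k)"

definition unipotent :: "real^'n^'n \<Rightarrow> bool" where
  "unipotent A \<longleftrightarrow> (\<exists>k. mpow (A - mat 1) k = 0)"

definition real_algebraic_group :: "(real^'n^'n) set \<Rightarrow> bool" where
  "real_algebraic_group H \<longleftrightarrow> subgroup H GL \<and>
     (\<exists>P. (\<forall>p\<in>P. real_polynomial_function p) \<and> H = {A. invertible A \<and> (\<forall>p\<in>P. p A = 0)})"

text \<open>
  Trivial unipotent radical.  The Zariski closure of a normal unipotent subgroup is again normal
  and unipotent, and unipotent algebraic groups in characteristic 0 are connected, so the
  normal subgroups below need not be required to be closed or connected.  The unipotent radical of
  the complexification is defined over the reals and its real points are Zariski dense in it, so it
  is enough to look at real points.
\<close>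
definition reductive_algebraic_group :: "(real^'n^'n) set \<Rightarrow> bool" where
  "reductive_algebraic_group H \<longleftrightarrow> real_algebraic_group H \<and>
     (\<forall>N. N \<lhd> (GL\<lparr>carrier := H\<rparr>) \<and> (\<forall>A\<in>N. unipotent A) \<longrightarrow> N = {mat 1})"

text \<open>
  A real reductive linear Lie group is an open subgroup of the group of real points of a reductive
  algebraic group; for the subgroup, being algebraic means being cut out in \<open>G\<close> by polynomial
  equations.
\<close>
definition real_reductive_linear_group :: "(real^'n^'n) set \<Rightarrow> bool" where
  "real_reductive_linear_group G \<longleftrightarrow> subgroup G GL \<and>
     (\<exists>H. reductive_algebraic_group H \<and> openin (top_of_set H) G)"

definition algebraic_reductive_subgroup :: "(real^'n^'n) set \<Rightarrow> (real^'n^'n) set \<Rightarrow> bool" where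
  "algebraic_reductive_subgroup G' G \<longleftrightarrow> subgroup G' GL \<and>
     (\<exists>H'. reductive_algebraic_group H' \<and> openin (top_of_set H') G' \<and> G' = G \<inter> H')"

definition maximal_compact_subgroup :: "(real^'n^'n) set \<Rightarrow> (real^'n^'n) set \<Rightarrow> bool" where
  "maximal_compact_subgroup K G \<longleftrightarrow> subgroup K GL \<and> compact K \<and> K \<subseteq> G \<and>
     (\<forall>C. subgroup C GL \<and> compact C \<and> C \<subseteq> G \<and> K \<subseteq> C \<longrightarrow> C = K)"

definition lie_algebra :: "(real^'n^'n) set \<Rightarrow> (real^'n^'n) set" where
  "lie_algebra G = {X. \<forall>t. mexp (t *\<^sub>R X) \<in> G}"

definition bracket :: "'a::ring_1^'n^'n \<Rightarrow> 'a^'n^'n \<Rightarrow> 'a^'n^'n" where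
  "bracket X Y = X ** Y - Y ** X"

text \<open>The complexification \<open>V + \<i>V\<close> of a real subspace \<open>V\<close> of the real matrices.\<close>
definition complexification :: "(real^'n^'n) set \<Rightarrow> (complex^'n^'n) set" where
  "complexification V = {Z. map_matrix Re Z \<in> V \<and> map_matrix Im Z \<in> V}"

definition msmult :: "complex \<Rightarrow> complex^'n^'n \<Rightarrow> complex^'n^'n" where
  "msmult c = map_matrix ((*) c)"

definition Ad :: "real^'n^'n \<Rightarrow> complex^'n^'n \<Rightarrow> complex^'n^'n" where
  "Ad g X = map_matrix complex_of_real g ** X ** map_matrix complex_of_real (matrix_inv g)"


section \<open>Smooth functions on linear groups\<close>

primrec Ck_on :: "nat \<Rightarrow> 'a::euclidean_space set \<Rightarrow> ('a \<Rightarrow> 'b::real_normed_vector) \<Rightarrow> bool" where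
  "Ck_on 0 U f \<longleftrightarrow> continuous_on U f"
| "Ck_on (Suc k) U f \<longleftrightarrow> (\<forall>x\<in>U. f differentiable (at x)) \<and>
     (\<forall>v. Ck_on k U (\<lambda>x. frechet_derivative f (at x) v))"

text \<open>
  Functions on a subset \<open>G\<close> of a type are represented by functions on the whole type that vanish off
  \<open>G\<close>.  The groups considered here are embedded submanifolds of the space of matrices, so
  smoothness is the local existence of smooth extensions.
\<close>
definition smooth_functions :: "(real^'n^'n) set \<Rightarrow> (real^'n^'n \<Rightarrow> complex) set" where
  "smooth_functions G = {f. (\<forall>x. x \<notin> G \<longrightarrow> f x = 0) \<and>
     (\<forall>g\<in>G. \<exists>U F. open U \<and> g \<in> U \<and> (\<forall>k. Ck_on k U F) \<and> (\<forall>x\<in>U \<inter> G. f x = F x))}"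


section \<open>The universal enveloping algebra\<close>

text \<open>The free associative complex algebra on a set, as the monoid algebra of the words.\<close>
definition free_alg :: "'a set \<Rightarrow> ('a list \<Rightarrow> complex) ring" where
  "free_alg S =
     \<lparr>carrier = {u. finite {w. u w \<noteq> 0} \<and> (\<forall>w. u w \<noteq> 0 \<longrightarrow> set w \<subseteq> S)},
      mult = (\<lambda>u v w. \<Sum>k\<le>length w. u (take k w) * v (drop k w)),
      one = (\<lambda>w. if w = [] then 1 else 0),
      zero = (\<lambda>w. 0),
      add = (\<lambda>u v w. u w + v w)\<rparr>"

definition word_ind :: "'a list \<Rightarrow> 'a list \<Rightarrow> complex" where
  "word_ind v w = (if w = v then 1 else 0)"

text \<open>
  The generators of the free algebra are all elements of the Lie algebra; dividing by the first
  family of relations gives the tensor algebra.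
\<close>
definition uea_relations :: "(complex^'n^'n) set \<Rightarrow> ((complex^'n^'n) list \<Rightarrow> complex) set" where
  "uea_relations L =
     {\<lambda>w. word_ind [msmult a X + msmult b Y] w - a * word_ind [X] w - b * word_ind [Y] w
        | a b X Y. X \<in> L \<and> Y \<in> L} \<union>
     {\<lambda>w. word_ind [X, Y] w - word_ind [Y, X] w - word_ind [bracket X Y] w | X Y. X \<in> L \<and> Y \<in> L}"

definition uea_ideal :: "(complex^'n^'n) set \<Rightarrow> ((complex^'n^'n) list \<Rightarrow> complex) set" where
  "uea_ideal L = Idl\<^bsub>free_alg L\<^esub> (uea_relations L)"

definition uea :: "(complex^'n^'n) set \<Rightarrow> ((complex^'n^'n) list \<Rightarrow> complex) set ring" where
  "uea L = free_alg L Quot uea_ideal L"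

definition uea_class ::
  "(complex^'n^'n) set \<Rightarrow> ((complex^'n^'n) list \<Rightarrow> complex) \<Rightarrow> ((complex^'n^'n) list \<Rightarrow> complex) set"
  where "uea_class L u = uea_ideal L +>\<^bsub>free_alg L\<^esub> u"

definition rep :: "'a set \<Rightarrow> 'a" where
  "rep c = (SOME u. u \<in> c)"

definition push_words :: "('a \<Rightarrow> 'b) \<Rightarrow> ('a list \<Rightarrow> complex) \<Rightarrow> 'b list \<Rightarrow> complex" where
  "push_words h u w = (\<Sum>v | u v \<noteq> 0 \<and> map h v = w. u v)"

text \<open>
  The map \<open>U(L) \<rightarrow> U(M)\<close> induced by a homomorphism \<open>h\<close> of Lie algebras; it does not depend on the
  representative.
\<close>
definition uea_map ::
  "(complex^'m^'m) set \<Rightarrow> (complex^'n^'n \<Rightarrow> complex^'m^'m)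
     \<Rightarrow> ((complex^'n^'n) list \<Rightarrow> complex) set \<Rightarrow> ((complex^'m^'m) list \<Rightarrow> complex) set" where
  "uea_map M h c = uea_class M (push_words h (rep c))"

abbreviation lie_algebra_C :: "(real^'n^'n) set \<Rightarrow> (complex^'n^'n) set" where
  "lie_algebra_C G \<equiv> complexification (lie_algebra G)"

abbreviation U_alg :: "(real^'n^'n) set \<Rightarrow> ((complex^'n^'n) list \<Rightarrow> complex) set ring" where
  "U_alg G \<equiv> uea (lie_algebra_C G)"

definition Z_alg :: "(real^'n^'n) set \<Rightarrow> ((complex^'n^'n) list \<Rightarrow> complex) set ring" where
  "Z_alg G = (U_alg G)\<lparr>carrier :=
     {u \<in> carrier (U_alg G). \<forall>g\<in>G. uea_map (lie_algebra_C G) (Ad g) u = u}\<rparr>"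

definition complex_ring :: "complex ring" where
  "complex_ring = \<lparr>carrier = UNIV, mult = (*), one = 1, zero = 0, add = (+)\<rparr>"

text \<open>
  Homomorphisms of complex algebras; complex linearity amounts to fixing the scalar multiples of
  the unit.
\<close>
definition Z_character ::
  "(real^'n^'n) set \<Rightarrow> (((complex^'n^'n) list \<Rightarrow> complex) set \<Rightarrow> complex) \<Rightarrow> bool" where
  "Z_character G \<eta> \<longleftrightarrow> \<eta> \<in> ring_hom (Z_alg G) complex_ring \<and>
     (\<forall>c. \<eta> (uea_class (lie_algebra_C G) (\<lambda>w. c * word_ind [] w)) = c)"


section \<open>The actions by differential operators\<close>

definition R_real :: "real^'n^'n \<Rightarrow> (real^'n^'n \<Rightarrow> complex) \<Rightarrow> real^'n^'n \<Rightarrow> complex" where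
  "R_real X f g = vector_derivative (\<lambda>t. f (g ** mexp (t *\<^sub>R X))) (at 0)"

definition L_real :: "real^'n^'n \<Rightarrow> (real^'n^'n \<Rightarrow> complex) \<Rightarrow> real^'n^'n \<Rightarrow> complex" where
  "L_real X f g = vector_derivative (\<lambda>t. f (mexp ((- t) *\<^sub>R X) ** g)) (at 0)"

definition R_lie :: "complex^'n^'n \<Rightarrow> (real^'n^'n \<Rightarrow> complex) \<Rightarrow> real^'n^'n \<Rightarrow> complex" where
  "R_lie Z f g = R_real (map_matrix Re Z) f g + \<i> * R_real (map_matrix Im Z) f g"

definition L_lie :: "complex^'n^'n \<Rightarrow> (real^'n^'n \<Rightarrow> complex) \<Rightarrow> real^'n^'n \<Rightarrow> complex" where
  "L_lie Z f g = L_real (map_matrix Re Z) f g + \<i> * L_real (map_matrix Im Z) f g"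

text \<open>
  On smooth functions the actions below vanish on the defining ideal, so that they do not depend on
  the chosen representatives.
\<close>
definition word_action ::
  "('x \<Rightarrow> ('g \<Rightarrow> complex) \<Rightarrow> 'g \<Rightarrow> complex) \<Rightarrow> ('x list \<Rightarrow> complex) \<Rightarrow> ('g \<Rightarrow> complex) \<Rightarrow> 'g \<Rightarrow> complex"
  where "word_action D u f g = (\<Sum>w | u w \<noteq> 0. u w * foldr D w f g)"

definition R_act ::
  "((complex^'n^'n) list \<Rightarrow> complex) set \<Rightarrow> (real^'n^'n \<Rightarrow> complex) \<Rightarrow> real^'n^'n \<Rightarrow> complex" where
  "R_act u = word_action R_lie (rep u)"

definition L_act ::
  "((complex^'n^'n) list \<Rightarrow> complex) set \<Rightarrow> (real^'n^'n \<Rightarrow> complex) \<Rightarrow> real^'n^'n \<Rightarrow> complex" where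
  "L_act u = word_action L_lie (rep u)"


section \<open>Infinitesimal characters\<close>

primrec lower_central_series :: "(real^'n^'n) set \<Rightarrow> nat \<Rightarrow> (real^'n^'n) set" where
  "lower_central_series V 0 = V"
| "lower_central_series V (Suc k) = span {bracket X Y | X Y. X \<in> V \<and> Y \<in> lower_central_series V k}"

definition cartan_subalgebra :: "(real^'n^'n) set \<Rightarrow> (real^'n^'n) set \<Rightarrow> bool" where
  "cartan_subalgebra \<jj> \<gg> \<longleftrightarrow> subspace \<jj> \<and> \<jj> \<subseteq> \<gg> \<and> (\<forall>X\<in>\<jj>. \<forall>Y\<in>\<jj>. bracket X Y \<in> \<jj>) \<and>
     (\<exists>k. lower_central_series \<jj> k = {0}) \<and>
     {X \<in> \<gg>. \<forall>Y\<in>\<jj>. bracket X Y \<in> \<jj>} = \<jj>"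

definition dual_space :: "(complex^'n^'n) set \<Rightarrow> (complex^'n^'n \<Rightarrow> complex) set" where
  "dual_space V = {\<mu>. (\<forall>X. X \<notin> V \<longrightarrow> \<mu> X = 0) \<and>
     (\<forall>X\<in>V. \<forall>Y\<in>V. \<forall>a b. \<mu> (msmult a X + msmult b Y) = a * \<mu> X + b * \<mu> Y)}"

definition exp_ad :: "complex^'n^'n \<Rightarrow> complex^'n^'n \<Rightarrow> complex^'n^'n" where
  "exp_ad X Y = (\<Sum>k. ((bracket X ^^ k) Y) /\<^sub>R fact k)"

text \<open>The group generated by \<open>Ad(G)\<close> and the inner automorphisms of the complexified Lie algebra.\<close>
inductive_set G_tilde :: "(real^'n^'n) set \<Rightarrow> (complex^'n^'n \<Rightarrow> complex^'n^'n) set"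
  for G :: "(real^'n^'n) set" where
  "id \<in> G_tilde G"
| "\<gamma> \<in> G_tilde G \<Longrightarrow> g \<in> G \<Longrightarrow> Ad g \<circ> \<gamma> \<in> G_tilde G"
| "\<gamma> \<in> G_tilde G \<Longrightarrow> X \<in> lie_algebra_C G \<Longrightarrow> exp_ad X \<circ> \<gamma> \<in> G_tilde G"

definition W_orbit ::
  "(real^'n^'n) set \<Rightarrow> (real^'n^'n) set \<Rightarrow> (complex^'n^'n \<Rightarrow> complex) \<Rightarrow> (complex^'n^'n \<Rightarrow> complex) set"
  where "W_orbit G \<jj> \<mu> =
    {(\<lambda>X. if X \<in> complexification \<jj> then \<mu> (\<gamma> X) else 0) | \<gamma>.
       \<gamma> \<in> G_tilde G \<and> \<gamma> ` complexification \<jj> = complexification \<jj>}"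

definition hc_parameters ::
  "(real^'n^'n) set \<Rightarrow> (real^'n^'n) set \<Rightarrow> (complex^'n^'n \<Rightarrow> complex) set set" where
  "hc_parameters G \<jj> = W_orbit G \<jj> ` dual_space (complexification \<jj>)"

definition root_space ::
  "(real^'n^'n) set \<Rightarrow> (real^'n^'n) set \<Rightarrow> (complex^'n^'n \<Rightarrow> complex) \<Rightarrow> (complex^'n^'n) set" where
  "root_space G \<jj> \<alpha> =
     {X \<in> lie_algebra_C G. \<forall>H\<in>complexification \<jj>. bracket H X = msmult (\<alpha> H) X}"

definition roots ::
  "(real^'n^'n) set \<Rightarrow> (real^'n^'n) set \<Rightarrow> (complex^'n^'n \<Rightarrow> complex) set" where
  "roots G \<jj> = {\<alpha> \<in> dual_space (complexification \<jj>). \<alpha> \<noteq> 0 \<and> root_space G \<jj> \<alpha> \<noteq> {0}}"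

definition positive_system ::
  "(real^'n^'n) set \<Rightarrow> (real^'n^'n) set \<Rightarrow> (complex^'n^'n \<Rightarrow> complex) set \<Rightarrow> bool" where
  "positive_system G \<jj> P \<longleftrightarrow> P \<subseteq> roots G \<jj> \<and>
     (\<forall>\<alpha>\<in>roots G \<jj>. \<alpha> \<in> P \<longleftrightarrow> - \<alpha> \<notin> P) \<and>
     (\<forall>\<alpha>\<in>P. \<forall>\<beta>\<in>P. \<alpha> + \<beta> \<in> roots G \<jj> \<longrightarrow> \<alpha> + \<beta> \<in> P)"

definition half_sum :: "(complex^'n^'n \<Rightarrow> complex) set \<Rightarrow> complex^'n^'n \<Rightarrow> complex" where
  "half_sum P H = (\<Sum>\<alpha>\<in>P. \<alpha> H) / 2"

inductive_set left_ideal :: "('a, 'b) ring_scheme \<Rightarrow> 'a set \<Rightarrow> 'a set"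
  for R :: "('a, 'b) ring_scheme" and S :: "'a set" where
  "\<zero>\<^bsub>R\<^esub> \<in> left_ideal R S"
| "x \<in> left_ideal R S \<Longrightarrow> u \<in> carrier R \<Longrightarrow> s \<in> S \<Longrightarrow> x \<oplus>\<^bsub>R\<^esub> u \<otimes>\<^bsub>R\<^esub> s \<in> left_ideal R S"

text \<open>The value at \<open>\<mu>\<close> of an element of the enveloping (that is, symmetric) algebra of a Cartan subalgebra.\<close>
definition eval_at :: "('x \<Rightarrow> complex) \<Rightarrow> ('x list \<Rightarrow> complex) \<Rightarrow> complex" where
  "eval_at \<mu> q = (\<Sum>w | q w \<noteq> 0. q w * prod_list (map \<mu> w))"

text \<open>
  \<open>\<eta>\<close> is the character that the Harish-Chandra isomorphism attaches to the orbit \<open>\<Lambda>\<close>: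
  if \<open>u \<in> q + U(\<gg>) \<nn>\<^sup>+\<close> with \<open>q\<close> in the enveloping algebra of the Cartan subalgebra, then
  \<open>\<eta>(u) = q(\<mu> - \<rho>)\<close> for \<open>\<mu> \<in> \<Lambda>\<close>.  By the theorem of Harish-Chandra there is exactly one such
  \<open>\<eta>\<close> (up to its values off the algebra of invariants), it does not depend on the positive system,
  and every algebra homomorphism to the complex numbers arises from exactly one \<open>\<Lambda>\<close>.
\<close>
definition infinitesimal_character ::
  "(real^'n^'n) set \<Rightarrow> (real^'n^'n) set \<Rightarrow> (complex^'n^'n \<Rightarrow> complex) set
     \<Rightarrow> (((complex^'n^'n) list \<Rightarrow> complex) set \<Rightarrow> complex) \<Rightarrow> bool" where
  "infinitesimal_character G \<jj> \<Lambda> \<eta> \<longleftrightarrow> Z_character G \<eta> \<and>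
     (\<exists>P. positive_system G \<jj> P \<and>
       (\<forall>\<mu>\<in>\<Lambda>. \<forall>u\<in>carrier (Z_alg G). \<exists>q\<in>carrier (free_alg (complexification \<jj>)).
          u \<ominus>\<^bsub>U_alg G\<^esub> uea_class (lie_algebra_C G) q
            \<in> left_ideal (U_alg G)
                {uea_class (lie_algebra_C G) (word_ind [X]) | X \<alpha>. \<alpha> \<in> P \<and> X \<in> root_space G \<jj> \<alpha>} \<and>
          \<eta> u = eval_at (\<mu> - half_sum P) q))"


section \<open>The product group and its homogeneous space\<close>

definition blk :: "'a::zero^'n^'n \<Rightarrow> 'a^'m^'m \<Rightarrow> 'a^('n + 'm)^('n + 'm)" where
  "blk A B = (\<chi> i j. case (i, j) of
      (Inl a, Inl b) \<Rightarrow> A $ a $ b | (Inr a, Inr b) \<Rightarrow> B $ a $ b | _ \<Rightarrow> 0)"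

definition prod_group ::
  "(real^'n^'n) set \<Rightarrow> (real^'m^'m) set \<Rightarrow> (real^('n + 'm)^('n + 'm)) set" where
  "prod_group G H = {blk g h | g h. g \<in> G \<and> h \<in> H}"

definition diag_group :: "(real^'n^'n) set \<Rightarrow> (real^('n + 'n)^('n + 'n)) set" where
  "diag_group H = {blk x x | x. x \<in> H}"

text \<open>The character of \<open>Z(G \<times> H) \<simeq> Z(G) \<otimes> Z(H)\<close> determined by characters of the two factors.\<close>
definition prod_character ::
  "(real^'n^'n) set \<Rightarrow> (real^'m^'m) set
    \<Rightarrow> (((complex^'n^'n) list \<Rightarrow> complex) set \<Rightarrow> complex)
    \<Rightarrow> (((complex^'m^'m) list \<Rightarrow> complex) set \<Rightarrow> complex)
    \<Rightarrow> ((complex^('n + 'm)^('n + 'm)) list \<Rightarrow> complex) set \<Rightarrow> complex" where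
  "prod_character G H \<eta> \<eta>' = (SOME \<psi>. Z_character (prod_group G H) \<psi> \<and>
     (\<forall>u\<in>carrier (Z_alg G). \<forall>v\<in>carrier (Z_alg H).
        \<psi> (uea_map (lie_algebra_C (prod_group G H)) (\<lambda>X. blk X 0) u
             \<otimes>\<^bsub>U_alg (prod_group G H)\<^esub>
           uea_map (lie_algebra_C (prod_group G H)) (\<lambda>Y. blk 0 Y) v) = \<eta> u * \<eta>' v))"

definition coset_space :: "(real^'n^'n) set \<Rightarrow> (real^'n^'n) set \<Rightarrow> (real^'n^'n) set set" where
  "coset_space X D = {x <#\<^bsub>GL\<^esub> D | x. x \<in> X}"

definition lift_fun ::
  "(real^'n^'n) set \<Rightarrow> (real^'n^'n) set \<Rightarrow> ((real^'n^'n) set \<Rightarrow> complex) \<Rightarrow> real^'n^'n \<Rightarrow> complex" where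
  "lift_fun X D F x = (if x \<in> X then F (x <#\<^bsub>GL\<^esub> D) else 0)"

text \<open>
  Smooth functions on \<open>X/D\<close>; as \<open>X \<rightarrow> X/D\<close> is a surjective submersion, a function on \<open>X/D\<close> is smooth
  iff its lift to \<open>X\<close> is.
\<close>
definition smooth_functions_quot ::
  "(real^'n^'n) set \<Rightarrow> (real^'n^'n) set \<Rightarrow> ((real^'n^'n) set \<Rightarrow> complex) set" where
  "smooth_functions_quot X D = {F. (\<forall>c. c \<notin> coset_space X D \<longrightarrow> F c = 0) \<and>
     lift_fun X D F \<in> smooth_functions X}"

text \<open>
  The projection \<open>X \<rightarrow> X/D\<close> is equivariant for left translations, so the differential operator \<open>L\<^sub>u\<close> on
  \<open>X/D\<close> is computed on lifts.
\<close>
definition eigen_functions_quot ::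
  "(real^'n^'n) set \<Rightarrow> (real^'n^'n) set \<Rightarrow> (((complex^'n^'n) list \<Rightarrow> complex) set \<Rightarrow> complex)
     \<Rightarrow> ((real^'n^'n) set \<Rightarrow> complex) set" where
  "eigen_functions_quot X D \<psi> = {F \<in> smooth_functions_quot X D.
     \<forall>u\<in>carrier (Z_alg X). L_act u (lift_fun X D F) = (\<lambda>x. \<psi> u * lift_fun X D F x)}"

definition fixed_vectors ::
  "(real^'n^'n) set \<Rightarrow> ((real^'n^'n) set \<Rightarrow> complex) set
     \<Rightarrow> (real^'n^'n) set set \<Rightarrow> ((real^'n^'n) set \<Rightarrow> complex) set" where
  "fixed_vectors M V Q = {F \<in> V. \<forall>k\<in>M. \<forall>c\<in>Q. F (matrix_inv k <#\<^bsub>GL\<^esub> c) = F c}"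

definition Hom_trivial ::
  "(real^'n^'n) set \<Rightarrow> (real^'n^'n) set \<Rightarrow> (real^'n^'n) set
    \<Rightarrow> (((complex^'n^'n) list \<Rightarrow> complex) set \<Rightarrow> complex)
    \<Rightarrow> (((complex^'n^'n) list \<Rightarrow> complex) set \<Rightarrow> complex)
    \<Rightarrow> ((real^('n + 'n)^('n + 'n)) set \<Rightarrow> complex) set" where
  "Hom_trivial G G' K \<eta> \<eta>' =
     fixed_vectors (prod_group K (K \<inter> G'))
       (eigen_functions_quot (prod_group G G') (diag_group G') (prod_character G G' \<eta> \<eta>'))
       (coset_space (prod_group G G') (diag_group G'))"


section \<open>Shintani functions\<close>

definition Sh ::
  "(real^'n^'n) set \<Rightarrow> (real^'n^'n) set \<Rightarrow> (real^'n^'n) set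
    \<Rightarrow> (((complex^'n^'n) list \<Rightarrow> complex) set \<Rightarrow> complex)
    \<Rightarrow> (((complex^'n^'n) list \<Rightarrow> complex) set \<Rightarrow> complex)
    \<Rightarrow> (real^'n^'n \<Rightarrow> complex) set" where
  "Sh G G' K \<eta> \<eta>' = {f \<in> smooth_functions G.
     (\<forall>k'\<in>K \<inter> G'. \<forall>k\<in>K. \<forall>g\<in>G. f (k' ** g ** k) = f g) \<and>
     (\<forall>u\<in>carrier (Z_alg G). R_act u f = (\<lambda>g. \<eta> u * f g)) \<and>
     (\<forall>v\<in>carrier (Z_alg G'). L_act v f = (\<lambda>g. \<eta>' v * f g))}"

text \<open>
  The order of the factors is forced by the conventions for Shintani functions
  (left invariance under \<open>K \<inter> G'\<close>, right invariance under \<open>K\<close>, and \<open>R\<close> for \<open>G\<close>, \<open>L\<close> for \<open>G'\<close>):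
  left translation by \<open>(k, k')\<close> turns \<open>h g\<^sup>-\<^sup>1\<close> into \<open>k' h g\<^sup>-\<^sup>1 k\<^sup>-\<^sup>1\<close>.  Pulling back along the inverse
  \<open>g h\<^sup>-\<^sup>1\<close> would interchange the two sides: already for \<open>G = GL(1,\<real>)\<close>, \<open>G' = 1\<close>, \<open>f(x) = |x|\<^sup>s\<close> it
  turns the eigenvalue \<open>s\<close> of \<open>R\<close> into the eigenvalue \<open>-s\<close> of \<open>L\<close>.
\<close>
definition phi :: "(real^'n^'n) \<times> (real^'n^'n) \<Rightarrow> real^'n^'n" where
  "phi = (\<lambda>(g, h). h ** matrix_inv g)"

definition phi_pullback ::
  "(real^'n^'n) set \<Rightarrow> (real^'n^'n) set \<Rightarrow> (real^'n^'n \<Rightarrow> complex)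
     \<Rightarrow> (real^('n + 'n)^('n + 'n)) set \<Rightarrow> complex" where
  "phi_pullback G G' f c =
     (if c \<in> coset_space (prod_group G G') (diag_group G')
      then f (phi (SOME p. case p of (g, h) \<Rightarrow> blk g h \<in> c)) else 0)"

definition fscale :: "complex \<Rightarrow> ('a \<Rightarrow> complex) \<Rightarrow> 'a \<Rightarrow> complex" where
  "fscale c f = (\<lambda>x. c * f x)"

definition linear_isomorphism ::
  "(('a \<Rightarrow> complex) \<Rightarrow> 'b \<Rightarrow> complex) \<Rightarrow> ('a \<Rightarrow> complex) set \<Rightarrow> ('b \<Rightarrow> complex) set \<Rightarrow> bool" where
  "linear_isomorphism T V W \<longleftrightarrow> module.subspace fscale V \<and> module.subspace fscale W \<and>
     (\<forall>f\<in>V. \<forall>g\<in>V. T (f + g) = T f + T g) \<and> (\<forall>c. \<forall>f\<in>V. T (fscale c f) = fscale c (T f)) \<and>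
     bij_betw T V W"

end

theory Submission
  imports Defs
begin

text \<open>
  With \<open>\<phi>(g, h) = h g\<^sup>-\<^sup>1\<close>, left translation on \<open>G \<times> G'\<close> turns into right translation by \<open>G\<close> and left
  translation by \<open>G'\<close> on \<open>G\<close>: for \<open>F = f \<circ> \<phi>\<close> one has \<open>L\<^bsub>(X,0)\<^esub> F = (R\<^sub>X f) \<circ> \<phi>\<close> and
  \<open>L\<^bsub>(0,Y)\<^esub> F = (L\<^sub>Y f) \<circ> \<phi>\<close>. As \<open>\<phi>\<close> identifies \<open>(G \<times> G')/diag G'\<close> with \<open>G\<close>, everything reduces to
  \<open>Z(G \<times> G') = Z(G) \<otimes> Z(G')\<close>: write an invariant \<open>z\<close> as a sum of products \<open>a\<^sub>i b\<^sub>i\<close> with as few terms as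
  possible; then both families are linearly independent, and contracting \<open>z\<close> with dual functionals
  shows that every \<open>a\<^sub>i\<close> and every \<open>b\<^sub>i\<close> is invariant. The same functionals produce the character of
  \<open>Z(G \<times> G')\<close> from those of the factors. That the actions descend to the enveloping algebras rests on the
  symmetry of second derivatives, and that the Lie algebra of a closed linear group is a Lie algebra
  on \<open>\<gamma>(t/n)\<^sup>n \<rightarrow> exp(t \<gamma>'(0))\<close>.
\<close>

section \<open>Matrices as a Banach algebra\<close>

text \<open>
  A copy of the type of square matrices that carries the operator norm, so that the library theory of
  \<^const>\<open>exp\<close> in Banach algebras becomes available for \<^const>\<open>mexp\<close>.
\<close>

typedef ('n::finite) normed_matrix = "UNIV :: (real^'n^'n) set"
  morphisms matrix_of_normed normed_of_matrix
  by simp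

setup_lifting type_definition_normed_matrix

declare matrix_of_normed_inverse [simp] normed_of_matrix_inverse [OF UNIV_I, simp]

lemma matrix_add_rdistrib: "(A + B) ** C = A ** C + B ** C"
  for A B :: "'a::semiring_1^'n^'m" and C :: "'a^'p^'n"
  by (simp add: matrix_matrix_mult_def vec_eq_iff distrib_right sum.distrib)

lemma matrix_mult_diff:
  fixes A B C :: "'a::ring_1^'n^'n"
  shows "(A - B) ** C = A ** C - B ** C" "C ** (A - B) = C ** A - C ** B"
  by (simp_all add: matrix_matrix_mult_def vec_eq_iff algebra_simps sum_subtractf)

interpretation matrix_mult: bounded_bilinear "(**) :: real^'n^'m \<Rightarrow> real^'p^'n \<Rightarrow> real^'p^'m"
  by (intro bilinear_conv_bounded_bilinear[THEN iffD1] bilinear_def[THEN iffD2] conjI allI linearI)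
    (auto simp: matrix_add_ldistrib matrix_add_rdistrib matrix_scalar_ac scalar_matrix_assoc)

lemma onorm_matrix_mult_le:
  fixes A B :: "real^'n^'n"
  shows "onorm ((*v) (A ** B)) \<le> onorm ((*v) A) * onorm ((*v) B)"
proof -
  have "(*v) (A ** B) = (*v) A \<circ> (*v) B"
    by (auto simp: matrix_vector_mul_assoc)
  then show ?thesis
    using onorm_compose[of "(*v) A" "(*v) B"] by simp
qed

instantiation normed_matrix :: (finite) real_algebra_1
begin
lift_definition zero_normed_matrix :: "'a normed_matrix" is 0 .
lift_definition one_normed_matrix :: "'a normed_matrix" is "mat 1" .
lift_definition plus_normed_matrix :: "'a normed_matrix \<Rightarrow> 'a normed_matrix \<Rightarrow> 'a normed_matrix" is "(+)" .
lift_definition minus_normed_matrix :: "'a normed_matrix \<Rightarrow> 'a normed_matrix \<Rightarrow> 'a normed_matrix" is "(-)" .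
lift_definition uminus_normed_matrix :: "'a normed_matrix \<Rightarrow> 'a normed_matrix" is "uminus" .
lift_definition times_normed_matrix :: "'a normed_matrix \<Rightarrow> 'a normed_matrix \<Rightarrow> 'a normed_matrix" is "(**)" .
lift_definition scaleR_normed_matrix :: "real \<Rightarrow> 'a normed_matrix \<Rightarrow> 'a normed_matrix" is "scaleR" .
instance
proof
  show "(0::'a normed_matrix) \<noteq> 1"
    by transfer (auto simp: vec_eq_iff mat_def)
qed (transfer; simp add: matrix_mul_assoc matrix_scalar_ac scaleR_add_right
      scaleR_add_left matrix_add_ldistrib matrix_add_rdistrib
      flip: scalar_matrix_assoc)+
end

instantiation normed_matrix :: (finite) real_normed_algebra_1
begin
lift_definition norm_normed_matrix :: "'a normed_matrix \<Rightarrow> real" is "\<lambda>A. onorm ((*v) A)" .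
definition dist_normed_matrix :: "'a normed_matrix \<Rightarrow> 'a normed_matrix \<Rightarrow> real" where
  "dist_normed_matrix A B = norm (A - B)"
definition sgn_normed_matrix :: "'a normed_matrix \<Rightarrow> 'a normed_matrix" where
  "sgn_normed_matrix A = A /\<^sub>R norm A"
definition uniformity_normed_matrix :: "('a normed_matrix \<times> 'a normed_matrix) filter" where
  "uniformity_normed_matrix = (INF e\<in>{0<..}. principal {(x, y). dist x y < e})"
definition open_normed_matrix :: "'a normed_matrix set \<Rightarrow> bool" where
  "open_normed_matrix U = (\<forall>x\<in>U. eventually (\<lambda>(x', y). x' = x \<longrightarrow> y \<in> U) uniformity)"
instance
proof
  fix A B :: "'a normed_matrix" and c :: real
  show "norm A = 0 \<longleftrightarrow> A = 0"
    by transfer (auto simp: onorm_eq_0 matrix_eq)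
  show "norm (A + B) \<le> norm A + norm B"
  proof transfer
    fix A B :: "real^'a^'a"
    have "(*v) (A + B) = (\<lambda>x. A *v x + B *v x)"
      by (auto simp: matrix_vector_mult_add_rdistrib)
    then show "onorm ((*v) (A + B)) \<le> onorm ((*v) A) + onorm ((*v) B)"
      by (simp add: onorm_triangle)
  qed
  show "norm (c *\<^sub>R A) = \<bar>c\<bar> * norm A"
  proof transfer
    fix A :: "real^'a^'a" and c :: real
    have "(*v) (c *\<^sub>R A) = (\<lambda>x. c *\<^sub>R (A *v x))"
      by (auto simp: scaleR_matrix_vector_assoc)
    then show "onorm ((*v) (c *\<^sub>R A)) = \<bar>c\<bar> * onorm ((*v) A)"
      by (simp add: onorm_scaleR)
  qed
  show "norm (A * B) \<le> norm A * norm B"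
    by transfer (rule onorm_matrix_mult_le)
  show "norm (1 :: 'a normed_matrix) = 1"
  proof transfer
    have "(*v) (mat 1 :: real^'a^'a) = (\<lambda>x. x)" by auto
    then show "onorm ((*v) (mat 1 :: real^'a^'a)) = 1" by (simp add: onorm_id)
  qed
qed (simp_all add: dist_normed_matrix_def sgn_normed_matrix_def uniformity_normed_matrix_def
    open_normed_matrix_def)
end

lemma norm_matrix_of_normed_le:
  fixes A :: "'n::finite normed_matrix"
  shows "norm (matrix_of_normed A) \<le> norm A * real (CARD('n) * CARD('n))"
proof -
  have "norm (matrix_of_normed A) \<le> (\<Sum>i\<in>UNIV. norm (matrix_of_normed A $ i))"
    unfolding norm_vec_def by (rule L2_set_le_sum) simp
  also have "\<dots> \<le> (\<Sum>i\<in>(UNIV::'n set). \<Sum>j\<in>(UNIV::'n set). norm A)"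
  proof (rule sum_mono)
    fix i :: 'n
    have "norm (matrix_of_normed A $ i) \<le> (\<Sum>j\<in>UNIV. norm (matrix_of_normed A $ i $ j))"
      unfolding norm_vec_def by (rule L2_set_le_sum) simp
    also have "\<dots> \<le> (\<Sum>j\<in>(UNIV::'n set). norm A)"
      unfolding norm_normed_matrix.rep_eq by (intro sum_mono) (simp add: matrix_component_le_onorm)
    finally show "norm (matrix_of_normed A $ i) \<le> (\<Sum>j\<in>(UNIV::'n set). norm A)" .
  qed
  finally show ?thesis by (simp add: mult_ac)
qed

lemma bounded_linear_matrix_of_normed: "bounded_linear matrix_of_normed"
  by (rule bounded_linear_intro, rule plus_normed_matrix.rep_eq, rule scaleR_normed_matrix.rep_eq,
      rule norm_matrix_of_normed_le)

lemma bounded_linear_normed_of_matrix: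
  "bounded_linear (normed_of_matrix :: real^'n^'n \<Rightarrow> 'n normed_matrix)"
  by (rule linear_conv_bounded_linear[THEN iffD1], rule linearI)
    (simp_all add: plus_normed_matrix.abs_eq scaleR_normed_matrix.abs_eq)

instance normed_matrix :: (finite) banach
proof
  fix X :: "nat \<Rightarrow> 'a normed_matrix"
  assume "Cauchy X"
  then have "Cauchy (\<lambda>n. matrix_of_normed (X n))"
    by (rule bounded_linear.Cauchy[OF bounded_linear_matrix_of_normed])
  then obtain A where "(\<lambda>n. matrix_of_normed (X n)) \<longlonglongrightarrow> A"
    using Cauchy_convergent convergent_def by blast
  then have "(\<lambda>n. normed_of_matrix (matrix_of_normed (X n))) \<longlonglongrightarrow> normed_of_matrix A"
    by (rule bounded_linear.tendsto[OF bounded_linear_normed_of_matrix])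
  then show "convergent X"
    by (auto simp: convergent_def matrix_of_normed_inverse)
qed

lemma matrix_of_normed_power: "matrix_of_normed (A ^ k) = mpow (matrix_of_normed A) k"
  by (induction k) (auto simp: one_normed_matrix.rep_eq times_normed_matrix.rep_eq)

section \<open>The matrix exponential\<close>

lemma mexp_series_sums_exp:
  "(\<lambda>k. mpow A k /\<^sub>R fact k) sums matrix_of_normed (exp (normed_of_matrix A))"
proof -
  have "(\<lambda>k. matrix_of_normed (normed_of_matrix A ^ k /\<^sub>R fact k)) sums
      matrix_of_normed (exp (normed_of_matrix A))"
    by (rule bounded_linear.sums[OF bounded_linear_matrix_of_normed exp_converges])
  then show ?thesis
    by (simp add: scaleR_normed_matrix.rep_eq matrix_of_normed_power)
qed

lemma mexp_eq_exp: "mexp A = matrix_of_normed (exp (normed_of_matrix A))"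
  unfolding mexp_def using mexp_series_sums_exp by (rule sums_unique[symmetric])

lemma mexp_sums: "(\<lambda>k. mpow A k /\<^sub>R fact k) sums mexp A"
  unfolding mexp_eq_exp by (rule mexp_series_sums_exp)

lemma mexp_zero [simp]: "mexp 0 = mat 1"
  by (simp add: mexp_eq_exp one_normed_matrix.rep_eq flip: zero_normed_matrix_def)

lemma mexp_minus_mult [simp]: "mexp (- X) ** mexp X = mat 1"
proof -
  have "exp (- normed_of_matrix X) * exp (normed_of_matrix X) = 1"
    using exp_minus_inverse[of "- normed_of_matrix X"] by simp
  then show ?thesis
    by (simp add: mexp_eq_exp flip: uminus_normed_matrix.abs_eq times_normed_matrix.rep_eq)
      (simp add: one_normed_matrix.rep_eq)
qed

lemma mexp_mult_minus [simp]: "mexp X ** mexp (- X) = mat 1"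
  using mexp_minus_mult[of "- X"] by simp

lemma mexp_has_vector_derivative:
  "((\<lambda>t. mexp (t *\<^sub>R X)) has_vector_derivative X) (at 0)"
proof -
  have "((\<lambda>t. exp (t *\<^sub>R normed_of_matrix X)) has_vector_derivative normed_of_matrix X) (at 0)"
    using exp_scaleR_has_vector_derivative_right[of "normed_of_matrix X" 0] by simp
  then have "((\<lambda>t. matrix_of_normed (exp (t *\<^sub>R normed_of_matrix X))) has_vector_derivative X) (at 0)"
    using bounded_linear.has_vector_derivative[OF bounded_linear_matrix_of_normed] by fastforce
  then show ?thesis
    by (simp add: mexp_eq_exp flip: scaleR_normed_matrix.abs_eq)
qed

lemma mpow_conj:
  fixes g h X :: "'a::comm_ring_1^'n^'n"
  assumes "h ** g = mat 1" "g ** h = mat 1"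
  shows "mpow (g ** X ** h) k = g ** mpow X k ** h"
proof (induction k)
  case (Suc k)
  have "mpow (g ** X ** h) (Suc k) = g ** X ** (h ** g) ** mpow X k ** h"
    by (simp add: Suc matrix_mul_assoc)
  then show ?case
    by (simp add: assms matrix_mul_assoc)
qed (simp add: assms)

lemma mexp_conj:
  fixes g h X :: "real^'n^'n"
  assumes "h ** g = mat 1" "g ** h = mat 1"
  shows "mexp (g ** X ** h) = g ** mexp X ** h"
proof (rule sums_unique2[OF mexp_sums])
  have "(\<lambda>k. g ** (mpow X k /\<^sub>R fact k) ** h) sums (g ** mexp X ** h)"
    by (intro bounded_linear.sums[OF matrix_mult.bounded_linear_left]
        bounded_linear.sums[OF matrix_mult.bounded_linear_right] mexp_sums)
  then show "(\<lambda>k. mpow (g ** X ** h) k /\<^sub>R fact k) sums (g ** mexp X ** h)"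
    by (simp add: mpow_conj[OF assms] matrix_mult.scaleR_left matrix_mult.scaleR_right)
qed

lemma exp_scaleR_of_nat:
  fixes x :: "'a::{real_normed_algebra_1,banach}"
  shows "exp (real n *\<^sub>R x) = exp x ^ n"
proof (induction n)
  case (Suc n)
  have "exp (real (Suc n) *\<^sub>R x) = exp (x + real n *\<^sub>R x)"
    by (simp add: scaleR_add_left)
  also have "\<dots> = exp x * exp (real n *\<^sub>R x)"
    by (rule exp_add_commuting) simp
  finally show ?case
    by (simp add: Suc)
qed simp

lemma has_vector_derivative_LIMSEQ:
  assumes "(\<gamma> has_vector_derivative v) (at 0)"
  shows "(\<lambda>n. real n *\<^sub>R (\<gamma> (1 / real n) - \<gamma> 0)) \<longlonglongrightarrow> v"
proof -
  have "((\<lambda>h. norm (\<gamma> h - \<gamma> 0 - h *\<^sub>R v) / norm h) \<longlongrightarrow> 0) (at 0)"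
    using assms by (simp add: has_vector_derivative_def has_derivative_at)
  moreover have "filterlim (\<lambda>n. 1 / real n) (at 0) sequentially"
    by (auto simp: filterlim_at eventually_sequentially intro!: lim_1_over_n exI[of _ 1])
  ultimately have "(\<lambda>n. norm (\<gamma> (1 / real n) - \<gamma> 0 - (1 / real n) *\<^sub>R v) / norm (1 / real n)) \<longlonglongrightarrow> 0"
    by (rule filterlim_compose)
  moreover have "norm (\<gamma> (1 / real n) - \<gamma> 0 - (1 / real n) *\<^sub>R v) / norm (1 / real n) =
      norm (real n *\<^sub>R (\<gamma> (1 / real n) - \<gamma> 0) - v)" if "n \<ge> 1" for n
  proof -
    have "real n *\<^sub>R (\<gamma> (1 / real n) - \<gamma> 0) - v =
        real n *\<^sub>R (\<gamma> (1 / real n) - \<gamma> 0 - (1 / real n) *\<^sub>R v)"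
      using that by (simp add: scaleR_right_diff_distrib)
    then show ?thesis
      by (simp del: scaleR_scaleR add: mult.commute)
  qed
  ultimately have "(\<lambda>n. norm (real n *\<^sub>R (\<gamma> (1 / real n) - \<gamma> 0) - v)) \<longlonglongrightarrow> 0"
    by (rule Lim_transform_eventually[OF _ eventually_sequentiallyI[of 1]])
  then show ?thesis
    by (intro LIM_zero_cancel[of _ v]) (rule tendsto_norm_zero_cancel)
qed

lemma norm_power_diff_le:
  fixes A B :: "'a::real_normed_algebra_1"
  assumes "norm A \<le> M" "norm B \<le> M"
  shows "norm (A ^ n - B ^ n) * M \<le> real n * norm (A - B) * M ^ n"
proof (induction n)
  case (Suc n)
  have M: "0 \<le> M" using assms norm_ge_zero order_trans by blast
  have "A ^ Suc n - B ^ Suc n = A * (A ^ n - B ^ n) + (A - B) * B ^ n"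
    by (simp add: algebra_simps)
  then have "norm (A ^ Suc n - B ^ Suc n) \<le> norm A * norm (A ^ n - B ^ n) + norm (A - B) * norm (B ^ n)"
    by (metis norm_triangle_le add_mono norm_mult_ineq)
  also have "\<dots> \<le> M * norm (A ^ n - B ^ n) + norm (A - B) * M ^ n"
    by (intro add_mono mult_mono order_trans[OF norm_power_ineq] power_mono assms) (use M in auto)
  finally have "norm (A ^ Suc n - B ^ Suc n) * M \<le> (M * norm (A ^ n - B ^ n) + norm (A - B) * M ^ n) * M"
    using M by (intro mult_right_mono) auto
  also have "\<dots> = M * (norm (A ^ n - B ^ n) * M) + norm (A - B) * M ^ Suc n"
    by (simp add: algebra_simps)
  also have "\<dots> \<le> M * (real n * norm (A - B) * M ^ n) + norm (A - B) * M ^ Suc n"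
    using M Suc by (intro add_mono mult_left_mono) auto
  finally show ?case
    by (simp add: algebra_simps)
qed auto

lemma norm_power_diff_exp_le:
  fixes A Z :: "'a::{real_normed_algebra_1,banach}"
  assumes n: "n > 0" and A: "real n * norm (A - 1) \<le> D" and Z: "norm Z \<le> D"
  shows "norm (A ^ n - exp Z) \<le> norm (real n *\<^sub>R (A - exp (Z /\<^sub>R real n))) * exp D"
proof -
  define B M where "B = exp (Z /\<^sub>R real n)" and "M = exp (D / real n)"
  have "norm (A - 1) \<le> D / real n"
    using n A by (simp add: field_simps)
  then have "norm A \<le> 1 + D / real n"
    using norm_triangle_ineq[of "A - 1" 1] by simp
  also have "\<dots> \<le> M"
    unfolding M_def by (rule exp_ge_add_one_self)
  finally have norm_A: "norm A \<le> M" .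
  have "norm B \<le> exp (norm (Z /\<^sub>R real n))"
    unfolding B_def by (rule norm_exp)
  also have "\<dots> \<le> M"
    using n Z by (simp add: M_def field_simps)
  finally have norm_B: "norm B \<le> M" .
  have "D \<ge> 0"
    using Z norm_ge_zero order_trans by blast
  then have "M \<ge> 1"
    using n by (simp add: M_def)
  then have "norm (A ^ n - B ^ n) \<le> norm (A ^ n - B ^ n) * M"
    using mult_left_mono[of 1 M "norm (A ^ n - B ^ n)"] by simp
  also have "\<dots> \<le> real n * norm (A - B) * M ^ n"
    by (rule norm_power_diff_le[OF norm_A norm_B])
  finally have "norm (A ^ n - B ^ n) \<le> norm (real n *\<^sub>R (A - B)) * M ^ n"
    by simp
  moreover have "B ^ n = exp Z"
    using n by (simp add: B_def flip: exp_scaleR_of_nat)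
  moreover have "M ^ n = exp D"
    using n by (simp add: M_def flip: exp_of_nat_mult)
  ultimately show ?thesis
    by (simp add: B_def)
qed

lemma power_tendsto_exp:
  fixes A :: "nat \<Rightarrow> 'a::{real_normed_algebra_1,banach}"
  assumes A: "(\<lambda>n. real n *\<^sub>R (A n - 1)) \<longlonglongrightarrow> Z"
  shows "(\<lambda>n. A n ^ n) \<longlonglongrightarrow> exp Z"
proof -
  define E where "E n = exp (Z /\<^sub>R real n)" for n
  have "((\<lambda>t. exp (t *\<^sub>R Z)) has_vector_derivative Z) (at 0)"
    using exp_scaleR_has_vector_derivative_right[of Z 0] by simp
  then have "(\<lambda>n. real n *\<^sub>R (E n - 1)) \<longlonglongrightarrow> Z"
    using has_vector_derivative_LIMSEQ by (fastforce simp: E_def divide_inverse)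
  then have "(\<lambda>n. norm (real n *\<^sub>R (A n - E n))) \<longlonglongrightarrow> 0"
    using tendsto_norm_zero[of "\<lambda>n. real n *\<^sub>R (A n - 1) - real n *\<^sub>R (E n - 1)"] tendsto_diff[OF A]
    by (fastforce simp: scaleR_right_diff_distrib)
  then have null: "(\<lambda>n. norm (real n *\<^sub>R (A n - E n)) * exp D) \<longlonglongrightarrow> 0" for D
    by (rule tendsto_mult_left_zero)
  obtain C where C: "norm (real n *\<^sub>R (A n - 1)) \<le> C" for n
    using convergent_imp_Bseq[OF convergentI[OF A]] unfolding Bseq_def by blast
  have "norm (A n ^ n - exp Z) \<le> norm (real n *\<^sub>R (A n - E n)) * exp (max C (norm Z))" if "n \<ge> 1" for n
    unfolding E_def using that C[of n] by (intro norm_power_diff_exp_le) auto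
  then have "(\<lambda>n. A n ^ n - exp Z) \<longlonglongrightarrow> 0"
    by (intro Lim_null_comparison[OF eventually_sequentiallyI[of 1] null])
  then show ?thesis
    by (rule LIM_zero_cancel)
qed

section \<open>Closed linear groups and their Lie algebras\<close>

lemma matrix_inv_mult_self:
  fixes A :: "'a::field^'n^'n"
  assumes "invertible A"
  shows "A ** matrix_inv A = mat 1" "matrix_inv A ** A = mat 1"
  using someI_ex[OF assms[unfolded invertible_def]] by (simp_all add: matrix_inv_def)

lemma matrix_inv_unique:
  fixes A B :: "'a::field^'n^'n"
  assumes "A ** B = mat 1"
  shows "matrix_inv A = B"
proof -
  have "invertible A"
    using assms invertible_right_inverse by blast
  then have "matrix_inv A ** A ** B = B"
    by (simp add: matrix_inv_mult_self)
  then show ?thesis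
    by (simp add: assms flip: matrix_mul_assoc)
qed

lemma matrix_inv_one [simp]: "matrix_inv (mat 1 :: 'a::field^'n^'n) = mat 1"
  by (rule matrix_inv_unique) simp

lemma invertible_matrix_inv:
  fixes A :: "'a::field^'n^'n"
  shows "invertible A \<Longrightarrow> invertible (matrix_inv A)"
  using matrix_inv_mult_self unfolding invertible_def by blast

lemma matrix_inv_matrix_inv:
  fixes A :: "'a::field^'n^'n"
  shows "invertible A \<Longrightarrow> matrix_inv (matrix_inv A) = A"
  by (simp add: matrix_inv_mult_self matrix_inv_unique)

lemma matrix_inv_mult:
  fixes A B :: "'a::field^'n^'n"
  assumes "invertible A" "invertible B"
  shows "matrix_inv (A ** B) = matrix_inv B ** matrix_inv A"
proof (rule matrix_inv_unique)
  have "A ** B ** (matrix_inv B ** matrix_inv A) = A ** (B ** matrix_inv B) ** matrix_inv A"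
    by (simp add: matrix_mul_assoc)
  then show "A ** B ** (matrix_inv B ** matrix_inv A) = mat 1"
    by (simp add: assms matrix_inv_mult_self)
qed

lemma group_GL: "group (GL :: ('a::field^'n^'n) monoid)"
proof (rule groupI)
  fix x :: "'a^'n^'n"
  assume "x \<in> carrier GL"
  then show "\<exists>y\<in>carrier GL. y \<otimes>\<^bsub>GL\<^esub> x = \<one>\<^bsub>GL\<^esub>"
    by (intro bexI[of _ "matrix_inv x"]) (auto simp: GL_def matrix_inv_mult_self invertible_matrix_inv)
next
  show "\<one>\<^bsub>GL\<^esub> \<in> carrier (GL :: ('a^'n^'n) monoid)"
    by (auto simp: GL_def invertible_def intro: exI[of _ "mat 1"])
qed (auto simp: GL_def matrix_mul_assoc invertible_mult)

lemma GL_simps [simp]: "carrier GL = {A. invertible A}" "mult GL = (**)" "one GL = mat 1"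
  by (simp_all add: GL_def)

lemma inv_GL: "invertible A \<Longrightarrow> inv\<^bsub>GL\<^esub> A = matrix_inv A" for A :: "'a::field^'n^'n"
  by (rule group.inv_equality[OF group_GL]) (simp_all add: matrix_inv_mult_self invertible_matrix_inv)

lemma matrix_inv_mexp: "matrix_inv (mexp X) = mexp (- X)"
  by (rule matrix_inv_unique) simp

locale linear_group =
  fixes G :: "(real^'n^'n) set"
  assumes subgroup: "subgroup G GL"
begin

lemma invertible [simp]: "A \<in> G \<Longrightarrow> invertible A"
  using subgroup.subset[OF subgroup] by auto

lemma one_mem [simp]: "mat 1 \<in> G"
  using subgroup.one_closed[OF subgroup] by simp

lemma mult_mem [simp]: "A \<in> G \<Longrightarrow> B \<in> G \<Longrightarrow> A ** B \<in> G"
  using subgroup.m_closed[OF subgroup] by simp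

lemma inv_mem [simp]: "A \<in> G \<Longrightarrow> matrix_inv A \<in> G"
  using subgroup.m_inv_closed[OF subgroup] by (simp add: inv_GL)

lemma mult_mem_cancel_left: "A \<in> G \<Longrightarrow> A ** B \<in> G \<longleftrightarrow> B \<in> G"
  using mult_mem[of "matrix_inv A" "A ** B"] by (auto simp: matrix_mul_assoc matrix_inv_mult_self)

lemma mult_mem_cancel_right: "B \<in> G \<Longrightarrow> A ** B \<in> G \<longleftrightarrow> A \<in> G"
  using mult_mem[of "A ** B" "matrix_inv B"] by (auto simp: matrix_inv_mult_self simp flip: matrix_mul_assoc)

lemma mpow_mem: "A \<in> G \<Longrightarrow> mpow A k \<in> G"
  by (induction k) auto

end

locale closed_linear_group = linear_group G for G :: "(real^'n^'n) set" +
  assumes closed: "\<And>x l. (\<And>n. x n \<in> G) \<Longrightarrow> x \<longlonglongrightarrow> l \<Longrightarrow> invertible l \<Longrightarrow> l \<in> G"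
begin

lemma tangent_in_lie_algebra:
  assumes mem: "\<And>t. \<gamma> t \<in> G" and start: "\<gamma> 0 = mat 1" and deriv: "(\<gamma> has_vector_derivative X) (at 0)"
  shows "X \<in> lie_algebra G"
  unfolding lie_algebra_def
proof (intro CollectI allI)
  fix t :: real
  define \<delta> where "\<delta> s = normed_of_matrix (\<gamma> (t * s))" for s
  have "((\<lambda>s. t * s) has_vector_derivative t) (at 0)"
    by (auto intro!: derivative_eq_intros)
  then have "((\<lambda>s. \<gamma> (t * s)) has_vector_derivative t *\<^sub>R X) (at 0)"
    using vector_diff_chain_at[of "\<lambda>s. t * s" t 0 \<gamma> X] deriv by (simp add: comp_def)
  then have "(\<delta> has_vector_derivative normed_of_matrix (t *\<^sub>R X)) (at 0)"
    unfolding \<delta>_def by (rule bounded_linear.has_vector_derivative[OF bounded_linear_normed_of_matrix])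
  then have "(\<lambda>n. real n *\<^sub>R (\<delta> (1 / real n) - 1)) \<longlonglongrightarrow> normed_of_matrix (t *\<^sub>R X)"
    using has_vector_derivative_LIMSEQ[of \<delta>] by (simp add: \<delta>_def start flip: one_normed_matrix_def)
  then have "(\<lambda>n. matrix_of_normed (\<delta> (1 / real n) ^ n)) \<longlonglongrightarrow> mexp (t *\<^sub>R X)"
    unfolding mexp_eq_exp
    by (intro bounded_linear.tendsto[OF bounded_linear_matrix_of_normed] power_tendsto_exp)
  then have limit: "(\<lambda>n. mpow (\<gamma> (t / real n)) n) \<longlonglongrightarrow> mexp (t *\<^sub>R X)"
    by (simp add: matrix_of_normed_power \<delta>_def)
  have "invertible (mexp (t *\<^sub>R X))"
    unfolding invertible_def by (intro exI[of _ "mexp (- (t *\<^sub>R X))"] conjI mexp_minus_mult mexp_mult_minus)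
  then show "mexp (t *\<^sub>R X) \<in> G"
    by (rule closed[OF mpow_mem[OF mem] limit])
qed

lemma mexp_mem: "X \<in> lie_algebra G \<Longrightarrow> mexp (t *\<^sub>R X) \<in> G"
  by (simp add: lie_algebra_def)

lemma subspace_lie_algebra: "subspace (lie_algebra G)"
proof (rule subspaceI)
  show "0 \<in> lie_algebra G"
    by (simp add: lie_algebra_def)
  fix X Y c
  assume X: "X \<in> lie_algebra G"
  then show "c *\<^sub>R X \<in> lie_algebra G"
    by (simp add: lie_algebra_def)
  assume Y: "Y \<in> lie_algebra G"
  have "((\<lambda>t. mexp (t *\<^sub>R X) ** mexp (t *\<^sub>R Y)) has_vector_derivative
      (mexp (0 *\<^sub>R X) ** Y + X ** mexp (0 *\<^sub>R Y))) (at 0)"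
    by (intro matrix_mult.has_vector_derivative mexp_has_vector_derivative)
  then have "((\<lambda>t. mexp (t *\<^sub>R X) ** mexp (t *\<^sub>R Y)) has_vector_derivative (X + Y)) (at 0)"
    by (simp add: add.commute)
  then show "X + Y \<in> lie_algebra G"
    by (rule tangent_in_lie_algebra[rotated 2]) (auto simp: X Y mexp_mem)
qed

lemma conj_in_lie_algebra:
  assumes "g \<in> G" "X \<in> lie_algebra G"
  shows "g ** X ** matrix_inv g \<in> lie_algebra G"
  unfolding lie_algebra_def
proof (intro CollectI allI)
  fix t
  have "mexp (t *\<^sub>R (g ** X ** matrix_inv g)) = g ** mexp (t *\<^sub>R X) ** matrix_inv g"
    using mexp_conj[of "matrix_inv g" g "t *\<^sub>R X"] assms
    by (simp add: matrix_inv_mult_self matrix_scalar_ac scalar_matrix_assoc)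
  then show "mexp (t *\<^sub>R (g ** X ** matrix_inv g)) \<in> G"
    using assms by (simp add: mexp_mem)
qed

lemma bracket_in_lie_algebra:
  assumes X: "X \<in> lie_algebra G" and Y: "Y \<in> lie_algebra G"
  shows "bracket X Y \<in> lie_algebra G"
proof -
  define \<gamma> where "\<gamma> t = mexp (t *\<^sub>R X) ** Y ** mexp (t *\<^sub>R (- X))" for t
  have mem: "\<gamma> t \<in> lie_algebra G" for t
    using conj_in_lie_algebra[OF mexp_mem[OF X] Y, of t] by (simp add: \<gamma>_def matrix_inv_mexp)
  have "((\<lambda>t. mexp (t *\<^sub>R X) ** Y) has_vector_derivative X ** Y) (at 0)"
    by (rule bounded_linear.has_vector_derivative[OF matrix_mult.bounded_linear_left mexp_has_vector_derivative])
  then have "(\<gamma> has_vector_derivative (mexp (0 *\<^sub>R X) ** Y ** (- X) + (X ** Y) ** mexp (0 *\<^sub>R (- X)))) (at 0)"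
    unfolding \<gamma>_def by (intro matrix_mult.has_vector_derivative mexp_has_vector_derivative)
  then have "(\<gamma> has_vector_derivative bracket X Y) (at 0)"
    by (simp add: bracket_def matrix_mult.minus_right)
  then have "(\<lambda>n. real n *\<^sub>R (\<gamma> (1 / real n) - \<gamma> 0)) \<longlonglongrightarrow> bracket X Y"
    by (rule has_vector_derivative_LIMSEQ)
  then show ?thesis
    by (rule closed_sequentially[OF closed_subspace[OF subspace_lie_algebra], rotated])
      (intro subspace_mul subspace_diff subspace_lie_algebra mem)
qed

lemma open_subgroup_closed:
  assumes U: "subgroup U GL" and opn: "openin (top_of_set G) U"
  shows "closed_linear_group U"
proof -
  interpret U: linear_group U using U by (rule linear_group.intro)
  obtain T where T: "open T" "U = G \<inter> T"
    using opn unfolding openin_open by blast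
  show ?thesis
  proof unfold_locales
    fix x l assume x: "\<And>n. x n \<in> U" and lim: "x \<longlonglongrightarrow> l" and l: "invertible l"
    have "l \<in> G"
      by (rule closed[OF _ lim l]) (use x T in blast)
    have "(\<lambda>n. matrix_inv l ** x n) \<longlonglongrightarrow> matrix_inv l ** l"
      by (intro matrix_mult.tendsto tendsto_const lim)
    then have "(\<lambda>n. matrix_inv l ** x n) \<longlonglongrightarrow> mat 1"
      by (simp add: l matrix_inv_mult_self)
    moreover have "mat 1 \<in> T" using T U.one_mem by blast
    ultimately have "\<forall>\<^sub>F n in sequentially. matrix_inv l ** x n \<in> T"
      using T(1) topological_tendstoD by blast
    then obtain n where "matrix_inv l ** x n \<in> T"
      using eventually_happens' sequentially_bot by blast
    then have "matrix_inv l ** x n \<in> U"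
      using T x[of n] \<open>l \<in> G\<close> by auto
    then show "l \<in> U"
      using U.mult_mem_cancel_right[OF x] U.inv_mem matrix_inv_matrix_inv[OF l] by metis
  qed
qed

end

lemma real_algebraic_group_closed:
  assumes "real_algebraic_group H"
  shows "closed_linear_group H"
proof (intro closed_linear_group.intro linear_group.intro closed_linear_group_axioms.intro)
  obtain P where P: "\<And>p. p \<in> P \<Longrightarrow> real_polynomial_function p"
    and H: "H = {A. invertible A \<and> (\<forall>p\<in>P. p A = 0)}"
    using assms unfolding real_algebraic_group_def by blast
  show "subgroup H GL"
    using assms by (simp add: real_algebraic_group_def)
  fix x l assume x: "\<And>n. x n \<in> H" and lim: "x \<longlonglongrightarrow> l" and l: "invertible l"
  have "p l = 0" if "p \<in> P" for p
  proof -
    have "(\<lambda>n. p (x n)) \<longlonglongrightarrow> p l"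
      using P[OF that] lim continuous_real_polymonial_function isCont_tendsto_compose by blast
    moreover have "p (x n) = 0" for n
      using x that H by blast
    ultimately show ?thesis
      by (simp add: LIMSEQ_const_iff)
  qed
  then show "l \<in> H" using l H by blast
qed

lemma real_reductive_linear_group_closed:
  assumes "real_reductive_linear_group G"
  shows "closed_linear_group G"
  using assms unfolding real_reductive_linear_group_def reductive_algebraic_group_def
  by (blast intro: closed_linear_group.open_subgroup_closed[OF real_algebraic_group_closed])

lemma algebraic_reductive_subgroup_imp_real_reductive:
  "algebraic_reductive_subgroup G' G \<Longrightarrow> real_reductive_linear_group G'"
  unfolding algebraic_reductive_subgroup_def real_reductive_linear_group_def by blast

section \<open>Calculus of \<open>C\<^sup>k\<close> functions\<close>

lemma has_derivative_cong_open:
  assumes "open U" "x \<in> U" "\<And>y. y \<in> U \<Longrightarrow> f y = g y"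
  shows "(f has_derivative D) (at x) \<longleftrightarrow> (g has_derivative D) (at x)"
  using assms has_derivative_transform_within_open[of f D x UNIV U g]
    has_derivative_transform_within_open[of g D x UNIV U f] by auto

lemma frechet_derivative_cong_open:
  assumes "open U" "x \<in> U" "\<And>y. y \<in> U \<Longrightarrow> f y = g y"
  shows "frechet_derivative f (at x) = frechet_derivative g (at x)"
  unfolding frechet_derivative_def using has_derivative_cong_open[OF assms] by simp

lemma frechet_derivative_eq:
  "(f has_derivative D) (at x) \<Longrightarrow> frechet_derivative f (at x) = D"
  using frechet_derivative_at by metis

lemma has_derivative_frechet:
  "f differentiable (at x) \<Longrightarrow> (f has_derivative frechet_derivative f (at x)) (at x)"
  by (simp add: frechet_derivative_works)

lemma Ck_on_cong:
  assumes "open U" "\<And>x. x \<in> U \<Longrightarrow> f x = g x"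
  shows "Ck_on k U f \<longleftrightarrow> Ck_on k U g"
  using assms(2)
proof (induction k arbitrary: f g)
  case 0
  then show ?case using continuous_on_cong by force
next
  case (Suc k)
  have "f differentiable (at x) \<longleftrightarrow> g differentiable (at x)" if "x \<in> U" for x
    unfolding differentiable_def using has_derivative_cong_open[OF assms(1) that] Suc.prems by blast
  moreover have "Ck_on k U (\<lambda>x. frechet_derivative f (at x) v) \<longleftrightarrow> Ck_on k U (\<lambda>x. frechet_derivative g (at x) v)" for v
    by (rule Suc.IH) (use frechet_derivative_cong_open[OF assms(1)] Suc.prems in metis)
  ultimately show ?case by auto
qed

lemma Ck_on_subset: "Ck_on k U f \<Longrightarrow> V \<subseteq> U \<Longrightarrow> Ck_on k V f"
  by (induction k arbitrary: f) (auto intro: continuous_on_subset)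

lemma Ck_on_SucD: "Ck_on (Suc k) U f \<Longrightarrow> Ck_on k U f"
proof (induction k arbitrary: f)
  case 0
  then show ?case
    by (auto intro!: continuous_at_imp_continuous_on differentiable_imp_continuous_within)
next
  case (Suc k)
  then show ?case by (metis Ck_on.simps(2))
qed

lemma Ck_on_continuous: "Ck_on k U f \<Longrightarrow> continuous_on U f"
  by (induction k) (use Ck_on_SucD in auto)

lemma Ck_on_SucI:
  assumes "open U" "\<And>x. x \<in> U \<Longrightarrow> (f has_derivative D x) (at x)" "\<And>v. Ck_on k U (\<lambda>x. D x v)"
  shows "Ck_on (Suc k) U f"
proof -
  have "Ck_on k U (\<lambda>x. frechet_derivative f (at x) v) \<longleftrightarrow> Ck_on k U (\<lambda>x. D x v)" for v
    by (rule Ck_on_cong[OF assms(1)]) (use assms(2) frechet_derivative_eq in metis)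
  then show ?thesis
    using assms(2,3) by (auto simp: differentiable_def)
qed

lemma Ck_on_const: "open U \<Longrightarrow> Ck_on k U (\<lambda>x. c)"
proof (induction k arbitrary: c)
  case (Suc k)
  then show ?case
    by (intro Ck_on_SucI[where D="\<lambda>x v. 0"]) auto
qed simp

lemma Ck_on_bounded_linear:
  assumes "open U" "bounded_linear f"
  shows "Ck_on k U f"
proof (cases k)
  case 0
  then show ?thesis using assms by (simp add: linear_continuous_on)
next
  case (Suc l)
  show ?thesis unfolding Suc
    by (rule Ck_on_SucI[OF assms(1), where D="\<lambda>x. f"])
      (use assms bounded_linear_imp_has_derivative Ck_on_const in auto)
qed

lemma Ck_on_add:
  assumes "open U" "Ck_on k U f" "Ck_on k U g"
  shows "Ck_on k U (\<lambda>x. f x + g x)"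
  using assms(2,3)
proof (induction k arbitrary: f g)
  case 0
  then show ?case by (auto intro: continuous_intros)
next
  case (Suc k)
  show ?case
    by (rule Ck_on_SucI[OF assms(1),
          where D="\<lambda>x v. frechet_derivative f (at x) v + frechet_derivative g (at x) v"])
      (use Suc in \<open>auto intro!: has_derivative_add has_derivative_frechet\<close>)
qed

lemma Ck_on_sum:
  assumes "open U" "\<And>i. i \<in> I \<Longrightarrow> Ck_on k U (f i)"
  shows "Ck_on k U (\<lambda>x. \<Sum>i\<in>I. f i x)"
  using assms(2)
proof (induction I rule: infinite_finite_induct)
  case (insert i I)
  then show ?case
    using Ck_on_add[OF assms(1), of k "f i" "\<lambda>x. \<Sum>i\<in>I. f i x"] by simp
qed (auto simp: Ck_on_const[OF assms(1)])

lemma Ck_on_compose_linear: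
  assumes "open U" "bounded_linear L" "Ck_on k U f"
  shows "Ck_on k U (\<lambda>x. L (f x))"
  using assms(3)
proof (induction k arbitrary: f)
  case 0
  then show ?case
    using assms(2) by (simp add: bounded_linear.continuous_on)
next
  case (Suc k)
  show ?case
    by (rule Ck_on_SucI[OF assms(1), where D="\<lambda>x v. L (frechet_derivative f (at x) v)"])
      (use Suc in \<open>auto intro!: bounded_linear.has_derivative[OF assms(2)] has_derivative_frechet\<close>)
qed

lemma Ck_on_bilinear:
  assumes "open U" and bil: "bounded_bilinear B" and "Ck_on k U f" "Ck_on k U g"
  shows "Ck_on k U (\<lambda>x. B (f x) (g x))"
  using assms(3,4)
proof (induction k arbitrary: f g)
  case 0
  then show ?case
    using bounded_bilinear.continuous_on[OF bil] by simp
next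
  case (Suc k)
  show ?case
  proof (rule Ck_on_SucI[OF assms(1), where
        D="\<lambda>x v. B (f x) (frechet_derivative g (at x) v) + B (frechet_derivative f (at x) v) (g x)"])
    fix x assume "x \<in> U"
    then show "((\<lambda>x. B (f x) (g x)) has_derivative
        (\<lambda>v. B (f x) (frechet_derivative g (at x) v) + B (frechet_derivative f (at x) v) (g x))) (at x)"
      using Suc.prems by (intro bounded_bilinear.FDERIV[OF bil] has_derivative_frechet) auto
  next
    fix v
    show "Ck_on k U (\<lambda>x. B (f x) (frechet_derivative g (at x) v) + B (frechet_derivative f (at x) v) (g x))"
      by (intro Ck_on_add[OF assms(1)] Suc.IH Suc.prems[THEN Ck_on_SucD])
        (use Suc.prems in simp_all)
  qed
qed

lemma frechet_derivative_euclidean_sum: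
  fixes F :: "'a::euclidean_space \<Rightarrow> 'b::real_normed_vector"
  assumes "F differentiable (at x)"
  shows "frechet_derivative F (at x) v = (\<Sum>b\<in>Basis. (v \<bullet> b) *\<^sub>R frechet_derivative F (at x) b)"
proof -
  have lin: "linear (frechet_derivative F (at x))"
    using linear_frechet_derivative[OF assms] .
  have "frechet_derivative F (at x) v = frechet_derivative F (at x) (\<Sum>b\<in>Basis. (v \<bullet> b) *\<^sub>R b)"
    by (simp add: euclidean_representation)
  also have "\<dots> = (\<Sum>b\<in>Basis. (v \<bullet> b) *\<^sub>R frechet_derivative F (at x) b)"
    by (simp add: linear_sum[OF lin] linear_scale[OF lin])
  finally show ?thesis .
qed

lemma Ck_on_compose:
  fixes F :: "'a::euclidean_space \<Rightarrow> 'b::real_normed_vector" and \<phi> :: "'c::euclidean_space \<Rightarrow> 'a"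
  assumes "open U" "open V" "\<And>x. x \<in> V \<Longrightarrow> \<phi> x \<in> U" "Ck_on k V \<phi>" "Ck_on k U F"
  shows "Ck_on k V (\<lambda>x. F (\<phi> x))"
  using assms(4,5)
proof (induction k arbitrary: F)
  case 0
  then show ?case
    using assms(3) by (auto intro!: continuous_on_compose2[of U F])
next
  case (Suc k)
  let ?D = "\<lambda>x v. \<Sum>b\<in>Basis. (frechet_derivative \<phi> (at x) v \<bullet> b) *\<^sub>R frechet_derivative F (at (\<phi> x)) b"
  show ?case
  proof (rule Ck_on_SucI[OF assms(2), where D="?D"])
    fix x assume x: "x \<in> V"
    have "((\<lambda>x. F (\<phi> x)) has_derivative (\<lambda>v. frechet_derivative F (at (\<phi> x)) (frechet_derivative \<phi> (at x) v))) (at x)"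
      using Suc.prems x assms(3)
      by (intro has_derivative_compose[of \<phi> _ x UNIV F] has_derivative_frechet) simp_all
    moreover have "frechet_derivative F (at (\<phi> x)) (frechet_derivative \<phi> (at x) v) = ?D x v" for v
      using Suc.prems x assms(3) by (intro frechet_derivative_euclidean_sum) simp
    ultimately show "((\<lambda>x. F (\<phi> x)) has_derivative ?D x) (at x)"
      by simp
  next
    fix v
    show "Ck_on k V (\<lambda>x. ?D x v)"
    proof (intro Ck_on_sum[OF assms(2)] Ck_on_bilinear[OF assms(2) bounded_bilinear_scaleR])
      fix b :: 'a assume "b \<in> Basis"
      show "Ck_on k V (\<lambda>x. frechet_derivative \<phi> (at x) v \<bullet> b)"
        using Suc.prems by (intro Ck_on_compose_linear[OF assms(2) bounded_linear_inner_left]) simp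
      show "Ck_on k V (\<lambda>x. frechet_derivative F (at (\<phi> x)) b)"
        using Suc.prems Ck_on_SucD by (intro Suc.IH) auto
    qed
  qed
qed

lemma Ck_on_vector_field_derivative:
  fixes F :: "'a::euclidean_space \<Rightarrow> 'b::real_normed_vector"
  assumes "open U" "Ck_on (Suc k) U F" "bounded_linear A"
  shows "Ck_on k U (\<lambda>x. frechet_derivative F (at x) (A x))"
proof -
  have "Ck_on k U (\<lambda>x. \<Sum>b\<in>Basis. (A x \<bullet> b) *\<^sub>R frechet_derivative F (at x) b)"
  proof (intro Ck_on_sum[OF assms(1)] Ck_on_bilinear[OF assms(1) bounded_bilinear_scaleR])
    fix b :: 'a
    show "Ck_on k U (\<lambda>x. A x \<bullet> b)"
      by (intro Ck_on_bounded_linear[OF assms(1)] bounded_linear_compose[OF bounded_linear_inner_left] assms(3))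
    show "Ck_on k U (\<lambda>x. frechet_derivative F (at x) b)"
      using assms(2) by simp
  qed
  moreover have "frechet_derivative F (at x) (A x) = (\<Sum>b\<in>Basis. (A x \<bullet> b) *\<^sub>R frechet_derivative F (at x) b)"
    if "x \<in> U" for x
    using that assms by (intro frechet_derivative_euclidean_sum) simp
  ultimately show ?thesis
    using Ck_on_cong[OF assms(1)] by (metis (no_types, lifting))
qed

lemma continuous_on_det:
  fixes f :: "'a::topological_space \<Rightarrow> real^'n^'n"
  assumes "\<And>i j. continuous_on S (\<lambda>x. f x $ i $ j)"
  shows "continuous_on S (\<lambda>x. det (f x))"
  unfolding det_def by (intro continuous_intros assms)

lemma open_invertible: "open {A :: real^'n^'n. invertible A}"
proof -
  have "continuous_on UNIV (det :: real^'n^'n \<Rightarrow> real)"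
    by (intro continuous_on_det continuous_intros)
  then have "open (det -` (- {0}) :: (real^'n^'n) set)"
    by (intro open_vimage) auto
  moreover have "{A :: real^'n^'n. invertible A} = det -` (- {0})"
    by (auto simp: invertible_det_nz)
  ultimately show ?thesis by simp
qed

lemma matrix_inv_cramer:
  fixes A :: "real^'n^'n"
  assumes "invertible A"
  shows "matrix_inv A = (\<chi> k l. det (\<chi> i j. if j = k then mat 1 $ i $ l else A $ i $ j) / det A)"
proof -
  have "matrix_inv A $ k $ l = det (\<chi> i j. if j = k then mat 1 $ i $ l else A $ i $ j) / det A" for k l
  proof -
    have "A *v (\<chi> k. matrix_inv A $ k $ l) = (\<chi> i. mat 1 $ i $ l)"
      using matrix_inv_mult_self(1)[OF assms]
      by (simp add: vec_eq_iff matrix_vector_mult_def matrix_matrix_mult_def)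
    then have "(\<chi> k. matrix_inv A $ k $ l) =
        (\<chi> k. det(\<chi> i j. if j=k then (\<chi> i. mat 1 $ i $ l) $ i else A$i$j) / det A)"
      using cramer[of A] assms by (simp add: invertible_det_nz)
    then have "matrix_inv A $ k $ l =
        det(\<chi> i j. if j=k then (\<chi> i. mat 1 $ i $ l) $ i else A$i$j) / det A"
      unfolding vec_eq_iff by simp
    then show ?thesis by (simp only: vec_lambda_beta)
  qed
  then show ?thesis by (simp add: vec_eq_iff)
qed

lemma continuous_on_matrix_inv: "continuous_on {A :: real^'n^'n. invertible A} matrix_inv"
proof -
  have "continuous_on {A :: real^'n^'n. invertible A}
      (\<lambda>A. (\<chi> k l. det (\<chi> i j. if j = k then mat 1 $ i $ l else A $ i $ j) / det A) :: real^'n^'n)"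
  proof (intro continuous_on_vec_lambda continuous_on_divide continuous_on_det)
    fix k l i j :: 'n
    show "continuous_on {A. invertible A}
        (\<lambda>A :: real^'n^'n. (\<chi> i j. if j = k then mat 1 $ i $ l else A $ i $ j) $ i $ j)"
      by (cases "j = k") (auto intro!: continuous_intros)
  qed (auto simp: invertible_det_nz intro!: continuous_intros)
  then show ?thesis
    by (rule continuous_on_eq) (simp add: matrix_inv_cramer)
qed

lemma matrix_inv_diff:
  fixes A B :: "'a::field^'n^'n"
  assumes "invertible A" "invertible B"
  shows "matrix_inv B - matrix_inv A = - (matrix_inv B ** (B - A) ** matrix_inv A)"
  using assms by (simp add: matrix_mult_diff matrix_inv_mult_self) (simp add: matrix_inv_mult_self flip: matrix_mul_assoc)

lemma matrix_inv_has_derivative: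
  fixes A :: "real^'n^'n"
  assumes A: "invertible A"
  shows "(matrix_inv has_derivative (\<lambda>H. - (matrix_inv A ** H ** matrix_inv A))) (at A)"
proof -
  define rem where "rem B = matrix_inv B - matrix_inv A - (- (matrix_inv A ** (B - A) ** matrix_inv A))" for B
  obtain K where K: "K > 0" "\<And>(X :: real^'n^'n) (Y :: real^'n^'n). norm (X ** Y) \<le> norm X * norm Y * K"
    using matrix_mult.pos_bounded by blast
  define C where "C = K * norm (matrix_inv A) * K"
  have "isCont matrix_inv A"
    using continuous_on_matrix_inv[where 'n='n] A by (simp add: continuous_on_eq_continuous_at[OF open_invertible])
  then have "(\<lambda>B. norm (matrix_inv A - matrix_inv B)) \<midarrow>A\<rightarrow> 0"
    unfolding isCont_def by (intro tendsto_norm_zero) (auto intro!: tendsto_eq_intros)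
  then have null: "(\<lambda>B. norm (matrix_inv A - matrix_inv B) * C) \<midarrow>A\<rightarrow> 0"
    by (rule tendsto_mult_left_zero)
  have bound: "norm (norm (rem B) / norm (B - A)) \<le> norm (matrix_inv A - matrix_inv B) * C"
    if B: "invertible B" "B \<noteq> A" for B
  proof -
    have "rem B = (matrix_inv A - matrix_inv B) ** (B - A) ** matrix_inv A"
      unfolding rem_def matrix_inv_diff[OF A B(1)] by (simp add: matrix_mult.diff_left)
    then have "norm (rem B) \<le> norm ((matrix_inv A - matrix_inv B) ** (B - A)) * norm (matrix_inv A) * K"
      by (simp only: K(2))
    also have "\<dots> \<le> norm (matrix_inv A - matrix_inv B) * norm (B - A) * K * norm (matrix_inv A) * K"
      using K by (intro mult_right_mono) auto
    finally show ?thesis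
      using B by (simp add: C_def field_simps)
  qed
  have "\<forall>\<^sub>F B in at A. invertible B \<and> B \<noteq> A"
    unfolding eventually_at_topological
    by (intro exI[of _ "{B. invertible B}"]) (use open_invertible A in auto)
  then have "\<forall>\<^sub>F B in at A. norm (norm (rem B) / norm (B - A)) \<le> norm (matrix_inv A - matrix_inv B) * C"
    by (rule eventually_mono) (use bound in auto)
  then have "(\<lambda>B. norm (rem B) / norm (B - A)) \<midarrow>A\<rightarrow> 0"
    by (rule Lim_null_comparison[OF _ null])
  moreover have "bounded_linear (\<lambda>H. - (matrix_inv A ** H ** matrix_inv A))"
    by (intro bounded_linear_minus bounded_linear_compose[OF matrix_mult.bounded_linear_left matrix_mult.bounded_linear_right])
  ultimately show ?thesis
    by (simp add: has_derivative_iff_norm rem_def)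
qed

lemma Ck_on_matrix_inv: "Ck_on k {A :: real^'n^'n. invertible A} matrix_inv"
proof (induction k)
  case 0
  then show ?case by (simp add: continuous_on_matrix_inv)
next
  case (Suc k)
  show ?case
  proof (rule Ck_on_SucI[OF open_invertible, where D="\<lambda>A H. - (matrix_inv A ** H ** matrix_inv A)"])
    fix v :: "real^'n^'n"
    show "Ck_on k {A. invertible A} (\<lambda>A. - (matrix_inv A ** v ** matrix_inv A))"
      by (intro Ck_on_compose_linear[OF open_invertible bounded_linear_minus[OF bounded_linear_ident]]
        Ck_on_bilinear[OF open_invertible matrix_mult.bounded_bilinear_axioms] Suc Ck_on_const open_invertible)
  qed (simp add: matrix_inv_has_derivative)
qed

section \<open>Symmetry of the second derivative\<close>

context
  fixes g gs gst :: "real \<Rightarrow> real \<Rightarrow> 'b::banach" and gt :: "real \<Rightarrow> 'b" and d :: real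
  assumes d: "d > 0"
    and ds: "\<And>s t. s \<in> {0..d} \<Longrightarrow> t \<in> {0..d} \<Longrightarrow>
      ((\<lambda>s. g s t) has_vector_derivative gs s t) (at s within {0..d})"
    and dt: "\<And>s. s \<in> {0..d} \<Longrightarrow> (g s has_vector_derivative gt s) (at 0 within {0..d})"
    and dst: "\<And>s t. s \<in> {0..d} \<Longrightarrow> t \<in> {0..d} \<Longrightarrow>
      (gs s has_vector_derivative gst s t) (at t within {0..d})"
    and cont: "continuous_on ({0..d} \<times> {0..d}) (\<lambda>(t, s). gst s t)"
begin

lemma integral_mixed_partial:
  assumes s: "s \<in> {0..d}"
  shows "integral {0..s} (\<lambda>\<sigma>. gst \<sigma> 0) = gt s - gt 0"
proof -
  have ftc: "((\<lambda>\<sigma>. gs \<sigma> t) has_integral (g s t - g 0 t)) {0..s}" if "t \<in> {0..d}" for t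
    by (rule fundamental_theorem_of_calculus)
      (use s that in \<open>auto intro: has_vector_derivative_within_subset[OF ds]\<close>)
  have "((\<lambda>t. integral (cbox 0 s) (\<lambda>\<sigma>. gs \<sigma> t)) has_vector_derivative
      integral (cbox 0 s) (\<lambda>\<sigma>. gst \<sigma> 0)) (at 0 within {0..d})"
  proof (rule leibniz_rule_vector_derivative)
    show "continuous_on ({0..d} \<times> cbox 0 s) (\<lambda>(t, \<sigma>). gst \<sigma> t)"
      by (rule continuous_on_subset[OF cont]) (use s in auto)
  qed (use s d dst ftc in \<open>auto simp: integrable_on_def\<close>)
  then have "((\<lambda>t. g s t - g 0 t) has_vector_derivative integral {0..s} (\<lambda>\<sigma>. gst \<sigma> 0))
      (at 0 within {0..d})"
    unfolding cbox_interval
    by (rule has_vector_derivative_transform[rotated 2]) (use d integral_unique[OF ftc] in auto)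
  moreover have "((\<lambda>t. g s t - g 0 t) has_vector_derivative gt s - gt 0) (at 0 within {0..d})"
    using d s by (intro has_vector_derivative_diff dt) auto
  ultimately show ?thesis
    by (rule vector_derivative_unique_within[rotated])
      (use d in \<open>simp add: at_within_Icc_at_right trivial_limit_at_right_real\<close>)
qed

lemma mixed_partial_has_vector_derivative: "(gt has_vector_derivative gst 0 0) (at 0 within {0..d})"
proof -
  have "continuous_on {0..d} (\<lambda>s. gst s 0)"
    by (rule continuous_on_compose2[OF cont, of _ "\<lambda>s. (0, s)", unfolded prod.case])
      (use d in \<open>auto intro!: continuous_intros\<close>)
  then have "((\<lambda>s. integral {0..s} (\<lambda>\<sigma>. gst \<sigma> 0)) has_vector_derivative gst 0 0) (at 0 within {0..d})"
    by (rule integral_has_vector_derivative) (use d in auto)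
  then have "((\<lambda>s. gt s - gt 0) has_vector_derivative gst 0 0) (at 0 within {0..d})"
    by (rule has_vector_derivative_transform[rotated 2]) (use d integral_mixed_partial in auto)
  then have "((\<lambda>s. gt s - gt 0 + gt 0) has_vector_derivative gst 0 0 + 0) (at 0 within {0..d})"
    by (rule has_vector_derivative_add[OF _ has_vector_derivative_const])
  then show ?thesis by simp
qed

end

lemma has_vector_derivative_line:
  assumes "F differentiable (at (p + s *\<^sub>R v))"
  shows "((\<lambda>s. F (p + s *\<^sub>R v)) has_vector_derivative frechet_derivative F (at (p + s *\<^sub>R v)) v) (at s within S)"
proof -
  have "((\<lambda>s. p + s *\<^sub>R v) has_derivative (\<lambda>h. h *\<^sub>R v)) (at s within S)"
    by (auto intro!: derivative_eq_intros)
  then have "((\<lambda>s. F (p + s *\<^sub>R v)) has_derivative (\<lambda>h. frechet_derivative F (at (p + s *\<^sub>R v)) (h *\<^sub>R v))) (at s within S)"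
    by (rule has_derivative_compose) (rule has_derivative_frechet[OF assms])
  then show ?thesis
    using linear_frechet_derivative[OF assms] by (simp add: has_vector_derivative_def linear_scale)
qed

lemma open_contains_parallelogram:
  fixes x v w :: "'a::real_normed_vector"
  assumes "open U" "x \<in> U"
  obtains d where "d > 0" "\<And>s t. s \<in> {0..d} \<Longrightarrow> t \<in> {0..d} \<Longrightarrow> x + s *\<^sub>R v + t *\<^sub>R w \<in> U"
proof -
  define S where "S = (\<lambda>(s, t). x + s *\<^sub>R v + t *\<^sub>R w) -` U"
  have "open S" "(0, 0) \<in> S"
    using assms by (auto simp: S_def case_prod_unfold intro!: open_vimage continuous_intros)
  then obtain e where e: "e > 0" "cball (0, 0) e \<subseteq> S"
    using open_contains_cball by blast
  show thesis
  proof (rule that)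
    show "e / 2 > 0" using e by simp
    fix s t assume "s \<in> {0..e / 2}" "t \<in> {0..e / 2}"
    then have "norm (s, t) \<le> e"
      using norm_Pair_le[of s t] by auto
    then have "(s, t) \<in> cball (0, 0) e"
      by (simp add: dist_Pair_Pair norm_Pair)
    then have "(s, t) \<in> S"
      using e(2) by blast
    then show "x + s *\<^sub>R v + t *\<^sub>R w \<in> U" by (simp add: S_def)
  qed
qed

lemma frechet_derivative_along_line:
  fixes F :: "'a::euclidean_space \<Rightarrow> 'b::banach"
  assumes F: "Ck_on 2 U F" and d: "d > 0"
    and mem: "\<And>s t. s \<in> {0..d} \<Longrightarrow> t \<in> {0..d} \<Longrightarrow> x + s *\<^sub>R v + t *\<^sub>R w \<in> U"
  shows "((\<lambda>s. frechet_derivative F (at (x + s *\<^sub>R v)) w) has_vector_derivative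
    frechet_derivative (\<lambda>y. frechet_derivative F (at y) v) (at x) w) (at 0 within {0..d})"
proof -
  let ?D = "\<lambda>v y. frechet_derivative F (at y) v"
  have C2: "Ck_on (Suc (Suc 0)) U F" using F by (simp add: numeral_2_eq_2)
  have diff: "F differentiable (at y)" "?D v differentiable (at y)" if "y \<in> U" for y
    using C2 that by simp_all
  have cont: "continuous_on U (\<lambda>y. frechet_derivative (?D v) (at y) w)" using C2 by simp
  have swap: "x + s *\<^sub>R v + t *\<^sub>R w = x + t *\<^sub>R w + s *\<^sub>R v" for s t
    by (simp add: ac_simps)
  have "((\<lambda>s. ?D w (x + s *\<^sub>R v)) has_vector_derivative
      frechet_derivative (?D v) (at (x + 0 *\<^sub>R v + 0 *\<^sub>R w)) w) (at 0 within {0..d})"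
  proof (rule mixed_partial_has_vector_derivative[OF d,
        where g="\<lambda>s t. F (x + s *\<^sub>R v + t *\<^sub>R w)" and gs="\<lambda>s t. ?D v (x + s *\<^sub>R v + t *\<^sub>R w)"
          and gst="\<lambda>s t. frechet_derivative (?D v) (at (x + s *\<^sub>R v + t *\<^sub>R w)) w"])
    fix s t assume st: "s \<in> {0..d}" "t \<in> {0..d}"
    show "((\<lambda>s. F (x + s *\<^sub>R v + t *\<^sub>R w)) has_vector_derivative ?D v (x + s *\<^sub>R v + t *\<^sub>R w)) (at s within {0..d})"
      unfolding swap by (rule has_vector_derivative_line, fold swap) (rule diff mem st)+
    show "((\<lambda>t. ?D v (x + s *\<^sub>R v + t *\<^sub>R w)) has_vector_derivative
        frechet_derivative (?D v) (at (x + s *\<^sub>R v + t *\<^sub>R w)) w) (at t within {0..d})"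
      by (rule has_vector_derivative_line) (rule diff mem st)+
  next
    fix s assume "s \<in> {0..d}"
    then show "((\<lambda>t. F (x + s *\<^sub>R v + t *\<^sub>R w)) has_vector_derivative ?D w (x + s *\<^sub>R v)) (at 0 within {0..d})"
      using has_vector_derivative_line[of F "x + s *\<^sub>R v" 0 w] diff(1)[OF mem[of s 0]] d by simp
  next
    show "continuous_on ({0..d} \<times> {0..d}) (\<lambda>(t, s). frechet_derivative (?D v) (at (x + s *\<^sub>R v + t *\<^sub>R w)) w)"
      unfolding case_prod_unfold
      by (rule continuous_on_compose2[OF cont]) (use mem in \<open>auto intro!: continuous_intros\<close>)
  qed
  then show ?thesis by simp
qed

lemma second_derivative_symmetric:
  fixes F :: "'a::euclidean_space \<Rightarrow> 'b::banach"
  assumes U: "open U" "x \<in> U" and F: "Ck_on 2 U F"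
  shows "frechet_derivative (\<lambda>y. frechet_derivative F (at y) v) (at x) w =
    frechet_derivative (\<lambda>y. frechet_derivative F (at y) w) (at x) v"
proof -
  let ?D = "\<lambda>v y. frechet_derivative F (at y) v"
  obtain d where d: "d > 0" and mem: "\<And>s t. s \<in> {0..d} \<Longrightarrow> t \<in> {0..d} \<Longrightarrow> x + s *\<^sub>R v + t *\<^sub>R w \<in> U"
    using open_contains_parallelogram[OF U] by blast
  have "?D w differentiable (at x)"
    using F U by (simp add: numeral_2_eq_2)
  then have "((\<lambda>s. ?D w (x + s *\<^sub>R v)) has_vector_derivative frechet_derivative (?D w) (at (x + 0 *\<^sub>R v)) v)
      (at 0 within {0..d})"
    by (intro has_vector_derivative_line) simp
  moreover have "((\<lambda>s. ?D w (x + s *\<^sub>R v)) has_vector_derivative frechet_derivative (?D v) (at x) w) (at 0 within {0..d})"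
    by (rule frechet_derivative_along_line[OF F d]) (rule mem)
  ultimately have "frechet_derivative (?D w) (at (x + 0 *\<^sub>R v)) v = frechet_derivative (?D v) (at x) w"
    by (rule vector_derivative_unique_within[rotated])
      (use d in \<open>simp add: at_within_Icc_at_right trivial_limit_at_right_real\<close>)
  then show ?thesis by simp
qed

section \<open>Linear maps on subspaces\<close>

definition linear_on ::
  "('k \<Rightarrow> 'b::ab_group_add \<Rightarrow> 'b) \<Rightarrow> ('k \<Rightarrow> 'c::ab_group_add \<Rightarrow> 'c) \<Rightarrow> 'b set \<Rightarrow> ('b \<Rightarrow> 'c) \<Rightarrow> bool"
  where "linear_on s1 s2 A f \<longleftrightarrow>
    (\<forall>x\<in>A. \<forall>y\<in>A. f (x + y) = f x + f y) \<and> (\<forall>c. \<forall>x\<in>A. f (s1 c x) = s2 c (f x))"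

lemma linear_onI:
  assumes "\<And>x y. x \<in> A \<Longrightarrow> y \<in> A \<Longrightarrow> f (x + y) = f x + f y" "\<And>c x. x \<in> A \<Longrightarrow> f (s1 c x) = s2 c (f x)"
  shows "linear_on s1 s2 A f"
  using assms by (simp add: linear_on_def)

lemma linear_on_add: "linear_on s1 s2 A f \<Longrightarrow> x \<in> A \<Longrightarrow> y \<in> A \<Longrightarrow> f (x + y) = f x + f y"
  by (simp add: linear_on_def)

lemma linear_on_scale: "linear_on s1 s2 A f \<Longrightarrow> x \<in> A \<Longrightarrow> f (s1 c x) = s2 c (f x)"
  by (simp add: linear_on_def)

context vector_space_pair
begin

context
  fixes A f
  assumes A: "vs1.subspace A" and f: "linear_on s1 s2 A f"
begin

lemma linear_on_0: "f 0 = 0"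
  using linear_on_scale[OF f vs1.subspace_0[OF A], of 0] by simp

lemma linear_on_sum: "(\<And>i. i \<in> I \<Longrightarrow> x i \<in> A) \<Longrightarrow> f (\<Sum>i\<in>I. x i) = (\<Sum>i\<in>I. f (x i))"
  by (induction I rule: infinite_finite_induct)
    (auto simp: linear_on_0 linear_on_add[OF f] vs1.subspace_sum[OF A])

lemma linear_on_extends: obtains g where "Vector_Spaces.linear s1 s2 g" "\<And>x. x \<in> A \<Longrightarrow> g x = f x"
proof -
  obtain B where B: "B \<subseteq> A" "vs1.independent B" "A \<subseteq> vs1.span B"
    using vs1.maximal_independent_subset[of A] by blast
  obtain g where g: "Vector_Spaces.linear s1 s2 g" "\<And>x. x \<in> B \<Longrightarrow> g x = f x"
    using linear_independent_extend[OF B(2), of f] by blast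
  have "x \<in> A \<and> g x = f x" if "x \<in> vs1.span B" for x
    using that
  proof (induction rule: vs1.span_induct_alt)
    case base
    show ?case by (simp add: linear_0[OF g(1)] linear_on_0 vs1.subspace_0[OF A])
  next
    case (step c x y)
    then show ?case
      using B(1) g(2) by (auto simp: vs1.subspace_add[OF A] vs1.subspace_scale[OF A] linear_add[OF g(1)]
          linear_scale[OF g(1)] linear_on_add[OF f] linear_on_scale[OF f])
  qed
  then show thesis using that[of g] g(1) B(3) by blast
qed

end

end

context vector_space
begin

lemma subspace_eigenspace:
  assumes "subspace A" "linear_on scale scale A f"
  shows "subspace {x \<in> A. f x = scale a x}"
proof -
  interpret vector_space_pair scale scale by unfold_locales
  show ?thesis
    using assms by (intro subspaceI) (auto simp: subspace_0 subspace_add subspace_scale linear_on_0[OF assms]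
        linear_on_add[OF assms(2)] linear_on_scale[OF assms(2)] scale_right_distrib mult.commute)
qed

lemma span_image_eq_sums:
  assumes "finite I"
  shows "span (b ` I) = range (\<lambda>c. \<Sum>i\<in>I. scale (c i) (b i))"
proof
  show "range (\<lambda>c. \<Sum>i\<in>I. scale (c i) (b i)) \<subseteq> span (b ` I)"
    by (auto intro!: span_sum span_scale intro: span_base)
  have "\<exists>c. x = (\<Sum>i\<in>I. scale (c i) (b i))" if "x \<in> span (b ` I)" for x
    using that
  proof (induction rule: span_induct_alt)
    case base
    show ?case by (intro exI[of _ "\<lambda>_. 0"]) simp
  next
    case (step k x y)
    then obtain j c where "j \<in> I" "x = b j" "y = (\<Sum>i\<in>I. scale (c i) (b i))" by blast
    then have "scale k x + y = (\<Sum>i\<in>I. scale ((if i = j then k else 0) + c i) (b i))"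
      using assms by (simp add: scale_left_distrib sum.distrib if_distrib[of "\<lambda>r. scale r _"] cong: if_cong)
    then show ?case by (rule exI[of _ "\<lambda>i. (if i = j then k else 0) + c i"])
  qed
  then show "span (b ` I) \<subseteq> range (\<lambda>c. \<Sum>i\<in>I. scale (c i) (b i))" by blast
qed

end

interpretation fun_vs: vector_space "fscale :: complex \<Rightarrow> ('a \<Rightarrow> complex) \<Rightarrow> 'a \<Rightarrow> complex"
  by unfold_locales (auto simp: fscale_def fun_eq_iff algebra_simps)

interpretation fun_pair: vector_space_pair "fscale :: complex \<Rightarrow> ('a \<Rightarrow> complex) \<Rightarrow> 'a \<Rightarrow> complex"
    "fscale :: complex \<Rightarrow> ('b \<Rightarrow> complex) \<Rightarrow> 'b \<Rightarrow> complex"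
  by unfold_locales

interpretation functional: vector_space_pair "fscale :: complex \<Rightarrow> ('a \<Rightarrow> complex) \<Rightarrow> 'a \<Rightarrow> complex"
    "(*) :: complex \<Rightarrow> complex \<Rightarrow> complex"
  by unfold_locales (auto simp: algebra_simps)

definition independent_mod :: "('a \<Rightarrow> complex) set \<Rightarrow> 'i set \<Rightarrow> ('i \<Rightarrow> 'a \<Rightarrow> complex) \<Rightarrow> bool" where
  "independent_mod J I b \<longleftrightarrow> (\<forall>c. (\<Sum>i\<in>I. fscale (c i) (b i)) \<in> J \<longrightarrow> (\<forall>i\<in>I. c i = 0))"

lemma independent_mod_notin_span_plus:
  assumes ind: "independent_mod J I b" and I: "finite I" "j \<in> I"
  shows "b j \<notin> {x + y | x y. x \<in> fun_vs.span (b ` (I - {j})) \<and> y \<in> J}"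
proof
  assume "b j \<in> {x + y | x y. x \<in> fun_vs.span (b ` (I - {j})) \<and> y \<in> J}"
  then obtain c y where y: "y \<in> J" "b j = (\<Sum>i\<in>I - {j}. fscale (c i) (b i)) + y"
    using I by (auto simp: fun_vs.span_image_eq_sums)
  define c' where "c' i = (if i = j then 1 else - c i)" for i
  have "(\<Sum>i\<in>I - {j}. fscale (c' i) (b i)) = - (\<Sum>i\<in>I - {j}. fscale (c i) (b i))"
    unfolding sum_negf[symmetric] by (rule sum.cong) (auto simp: c'_def)
  then have "(\<Sum>i\<in>I. fscale (c' i) (b i)) = y"
    using I y(2) by (simp add: sum.remove[of I j] c'_def[of j])
  then have "c' j = 0"
    using ind y(1) I(2) unfolding independent_mod_def by blast
  then show False by (simp add: c'_def)
qed

text \<open>A linear relation between the right factors shortens a sum of products.\<close>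

lemma bilinear_sum_eliminate:
  fixes B :: "('a \<Rightarrow> complex) \<Rightarrow> ('b \<Rightarrow> complex) \<Rightarrow> 'c \<Rightarrow> complex"
  assumes A1: "fun_vs.subspace A1" and A2: "fun_vs.subspace A2" and J: "fun_vs.subspace J"
    and left: "\<And>y. y \<in> A2 \<Longrightarrow> linear_on fscale fscale A1 (\<lambda>x. B x y)"
    and right: "\<And>x. x \<in> A1 \<Longrightarrow> linear_on fscale fscale A2 (B x)"
    and a: "\<And>i. i \<in> I \<Longrightarrow> a i \<in> A1" and b: "\<And>i. i \<in> I \<Longrightarrow> b i \<in> A2"
    and j: "finite I" "j \<in> I" "c j \<noteq> 0"
    and relation: "B (a j) (\<Sum>i\<in>I. fscale (c i) (b i)) \<in> J"
  shows "(\<Sum>i\<in>I. B (a i) (b i)) - (\<Sum>i\<in>I - {j}. B (a i - fscale (c i / c j) (a j)) (b i)) \<in> J"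
proof -
  have sub: "B (a i - fscale k (a j)) (b i) = B (a i) (b i) - fscale k (B (a j) (b i))" if "i \<in> I" for i k
  proof -
    have "B (a i + fscale (- k) (a j)) (b i) = B (a i) (b i) + fscale (- k) (B (a j) (b i))"
      by (simp only: linear_on_add[OF left] linear_on_scale[OF left] a b that j(2) fun_vs.subspace_scale[OF A1])
    then show ?thesis
      by (simp only: fun_vs.scale_minus_left add_uminus_conv_diff)
  qed
  have "B (a j - fscale (c j / c j) (a j)) (b j) = 0"
    using sub[OF j(2), of 1] by (simp only: divide_self[OF j(3)] fun_vs.scale_one diff_self)
  then have "(\<Sum>i\<in>I - {j}. B (a i - fscale (c i / c j) (a j)) (b i)) = (\<Sum>i\<in>I. B (a i - fscale (c i / c j) (a j)) (b i))"
    by (simp only: sum.remove[OF j(1,2), of "\<lambda>i. B (a i - fscale (c i / c j) (a j)) (b i)"] add_0_left)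
  also have "\<dots> = (\<Sum>i\<in>I. B (a i) (b i)) - (\<Sum>i\<in>I. fscale (c i / c j) (B (a j) (b i)))"
    by (simp only: sub sum_subtractf cong: sum.cong)
  also have "(\<Sum>i\<in>I. fscale (c i / c j) (B (a j) (b i))) = fscale (1 / c j) (\<Sum>i\<in>I. fscale (c i) (B (a j) (b i)))"
    by (simp only: fun_vs.scale_sum_right fun_vs.scale_scale) simp
  also have "(\<Sum>i\<in>I. fscale (c i) (B (a j) (b i))) = B (a j) (\<Sum>i\<in>I. fscale (c i) (b i))"
    by (subst fun_pair.linear_on_sum[OF A2 right[OF a[OF j(2)]]])
      (simp_all add: b fun_vs.subspace_scale[OF A2] linear_on_scale[OF right[OF a[OF j(2)]]])
  finally have "(\<Sum>i\<in>I. B (a i) (b i)) - (\<Sum>i\<in>I - {j}. B (a i - fscale (c i / c j) (a j)) (b i)) =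
      fscale (1 / c j) (B (a j) (\<Sum>i\<in>I. fscale (c i) (b i)))"
    by (simp only: diff_diff_eq2 add_diff_cancel_left')
  then show ?thesis
    using fun_vs.subspace_scale[OF J relation] by (simp only:)
qed

section \<open>Lie algebra representations on function spaces\<close>

locale lie_rep =
  fixes L :: "(complex^'n^'n) set"
    and D :: "complex^'n^'n \<Rightarrow> ('g \<Rightarrow> complex) \<Rightarrow> 'g \<Rightarrow> complex"
    and V :: "('g \<Rightarrow> complex) set"
  assumes subspace_V: "fun_vs.subspace V"
    and D_closed: "X \<in> L \<Longrightarrow> f \<in> V \<Longrightarrow> D X f \<in> V"
    and D_linear_on: "X \<in> L \<Longrightarrow> linear_on fscale fscale V (D X)"
    and D_linear_left: "X \<in> L \<Longrightarrow> Y \<in> L \<Longrightarrow> f \<in> V \<Longrightarrow>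
      D (msmult a X + msmult b Y) f = fscale a (D X f) + fscale b (D Y f)"
    and D_bracket: "X \<in> L \<Longrightarrow> Y \<in> L \<Longrightarrow> f \<in> V \<Longrightarrow>
      D (bracket X Y) f = D X (D Y f) - D Y (D X f)"

lemma map_matrix_Re_Im_linear:
  "map_matrix Re (msmult a X + msmult b Y) =
     Re a *\<^sub>R map_matrix Re X + (- Im a) *\<^sub>R map_matrix Im X + (Re b *\<^sub>R map_matrix Re Y + (- Im b) *\<^sub>R map_matrix Im Y)"
  "map_matrix Im (msmult a X + msmult b Y) =
     Re a *\<^sub>R map_matrix Im X + Im a *\<^sub>R map_matrix Re X + (Re b *\<^sub>R map_matrix Im Y + Im b *\<^sub>R map_matrix Re Y)"
  by (simp_all add: vec_eq_iff map_matrix_def msmult_def)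

lemma map_matrix_Re_Im_bracket:
  "map_matrix Re (bracket X Y) =
     bracket (map_matrix Re X) (map_matrix Re Y) + (- 1) *\<^sub>R bracket (map_matrix Im X) (map_matrix Im Y)"
  "map_matrix Im (bracket X Y) =
     bracket (map_matrix Re X) (map_matrix Im Y) + bracket (map_matrix Im X) (map_matrix Re Y)"
  by (simp_all add: vec_eq_iff map_matrix_def bracket_def matrix_matrix_mult_def sum_subtractf sum.distrib)

definition complexify_action ::
  "(real^'n^'n \<Rightarrow> ('g \<Rightarrow> complex) \<Rightarrow> 'g \<Rightarrow> complex) \<Rightarrow> complex^'n^'n \<Rightarrow> ('g \<Rightarrow> complex) \<Rightarrow> 'g \<Rightarrow> complex"
  where "complexify_action D Z f = D (map_matrix Re Z) f + fscale \<i> (D (map_matrix Im Z) f)"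

locale real_lie_rep =
  fixes \<gg> :: "(real^'n^'n) set"
    and D :: "real^'n^'n \<Rightarrow> ('g \<Rightarrow> complex) \<Rightarrow> 'g \<Rightarrow> complex"
    and V :: "('g \<Rightarrow> complex) set"
  assumes subspace: "subspace \<gg>"
    and bracket_mem: "X \<in> \<gg> \<Longrightarrow> Y \<in> \<gg> \<Longrightarrow> bracket X Y \<in> \<gg>"
    and subspace_V: "fun_vs.subspace V"
    and D_closed: "X \<in> \<gg> \<Longrightarrow> f \<in> V \<Longrightarrow> D X f \<in> V"
    and D_linear_on: "X \<in> \<gg> \<Longrightarrow> linear_on fscale fscale V (D X)"
    and D_linear_left: "X \<in> \<gg> \<Longrightarrow> Y \<in> \<gg> \<Longrightarrow> f \<in> V \<Longrightarrow>
      D (r *\<^sub>R X + s *\<^sub>R Y) f = fscale (of_real r) (D X f) + fscale (of_real s) (D Y f)"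
    and D_bracket: "X \<in> \<gg> \<Longrightarrow> Y \<in> \<gg> \<Longrightarrow> f \<in> V \<Longrightarrow>
      D (bracket X Y) f = D X (D Y f) - D Y (D X f)"
begin

lemmas \<gg>_closed = subspace_add[OF subspace] subspace_mul[OF subspace] bracket_mem
lemmas V_closed = fun_vs.subspace_add[OF subspace_V] fun_vs.subspace_scale[OF subspace_V] D_closed

lemma D_add: "X \<in> \<gg> \<Longrightarrow> f \<in> V \<Longrightarrow> g \<in> V \<Longrightarrow> D X (f + g) = D X f + D X g"
  by (rule linear_on_add[OF D_linear_on])

lemma D_scale: "X \<in> \<gg> \<Longrightarrow> f \<in> V \<Longrightarrow> D X (fscale c f) = fscale c (D X f)"
  by (rule linear_on_scale[OF D_linear_on])

lemma D_add_left: "X \<in> \<gg> \<Longrightarrow> Y \<in> \<gg> \<Longrightarrow> f \<in> V \<Longrightarrow> D (X + Y) f = D X f + D Y f"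
  using D_linear_left[of X Y f 1 1] by (simp add: fscale_def)

lemma D_scaleR_left: "X \<in> \<gg> \<Longrightarrow> f \<in> V \<Longrightarrow> D (r *\<^sub>R X) f = fscale (of_real r) (D X f)"
  using D_linear_left[of X X f r 0] by (simp add: fscale_def fun_eq_iff)

lemma complexify_action_linear:
  assumes "X \<in> complexification \<gg>" "Y \<in> complexification \<gg>" "f \<in> V"
  shows "complexify_action D (msmult a X + msmult b Y) f =
    fscale a (complexify_action D X f) + fscale b (complexify_action D Y f)"
proof -
  let ?X\<^sub>r = "map_matrix Re X" and ?X\<^sub>i = "map_matrix Im X"
  let ?Y\<^sub>r = "map_matrix Re Y" and ?Y\<^sub>i = "map_matrix Im Y"
  have mem: "?X\<^sub>r \<in> \<gg>" "?X\<^sub>i \<in> \<gg>" "?Y\<^sub>r \<in> \<gg>" "?Y\<^sub>i \<in> \<gg>"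
    using assms by (auto simp: complexification_def)
  show ?thesis
    unfolding complexify_action_def map_matrix_Re_Im_linear using mem assms(3)
    by (simp only: D_add_left D_scaleR_left \<gg>_closed) (simp add: fun_eq_iff fscale_def complex_eq_iff algebra_simps)
qed

lemma complexify_action_bracket:
  assumes "X \<in> complexification \<gg>" "Y \<in> complexification \<gg>" "f \<in> V"
  shows "complexify_action D (bracket X Y) f =
    complexify_action D X (complexify_action D Y f) - complexify_action D Y (complexify_action D X f)"
proof -
  let ?X\<^sub>r = "map_matrix Re X" and ?X\<^sub>i = "map_matrix Im X"
  let ?Y\<^sub>r = "map_matrix Re Y" and ?Y\<^sub>i = "map_matrix Im Y"
  have mem: "?X\<^sub>r \<in> \<gg>" "?X\<^sub>i \<in> \<gg>" "?Y\<^sub>r \<in> \<gg>" "?Y\<^sub>i \<in> \<gg>"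
    using assms by (auto simp: complexification_def)
  show ?thesis
    unfolding complexify_action_def map_matrix_Re_Im_bracket using mem assms(3)
    by (simp only: D_add_left D_scaleR_left D_bracket \<gg>_closed D_add D_scale V_closed)
      (simp add: fun_eq_iff fscale_def algebra_simps)
qed

lemma lie_rep_complexify: "lie_rep (complexification \<gg>) (complexify_action D) V"
proof
  fix X and f :: "'g \<Rightarrow> complex"
  assume "X \<in> complexification \<gg>"
  then have mem: "map_matrix Re X \<in> \<gg>" "map_matrix Im X \<in> \<gg>"
    by (auto simp: complexification_def)
  then show "complexify_action D X f \<in> V" if "f \<in> V"
    unfolding complexify_action_def using that by (intro V_closed)
  show "linear_on fscale fscale V (complexify_action D X)"
    using mem unfolding complexify_action_def
    by (intro linear_onI) (simp_all only: D_add D_scale fun_vs.scale_right_distrib fun_vs.scale_scale mult.commute[of \<i>] add_ac)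
qed (simp_all add: subspace_V complexify_action_linear complexify_action_bracket)

end

section \<open>Invariant vector fields on smooth functions\<close>

definition local_extension ::
  "(real^'n^'n) set \<Rightarrow> (real^'n^'n \<Rightarrow> complex) \<Rightarrow> real^'n^'n \<Rightarrow> (real^'n^'n) set \<Rightarrow> (real^'n^'n \<Rightarrow> complex) \<Rightarrow> bool"
  where "local_extension G f g U F \<longleftrightarrow>
    open U \<and> g \<in> U \<and> (\<forall>k. Ck_on k U F) \<and> (\<forall>x\<in>U \<inter> G. f x = F x)"

lemma smooth_functions_iff:
  "f \<in> smooth_functions G \<longleftrightarrow>
    (\<forall>x. x \<notin> G \<longrightarrow> f x = 0) \<and> (\<forall>g\<in>G. \<exists>U F. local_extension G f g U F)"
  by (simp add: smooth_functions_def local_extension_def)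

lemma local_extension_differentiable:
  assumes "local_extension G f x U F"
  shows "F differentiable (at x)"
  using assms unfolding local_extension_def by (auto dest: spec[of _ "Suc 0"])

lemma local_extension_move: "local_extension G f g U F \<Longrightarrow> x \<in> U \<Longrightarrow> local_extension G f x U F"
  by (simp add: local_extension_def)

lemma local_extension_add:
  assumes "local_extension G f g U F" "local_extension G f' g U' F'"
  shows "local_extension G (f + f') g (U \<inter> U') (\<lambda>x. F x + F' x)"
  using assms unfolding local_extension_def by (auto intro!: Ck_on_add intro: Ck_on_subset)

lemma local_extension_scale:
  assumes "local_extension G f g U F"
  shows "local_extension G (fscale c f) g U (\<lambda>x. c * F x)"
  using assms unfolding local_extension_def fscale_def
  by (auto intro!: Ck_on_compose_linear[OF _ bounded_linear_mult_right])

lemma smooth_functions_off: "f \<in> smooth_functions G \<Longrightarrow> x \<notin> G \<Longrightarrow> f x = 0"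
  by (simp add: smooth_functions_iff)

lemma smooth_functions_eqI:
  assumes "f \<in> smooth_functions G"
    and "\<And>x U F. x \<in> G \<Longrightarrow> local_extension G f x U F \<Longrightarrow> a x = b x" and "\<And>x. x \<notin> G \<Longrightarrow> a x = b x"
  shows "a = b"
proof
  fix x
  show "a x = b x"
    using assms unfolding smooth_functions_iff by (cases "x \<in> G") blast+
qed

lemma smooth_functions_add:
  assumes "f \<in> smooth_functions G" "f' \<in> smooth_functions G"
  shows "f + f' \<in> smooth_functions G"
  unfolding smooth_functions_iff
proof (intro conjI allI impI ballI)
  fix g assume "g \<in> G"
  then show "\<exists>U F. local_extension G (f + f') g U F"
    using assms local_extension_add unfolding smooth_functions_iff by meson
qed (use assms in \<open>simp add: smooth_functions_off\<close>)

lemma smooth_functions_scale: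
  assumes "f \<in> smooth_functions G"
  shows "fscale c f \<in> smooth_functions G"
  unfolding smooth_functions_iff
proof (intro conjI allI impI ballI)
  fix g assume "g \<in> G"
  then show "\<exists>U F. local_extension G (fscale c f) g U F"
    using assms local_extension_scale unfolding smooth_functions_iff by meson
qed (use assms in \<open>simp add: smooth_functions_off fscale_def\<close>)

lemma subspace_smooth_functions: "fun_vs.subspace (smooth_functions G)"
proof (rule fun_vs.subspaceI)
  show "0 \<in> smooth_functions G"
    unfolding smooth_functions_iff local_extension_def
    by (auto intro!: exI[of _ UNIV] exI[of _ "\<lambda>x. 0"] Ck_on_const)
qed (auto intro: smooth_functions_add smooth_functions_scale)

definition flow_derivative :: "('a \<Rightarrow> real \<Rightarrow> 'a) \<Rightarrow> ('a \<Rightarrow> complex) \<Rightarrow> 'a \<Rightarrow> complex" where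
  "flow_derivative \<gamma> f x = vector_derivative (\<lambda>t. f (\<gamma> x t)) (at 0)"

locale flow_field =
  fixes G :: "(real^'n^'n) set" and A :: "real^'n^'n \<Rightarrow> real^'n^'n"
    and \<gamma> :: "real^'n^'n \<Rightarrow> real \<Rightarrow> real^'n^'n"
  assumes linear: "bounded_linear A"
    and flow_mem: "\<gamma> x t \<in> G \<longleftrightarrow> x \<in> G"
    and flow_0: "\<gamma> x 0 = x"
    and flow_deriv: "(\<gamma> x has_vector_derivative A x) (at 0)"
begin

lemma flow_derivative_eq:
  assumes "x \<in> G" and ext: "local_extension G f x U F"
  shows "flow_derivative \<gamma> f x = frechet_derivative F (at x) (A x)"
proof -
  have U: "open U" "x \<in> U" and eq: "\<And>y. y \<in> U \<Longrightarrow> y \<in> G \<Longrightarrow> f y = F y"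
    using ext unfolding local_extension_def by auto
  note F = local_extension_differentiable[OF ext]
  have "(F has_derivative frechet_derivative F (at x)) (at (\<gamma> x 0))"
    using has_derivative_frechet[OF F] by (simp add: flow_0)
  then have "((\<lambda>t. F (\<gamma> x t)) has_derivative (\<lambda>t. frechet_derivative F (at x) (t *\<^sub>R A x))) (at 0)"
    by (rule has_derivative_compose[OF flow_deriv[of x, unfolded has_vector_derivative_def]])
  moreover have "\<forall>\<^sub>F t in at 0. F (\<gamma> x t) = f (\<gamma> x t)"
  proof -
    have "isCont (\<gamma> x) 0"
      by (rule has_vector_derivative_continuous[OF flow_deriv])
    then have "\<forall>\<^sub>F t in at 0. \<gamma> x t \<in> U"
      using U topological_tendstoD[of "\<gamma> x" "\<gamma> x 0" "at 0" U] by (simp add: isCont_def flow_0)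
    then show ?thesis
      by eventually_elim (use eq flow_mem assms in auto)
  qed
  ultimately have "((\<lambda>t. f (\<gamma> x t)) has_derivative (\<lambda>t. frechet_derivative F (at x) (t *\<^sub>R A x))) (at 0)"
    by (rule has_derivative_transform_eventually) (use eq U assms flow_0 in auto)
  then have "((\<lambda>t. f (\<gamma> x t)) has_vector_derivative frechet_derivative F (at x) (A x)) (at 0)"
    using linear_frechet_derivative[OF F] by (simp add: has_vector_derivative_def linear_scale)
  then show ?thesis
    unfolding flow_derivative_def by (rule vector_derivative_at)
qed

lemma flow_derivative_off:
  assumes "x \<notin> G" "\<And>y. y \<notin> G \<Longrightarrow> f y = 0"
  shows "flow_derivative \<gamma> f x = 0"
proof -
  have "(\<lambda>t. f (\<gamma> x t)) = (\<lambda>t. 0)"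
    using assms flow_mem by auto
  then show ?thesis
    by (simp add: flow_derivative_def)
qed

lemma local_extension_flow:
  assumes "local_extension G f g U F"
  shows "local_extension G (flow_derivative \<gamma> f) g U (\<lambda>x. frechet_derivative F (at x) (A x))"
  unfolding local_extension_def
proof (intro conjI allI ballI)
  fix k
  show "Ck_on k U (\<lambda>x. frechet_derivative F (at x) (A x))"
    using assms linear unfolding local_extension_def by (intro Ck_on_vector_field_derivative) auto
next
  fix x assume "x \<in> U \<inter> G"
  then show "flow_derivative \<gamma> f x = frechet_derivative F (at x) (A x)"
    by (intro flow_derivative_eq[OF _ local_extension_move[OF assms]]) auto
qed (use assms in \<open>auto simp: local_extension_def\<close>)

lemma flow_derivative_smooth:
  assumes "f \<in> smooth_functions G"
  shows "flow_derivative \<gamma> f \<in> smooth_functions G"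
  using assms local_extension_flow flow_derivative_off unfolding smooth_functions_iff by blast

lemma flow_derivative_scale:
  assumes f: "f \<in> smooth_functions G"
  shows "flow_derivative \<gamma> (fscale c f) = fscale c (flow_derivative \<gamma> f)"
proof (rule smooth_functions_eqI[OF f])
  fix x U F assume x: "x \<in> G" and ext: "local_extension G f x U F"
  have "frechet_derivative (\<lambda>x. c * F x) (at x) = (\<lambda>v. c * frechet_derivative F (at x) v)"
    by (intro frechet_derivative_eq has_derivative_mult_right has_derivative_frechet
        local_extension_differentiable[OF ext])
  then show "flow_derivative \<gamma> (fscale c f) x = fscale c (flow_derivative \<gamma> f) x"
    using flow_derivative_eq[OF x local_extension_scale[OF ext]] flow_derivative_eq[OF x ext]
    by (simp add: fscale_def)
qed (simp add: flow_derivative_off fscale_def smooth_functions_off[OF f])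

lemma flow_derivative_add:
  assumes f: "f \<in> smooth_functions G" and f': "f' \<in> smooth_functions G"
  shows "flow_derivative \<gamma> (f + f') = flow_derivative \<gamma> f + flow_derivative \<gamma> f'"
proof (rule smooth_functions_eqI[OF f])
  fix x U F assume x: "x \<in> G" and ext: "local_extension G f x U F"
  obtain U' F' where ext': "local_extension G f' x U' F'"
    using f' x smooth_functions_iff by blast
  have "frechet_derivative (\<lambda>x. F x + F' x) (at x) =
      (\<lambda>v. frechet_derivative F (at x) v + frechet_derivative F' (at x) v)"
    by (intro frechet_derivative_eq has_derivative_add has_derivative_frechet
        local_extension_differentiable[OF ext] local_extension_differentiable[OF ext'])
  then show "flow_derivative \<gamma> (f + f') x = (flow_derivative \<gamma> f + flow_derivative \<gamma> f') x"
    using flow_derivative_eq[OF x local_extension_add[OF ext ext']]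
    by (simp add: flow_derivative_eq[OF x ext] flow_derivative_eq[OF x ext'])
qed (simp add: flow_derivative_off smooth_functions_off[OF f] smooth_functions_off[OF f'])

end

lemma flow_derivative_linear:
  assumes "flow_field G A \<alpha>" "flow_field G B \<beta>" "flow_field G C \<gamma>"
    and C: "\<And>x. x \<in> G \<Longrightarrow> C x = r *\<^sub>R A x + s *\<^sub>R B x" and f: "f \<in> smooth_functions G"
  shows "flow_derivative \<gamma> f = fscale (of_real r) (flow_derivative \<alpha> f) + fscale (of_real s) (flow_derivative \<beta> f)"
proof -
  interpret A: flow_field G A \<alpha> by fact
  interpret B: flow_field G B \<beta> by fact
  interpret C: flow_field G C \<gamma> by fact
  show ?thesis
  proof (rule smooth_functions_eqI[OF f])
    fix x U F assume x: "x \<in> G" and ext: "local_extension G f x U F"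
    have lin: "linear (frechet_derivative F (at x))"
      by (rule linear_frechet_derivative[OF local_extension_differentiable[OF ext]])
    show "flow_derivative \<gamma> f x =
        (fscale (of_real r) (flow_derivative \<alpha> f) + fscale (of_real s) (flow_derivative \<beta> f)) x"
      by (simp add: A.flow_derivative_eq[OF x ext] B.flow_derivative_eq[OF x ext] C.flow_derivative_eq[OF x ext]
          C[OF x] linear_add[OF lin] linear_scale[OF lin] fscale_def flip: scaleR_conv_of_real)
  qed (simp add: A.flow_derivative_off B.flow_derivative_off C.flow_derivative_off fscale_def
      smooth_functions_off[OF f])
qed

lemma frechet_derivative_vector_field:
  fixes F :: "'a::euclidean_space \<Rightarrow> 'b::banach"
  assumes U: "open U" "x \<in> U" and F: "Ck_on 2 U F" and B: "bounded_linear B"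
  shows "frechet_derivative (\<lambda>y. frechet_derivative F (at y) (B y)) (at x) w =
    frechet_derivative F (at x) (B w) + frechet_derivative (\<lambda>y. frechet_derivative F (at y) w) (at x) (B x)"
proof -
  have C2: "Ck_on (Suc (Suc 0)) U F" using F by (simp add: numeral_2_eq_2)
  have diff: "F differentiable (at y)" if "y \<in> U" for y using C2 that by simp
  have diff_D: "(\<lambda>y. frechet_derivative F (at y) b) differentiable (at x)" for b using C2 U by simp
  let ?H = "\<lambda>y. \<Sum>b\<in>Basis. (B y \<bullet> b) *\<^sub>R frechet_derivative F (at y) b"
  have "frechet_derivative (\<lambda>y. frechet_derivative F (at y) (B y)) (at x) = frechet_derivative ?H (at x)"
    by (rule frechet_derivative_cong_open[OF U]) (rule frechet_derivative_euclidean_sum[OF diff])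
  also have "\<dots> = (\<lambda>w. \<Sum>b\<in>Basis. (B x \<bullet> b) *\<^sub>R frechet_derivative (\<lambda>y. frechet_derivative F (at y) b) (at x) w
        + (B w \<bullet> b) *\<^sub>R frechet_derivative F (at x) b)"
  proof (rule frechet_derivative_eq, intro has_derivative_sum has_derivative_scaleR)
    fix b
    show "((\<lambda>y. frechet_derivative F (at y) b) has_derivative
        frechet_derivative (\<lambda>y. frechet_derivative F (at y) b) (at x)) (at x)"
      by (rule has_derivative_frechet[OF diff_D])
    show "((\<lambda>y. B y \<bullet> b) has_derivative (\<lambda>w. B w \<bullet> b)) (at x)"
      by (intro has_derivative_inner_left bounded_linear_imp_has_derivative B)
  qed
  finally have "frechet_derivative (\<lambda>y. frechet_derivative F (at y) (B y)) (at x) w =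
      (\<Sum>b\<in>Basis. (B x \<bullet> b) *\<^sub>R frechet_derivative (\<lambda>y. frechet_derivative F (at y) w) (at x) b)
        + (\<Sum>b\<in>Basis. (B w \<bullet> b) *\<^sub>R frechet_derivative F (at x) b)"
    using second_derivative_symmetric[OF U F] by (simp add: sum.distrib)
  then show ?thesis
    using frechet_derivative_euclidean_sum[OF diff[OF U(2)], of "B w"]
      frechet_derivative_euclidean_sum[OF diff_D, of w "B x"] by simp
qed

lemma flow_derivative_commutator:
  assumes "flow_field G A \<alpha>" "flow_field G B \<beta>" "flow_field G C \<gamma>"
    and C: "\<And>x. x \<in> G \<Longrightarrow> C x = B (A x) - A (B x)" and f: "f \<in> smooth_functions G"
  shows "flow_derivative \<gamma> f =
    flow_derivative \<alpha> (flow_derivative \<beta> f) - flow_derivative \<beta> (flow_derivative \<alpha> f)"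
proof -
  interpret A: flow_field G A \<alpha> by fact
  interpret B: flow_field G B \<beta> by fact
  interpret C: flow_field G C \<gamma> by fact
  show ?thesis
  proof (rule smooth_functions_eqI[OF f])
    fix x U F assume x: "x \<in> G" and ext: "local_extension G f x U F"
    then have U: "open U" "x \<in> U" and F: "\<And>k. Ck_on k U F"
      by (auto simp: local_extension_def)
    let ?D = "\<lambda>y. frechet_derivative F (at y)"
    have lin: "linear (?D x)"
      by (rule linear_frechet_derivative[OF local_extension_differentiable[OF ext]])
    have "flow_derivative \<alpha> (flow_derivative \<beta> f) x =
        ?D x (B (A x)) + frechet_derivative (\<lambda>y. ?D y (A x)) (at x) (B x)"
      using A.flow_derivative_eq[OF x B.local_extension_flow[OF ext]]
        frechet_derivative_vector_field[OF U F B.linear] by simp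
    moreover have "flow_derivative \<beta> (flow_derivative \<alpha> f) x =
        ?D x (A (B x)) + frechet_derivative (\<lambda>y. ?D y (B x)) (at x) (A x)"
      using B.flow_derivative_eq[OF x A.local_extension_flow[OF ext]]
        frechet_derivative_vector_field[OF U F A.linear] by simp
    moreover have "frechet_derivative (\<lambda>y. ?D y (A x)) (at x) (B x) =
        frechet_derivative (\<lambda>y. ?D y (B x)) (at x) (A x)"
      by (rule second_derivative_symmetric[OF U F])
    ultimately show "flow_derivative \<gamma> f x =
        (flow_derivative \<alpha> (flow_derivative \<beta> f) - flow_derivative \<beta> (flow_derivative \<alpha> f)) x"
      using C.flow_derivative_eq[OF x ext] by (simp add: C[OF x] linear_diff[OF lin])
  next
    fix x assume x: "x \<notin> G"
    then show "flow_derivative \<gamma> f x =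
        (flow_derivative \<alpha> (flow_derivative \<beta> f) - flow_derivative \<beta> (flow_derivative \<alpha> f)) x"
      using A.flow_derivative_off[OF x, of "flow_derivative \<beta> f"] B.flow_derivative_off[OF x, of "flow_derivative \<alpha> f"]
      by (simp add: A.flow_derivative_off B.flow_derivative_off C.flow_derivative_off smooth_functions_off[OF f])
  qed
qed

lemma real_lie_rep_flow:
  fixes A :: "real^'n^'n \<Rightarrow> real^'n^'n \<Rightarrow> real^'n^'n"
  assumes "subspace \<gg>" and bracket: "\<And>X Y. X \<in> \<gg> \<Longrightarrow> Y \<in> \<gg> \<Longrightarrow> bracket X Y \<in> \<gg>"
    and field: "\<And>X. X \<in> \<gg> \<Longrightarrow> flow_field G (A X) (\<gamma> X)"
    and lin: "\<And>X Y r s x. A (r *\<^sub>R X + s *\<^sub>R Y) x = r *\<^sub>R A X x + s *\<^sub>R A Y x"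
    and comm: "\<And>X Y x. A (bracket X Y) x = A Y (A X x) - A X (A Y x)"
  shows "real_lie_rep \<gg> (\<lambda>X. flow_derivative (\<gamma> X)) (smooth_functions G)"
proof
  fix X Y f r s
  assume X: "X \<in> \<gg>" and Y: "Y \<in> \<gg>" and f: "f \<in> smooth_functions G"
  have comb: "r *\<^sub>R X + s *\<^sub>R Y \<in> \<gg>"
    using X Y assms(1) by (intro subspace_add subspace_mul)
  show "flow_derivative (\<gamma> (r *\<^sub>R X + s *\<^sub>R Y)) f =
      fscale (of_real r) (flow_derivative (\<gamma> X) f) + fscale (of_real s) (flow_derivative (\<gamma> Y) f)"
    by (rule flow_derivative_linear[OF field[OF X] field[OF Y] field[OF comb] _ f]) (rule lin)
  show "flow_derivative (\<gamma> (bracket X Y)) f =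
      flow_derivative (\<gamma> X) (flow_derivative (\<gamma> Y) f) - flow_derivative (\<gamma> Y) (flow_derivative (\<gamma> X) f)"
    by (rule flow_derivative_commutator[OF field[OF X] field[OF Y] field[OF bracket[OF X Y]] _ f]) (rule comm)
next
  fix X assume X: "X \<in> \<gg>"
  show "flow_derivative (\<gamma> X) f \<in> smooth_functions G" if "f \<in> smooth_functions G" for f
    by (rule flow_field.flow_derivative_smooth[OF field[OF X] that])
  show "linear_on fscale fscale (smooth_functions G) (flow_derivative (\<gamma> X))"
    by (intro linear_onI flow_field.flow_derivative_scale[OF field[OF X]]
        flow_field.flow_derivative_add[OF field[OF X]])
qed (fact assms(1) | rule subspace_smooth_functions | rule bracket; assumption)+

lemma R_real_flow: "R_real = (\<lambda>X. flow_derivative (\<lambda>x t. x ** mexp (t *\<^sub>R X)))"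
  by (intro ext) (simp add: R_real_def flow_derivative_def)

lemma L_real_flow: "L_real = (\<lambda>X. flow_derivative (\<lambda>x t. mexp ((- t) *\<^sub>R X) ** x))"
  by (intro ext) (simp add: L_real_def flow_derivative_def)

lemma R_lie_complexify: "R_lie = complexify_action R_real"
  by (intro ext) (simp add: R_lie_def complexify_action_def fscale_def)

lemma L_lie_complexify: "L_lie = complexify_action L_real"
  by (intro ext) (simp add: L_lie_def complexify_action_def fscale_def)

context closed_linear_group
begin

lemma flow_field_right:
  assumes X: "X \<in> lie_algebra G"
  shows "flow_field G (\<lambda>x. x ** X) (\<lambda>x t. x ** mexp (t *\<^sub>R X))"
proof (rule flow_field.intro)
  show "bounded_linear (\<lambda>x :: real^'n^'n. x ** X)"
    by (rule matrix_mult.bounded_linear_left)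
  fix x :: "real^'n^'n" and t :: real
  show "x ** mexp (t *\<^sub>R X) \<in> G \<longleftrightarrow> x \<in> G"
    by (rule mult_mem_cancel_right[OF mexp_mem[OF X]])
  show "((\<lambda>t. x ** mexp (t *\<^sub>R X)) has_vector_derivative x ** X) (at 0)"
    by (rule bounded_linear.has_vector_derivative[OF
          matrix_mult.bounded_linear_right
          mexp_has_vector_derivative])
qed simp

lemma flow_field_left:
  assumes X: "X \<in> lie_algebra G"
  shows "flow_field G (\<lambda>x. (- X) ** x) (\<lambda>x t. mexp ((- t) *\<^sub>R X) ** x)"
proof (rule flow_field.intro)
  show "bounded_linear (\<lambda>x :: real^'n^'n. (- X) ** x)"
    by (rule matrix_mult.bounded_linear_right)
  fix x :: "real^'n^'n" and t :: real
  show "mexp ((- t) *\<^sub>R X) ** x \<in> G \<longleftrightarrow> x \<in> G"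
    by (rule mult_mem_cancel_left[OF mexp_mem[OF X]])
  have "((\<lambda>t. mexp (t *\<^sub>R (- X)) ** x) has_vector_derivative (- X) ** x) (at 0)"
    by (rule bounded_linear.has_vector_derivative[OF
          matrix_mult.bounded_linear_left
          mexp_has_vector_derivative])
  then show "((\<lambda>t. mexp ((- t) *\<^sub>R X) ** x) has_vector_derivative (- X) ** x) (at 0)"
    by simp
qed simp

lemma real_lie_rep_R:
  assumes "subspace \<gg>" "\<And>X Y. X \<in> \<gg> \<Longrightarrow> Y \<in> \<gg> \<Longrightarrow> bracket X Y \<in> \<gg>" "\<gg> \<subseteq> lie_algebra G"
  shows "real_lie_rep \<gg> R_real (smooth_functions G)"
  unfolding R_real_flow
proof (rule real_lie_rep_flow[where A="\<lambda>X x. x ** X" and \<gamma>="\<lambda>X x t. x ** mexp (t *\<^sub>R X)", OF assms(1,2)])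
  fix X assume "X \<in> \<gg>"
  then show "flow_field G (\<lambda>x. x ** X) (\<lambda>x t. x ** mexp (t *\<^sub>R X))"
    using assms(3) by (intro flow_field_right) blast
qed (simp_all only: bracket_def matrix_mult.add_right matrix_mult.scaleR_right matrix_mult.diff_right matrix_mul_assoc)

lemma real_lie_rep_L:
  assumes "subspace \<gg>" "\<And>X Y. X \<in> \<gg> \<Longrightarrow> Y \<in> \<gg> \<Longrightarrow> bracket X Y \<in> \<gg>" "\<gg> \<subseteq> lie_algebra G"
  shows "real_lie_rep \<gg> L_real (smooth_functions G)"
  unfolding L_real_flow
proof (rule real_lie_rep_flow[where A="\<lambda>X x. (- X) ** x" and \<gamma>="\<lambda>X x t. mexp ((- t) *\<^sub>R X) ** x", OF assms(1,2)])
  fix X assume "X \<in> \<gg>"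
  then show "flow_field G (\<lambda>x. (- X) ** x) (\<lambda>x t. mexp ((- t) *\<^sub>R X) ** x)"
    using assms(3) by (intro flow_field_left) blast
qed (simp_all add: bracket_def matrix_mult.minus_left matrix_mult.minus_right matrix_mult.diff_left
    matrix_mult.add_left matrix_mult.scaleR_left matrix_mul_assoc)

lemma lie_rep_R:
  assumes "subspace \<gg>" "\<And>X Y. X \<in> \<gg> \<Longrightarrow> Y \<in> \<gg> \<Longrightarrow> bracket X Y \<in> \<gg>" "\<gg> \<subseteq> lie_algebra G"
  shows "lie_rep (complexification \<gg>) R_lie (smooth_functions G)"
  unfolding R_lie_complexify using real_lie_rep_R[OF assms] by (rule real_lie_rep.lie_rep_complexify)

lemma lie_rep_L:
  assumes "subspace \<gg>" "\<And>X Y. X \<in> \<gg> \<Longrightarrow> Y \<in> \<gg> \<Longrightarrow> bracket X Y \<in> \<gg>" "\<gg> \<subseteq> lie_algebra G"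
  shows "lie_rep (complexification \<gg>) L_lie (smooth_functions G)"
  unfolding L_lie_complexify using real_lie_rep_L[OF assms] by (rule real_lie_rep.lie_rep_complexify)

end

section \<open>The free algebra\<close>

definition fmul :: "('a list \<Rightarrow> complex) \<Rightarrow> ('a list \<Rightarrow> complex) \<Rightarrow> 'a list \<Rightarrow> complex" where
  "fmul u v w = (\<Sum>k\<le>length w. u (take k w) * v (drop k w))"

text \<open>A linear functional on the free algebra is the same as an arbitrary function \<open>\<alpha>\<close> on words.\<close>
definition pairing :: "('a \<Rightarrow> complex) \<Rightarrow> ('a \<Rightarrow> complex) \<Rightarrow> complex" where
  "pairing u \<alpha> = (\<Sum>w | u w \<noteq> 0. u w * \<alpha> w)"

abbreviation finsupp :: "('a \<Rightarrow> complex) \<Rightarrow> bool" where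
  "finsupp u \<equiv> finite {w. u w \<noteq> 0}"

lemma sum_fun_apply: "(\<Sum>i\<in>I. f i) x = (\<Sum>i\<in>I. f i x)" for f :: "'i \<Rightarrow> 'a \<Rightarrow> complex"
  by (induction I rule: infinite_finite_induct) auto

lemma pairing_superset: "finite A \<Longrightarrow> {w. u w \<noteq> 0} \<subseteq> A \<Longrightarrow> pairing u \<alpha> = (\<Sum>w\<in>A. u w * \<alpha> w)"
  unfolding pairing_def by (rule sum.mono_neutral_left) auto

lemma finsupp_add: "finsupp u \<Longrightarrow> finsupp v \<Longrightarrow> finsupp (u + v)"
  by (rule finite_subset[of _ "{w. u w \<noteq> 0} \<union> {w. v w \<noteq> 0}"]) auto

lemma finsupp_diff: "finsupp u \<Longrightarrow> finsupp v \<Longrightarrow> finsupp (u - v)"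
  by (rule finite_subset[of _ "{w. u w \<noteq> 0} \<union> {w. v w \<noteq> 0}"]) auto

lemma finsupp_scale: "finsupp u \<Longrightarrow> finsupp (fscale c u)"
  by (rule finite_subset[of _ "{w. u w \<noteq> 0}"]) (auto simp: fscale_def)

lemma finsupp_word: "finsupp (word_ind v)"
  by (rule finite_subset[of _ "{v}"]) (auto simp: word_ind_def)

lemma pairing_zero [simp]: "pairing 0 \<alpha> = 0"
  by (simp add: pairing_def)

lemma pairing_add:
  assumes "finsupp u" "finsupp v"
  shows "pairing (u + v) \<alpha> = pairing u \<alpha> + pairing v \<alpha>"
proof -
  let ?A = "{w. u w \<noteq> 0} \<union> {w. v w \<noteq> 0}"
  have "pairing (u + v) \<alpha> = (\<Sum>w\<in>?A. (u + v) w * \<alpha> w)"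
    by (rule pairing_superset) (use assms in auto)
  also have "\<dots> = (\<Sum>w\<in>?A. u w * \<alpha> w) + (\<Sum>w\<in>?A. v w * \<alpha> w)"
    by (simp add: distrib_right sum.distrib)
  also have "(\<Sum>w\<in>?A. u w * \<alpha> w) = pairing u \<alpha>"
    by (rule pairing_superset[symmetric]) (use assms in auto)
  also have "(\<Sum>w\<in>?A. v w * \<alpha> w) = pairing v \<alpha>"
    by (rule pairing_superset[symmetric]) (use assms in auto)
  finally show ?thesis .
qed

lemma pairing_scale: "pairing (fscale c u) \<alpha> = c * pairing u \<alpha>"
  by (cases "c = 0") (auto simp: pairing_def fscale_def sum_distrib_left mult.assoc)

lemma pairing_diff:
  assumes "finsupp u" "finsupp v"
  shows "pairing (u - v) \<alpha> = pairing u \<alpha> - pairing v \<alpha>"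
proof -
  have "u - v = u + fscale (-1) v"
    by simp
  then show ?thesis
    by (simp only: pairing_add[OF assms(1) finsupp_scale[OF assms(2)]] pairing_scale) simp
qed

lemma pairing_word [simp]: "pairing (word_ind v) \<alpha> = \<alpha> v"
  by (subst pairing_superset[of "{v}"]) (auto simp: word_ind_def)

lemma pairing_delta: "finsupp u \<Longrightarrow> pairing u (\<lambda>v. if v = w then 1 else 0) = u w"
  by (auto simp: pairing_def if_distrib cong: if_cong)

lemma pairing_ext:
  "finsupp u \<Longrightarrow> finsupp v \<Longrightarrow> (\<And>\<alpha>. pairing u \<alpha> = pairing v \<alpha>) \<Longrightarrow> u = v"
  using pairing_delta by (metis ext)

lemma pairing_mult_right: "pairing u (\<lambda>w. c * \<alpha> w) = c * pairing u \<alpha>"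
  by (simp add: pairing_def sum_distrib_left mult_ac)

lemma pairing_add_right: "pairing u (\<lambda>w. \<alpha> w + \<beta> w) = pairing u \<alpha> + pairing u \<beta>"
  by (simp add: pairing_def distrib_left sum.distrib)

lemma pairing_zero_right: "pairing u (\<lambda>w. 0) = 0"
  by (simp add: pairing_def)

lemma pairing_cong: "(\<And>w. u w \<noteq> 0 \<Longrightarrow> \<alpha> w = \<beta> w) \<Longrightarrow> pairing u \<alpha> = pairing u \<beta>"
  by (auto simp: pairing_def intro: sum.cong)

lemma finsupp_sum: "(\<And>i. i \<in> I \<Longrightarrow> finsupp (u i)) \<Longrightarrow> finsupp (\<Sum>i\<in>I. u i)"
  by (induction I rule: infinite_finite_induct) (auto intro: finsupp_add simp del: plus_fun_apply)

lemma word_expansion: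
  assumes "finsupp u"
  shows "u = (\<Sum>w | u w \<noteq> 0. fscale (u w) (word_ind w))"
proof
  fix v
  have "(\<Sum>w | u w \<noteq> 0. fscale (u w) (word_ind w)) v = (\<Sum>w | u w \<noteq> 0. if v = w then u w else 0)"
    unfolding sum_fun_apply by (rule sum.cong) (auto simp: fscale_def word_ind_def)
  then show "u v = (\<Sum>w | u w \<noteq> 0. fscale (u w) (word_ind w)) v"
    using assms by simp
qed

lemma fmul_nonzero:
  assumes "fmul u v w \<noteq> 0"
  obtains a b where "u a \<noteq> 0" "v b \<noteq> 0" "w = a @ b"
proof -
  obtain k where "u (take k w) * v (drop k w) \<noteq> 0"
    using assms sum.not_neutral_contains_not_neutral unfolding fmul_def by blast
  then show thesis
    using that[of "take k w" "drop k w"] by auto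
qed

lemma finsupp_fmul: "finsupp u \<Longrightarrow> finsupp v \<Longrightarrow> finsupp (fmul u v)"
  by (rule finite_subset[of _ "(\<lambda>(a, b). a @ b) ` ({w. u w \<noteq> 0} \<times> {w. v w \<noteq> 0})"])
    (auto elim!: fmul_nonzero)

lemma bij_betw_take_drop:
  "bij_betw (\<lambda>k. (take k w, drop k w)) {..length w} {p. fst p @ snd p = w}"
proof (rule bij_betwI')
  fix k l assume "k \<in> {..length w}" "l \<in> {..length w}"
  then show "((take k w, drop k w) = (take l w, drop l w)) = (k = l)"
    by (metis atMost_iff length_take min.absorb2 prod.inject)
next
  fix p assume "p \<in> {p. fst p @ snd p = w}"
  then show "\<exists>k\<in>{..length w}. p = (take k w, drop k w)"
    by (intro bexI[of _ "length (fst p)"]) (auto simp: prod_eq_iff)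
qed auto

lemma pairing_fmul:
  assumes u: "finsupp u" and v: "finsupp v"
  shows "pairing (fmul u v) \<alpha> = pairing u (\<lambda>a. pairing v (\<lambda>b. \<alpha> (a @ b)))"
proof -
  let ?S = "{w. u w \<noteq> 0} \<times> {w. v w \<noteq> 0}"
  let ?h = "\<lambda>p. u (fst p) * v (snd p) * \<alpha> (fst p @ snd p)"
  let ?T = "(\<lambda>p. fst p @ snd p) ` ?S"
  have fin: "finite ?S" using u v by simp
  have splits: "fmul u v w * \<alpha> w = (\<Sum>p | p \<in> ?S \<and> fst p @ snd p = w. ?h p)" for w
  proof -
    have "fmul u v w * \<alpha> w = (\<Sum>k\<le>length w. ?h (take k w, drop k w))"
      by (simp add: fmul_def sum_distrib_right)
    also have "\<dots> = (\<Sum>p | fst p @ snd p = w. ?h p)"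
      by (rule sum.reindex_bij_betw[OF bij_betw_take_drop])
    also have "\<dots> = (\<Sum>p | p \<in> ?S \<and> fst p @ snd p = w. ?h p)"
      by (rule sum.mono_neutral_right) (use bij_betw_finite[OF bij_betw_take_drop] in auto)
    finally show ?thesis .
  qed
  have "w \<in> ?T" if nonzero: "fmul u v w \<noteq> 0" for w
    by (rule fmul_nonzero[OF nonzero]) (auto intro!: image_eqI[of _ _ "(_, _)"])
  then have "pairing (fmul u v) \<alpha> = (\<Sum>w\<in>?T. fmul u v w * \<alpha> w)"
    by (intro pairing_superset) (use fin in auto)
  also have "\<dots> = (\<Sum>w\<in>?T. \<Sum>p | p \<in> ?S \<and> fst p @ snd p = w. ?h p)"
    by (simp only: splits)
  also have "\<dots> = (\<Sum>p\<in>?S. ?h p)"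
    by (rule sum.group) (use fin in auto)
  also have "\<dots> = pairing u (\<lambda>a. pairing v (\<lambda>b. \<alpha> (a @ b)))"
    unfolding pairing_def by (simp add: sum.cartesian_product sum_distrib_left case_prod_beta mult.assoc)
  finally show ?thesis .
qed

lemma fmul_word: "fmul (word_ind a) (word_ind b) = word_ind (a @ b)"
  by (rule pairing_ext) (simp_all add: pairing_fmul finsupp_fmul finsupp_word)

lemma fmul_assoc:
  assumes "finsupp u" "finsupp v" "finsupp x"
  shows "fmul (fmul u v) x = fmul u (fmul v x)"
  by (rule pairing_ext) (use assms in \<open>simp_all add: pairing_fmul finsupp_fmul\<close>)

lemma fmul_one_left: "fmul (word_ind []) u = u"
proof
  fix w
  have "fmul (word_ind []) u w = (\<Sum>k\<in>{0}. word_ind [] (take k w) * u (drop k w))"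
    unfolding fmul_def by (rule sum.mono_neutral_right) (auto simp: word_ind_def)
  then show "fmul (word_ind []) u w = u w"
    by (simp add: word_ind_def)
qed

lemma fmul_one_right: "fmul u (word_ind []) = u"
proof
  fix w
  have "fmul u (word_ind []) w = (\<Sum>k\<in>{length w}. u (take k w) * word_ind [] (drop k w))"
    unfolding fmul_def by (rule sum.mono_neutral_right) (auto simp: word_ind_def)
  then show "fmul u (word_ind []) w = u w"
    by (simp add: word_ind_def)
qed

lemma fmul_add_left: "fmul (u + v) x = fmul u x + fmul v x"
  by (simp add: fmul_def fun_eq_iff distrib_right sum.distrib)

lemma fmul_add_right: "fmul x (u + v) = fmul x u + fmul x v"
  by (simp add: fmul_def fun_eq_iff distrib_left sum.distrib)

lemma fmul_diff_left: "fmul (u - v) x = fmul u x - fmul v x"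
  by (simp add: fmul_def fun_eq_iff left_diff_distrib sum_subtractf)

lemma fmul_diff_right: "fmul x (u - v) = fmul x u - fmul x v"
  by (simp add: fmul_def fun_eq_iff right_diff_distrib sum_subtractf)

lemma fmul_scale_left: "fmul (fscale c u) x = fscale c (fmul u x)"
  by (simp add: fmul_def fun_eq_iff fscale_def sum_distrib_left mult.assoc)

lemma fmul_scale_right: "fmul x (fscale c u) = fscale c (fmul x u)"
  by (simp add: fmul_def fun_eq_iff fscale_def sum_distrib_left mult_ac)

lemma fmul_zero [simp]: "fmul 0 x = 0" "fmul x 0 = 0" "fmul (\<lambda>w. 0) x = (\<lambda>w. 0)" "fmul x (\<lambda>w. 0) = (\<lambda>w. 0)"
  by (simp_all add: fmul_def fun_eq_iff)

abbreviation FA :: "'a set \<Rightarrow> ('a list \<Rightarrow> complex) set" where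
  "FA S \<equiv> carrier (free_alg S)"

lemma FA_iff: "u \<in> FA S \<longleftrightarrow> finsupp u \<and> (\<forall>w. u w \<noteq> 0 \<longrightarrow> set w \<subseteq> S)"
  by (simp add: free_alg_def)

lemma free_alg_simps [simp]:
  "mult (free_alg S) = fmul" "one (free_alg S) = word_ind []"
  "zero (free_alg S) = 0" "add (free_alg S) = (+)"
  by (auto simp: free_alg_def fmul_def word_ind_def fun_eq_iff)

lemma FA_finsupp: "u \<in> FA S \<Longrightarrow> finsupp u"
  by (simp add: FA_iff)

lemma FA_zero: "0 \<in> FA S"
  by (simp add: FA_iff)

lemma FA_add: "u \<in> FA S \<Longrightarrow> v \<in> FA S \<Longrightarrow> u + v \<in> FA S"
  by (auto simp: FA_iff finsupp_add simp del: plus_fun_apply) (metis add_cancel_left_left plus_fun_apply subsetD)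

lemma FA_scale: "u \<in> FA S \<Longrightarrow> fscale c u \<in> FA S"
  using finsupp_scale[of u c] by (auto simp: FA_iff fscale_def)

lemma FA_diff: "u \<in> FA S \<Longrightarrow> v \<in> FA S \<Longrightarrow> u - v \<in> FA S"
  using FA_add[of u S "fscale (-1) v"] FA_scale[of v S "-1"]
  by (simp add: fscale_def fun_diff_def plus_fun_def)

lemma FA_fmul: "u \<in> FA S \<Longrightarrow> v \<in> FA S \<Longrightarrow> fmul u v \<in> FA S"
  unfolding FA_iff using finsupp_fmul fmul_nonzero by (metis Un_least set_append)

lemma FA_word: "set w \<subseteq> S \<Longrightarrow> word_ind w \<in> FA S"
  by (auto simp: FA_iff finsupp_word) (auto simp: word_ind_def split: if_splits)

lemma subspace_FA: "fun_vs.subspace (FA S)"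
  by (rule fun_vs.subspaceI) (auto intro: FA_zero FA_add FA_scale)

lemma ring_free_alg: "ring (free_alg S)"
proof (rule ringI)
  show "abelian_group (free_alg S)"
  proof (rule abelian_groupI)
    fix u assume u: "u \<in> FA S"
    then have "fscale (-1) u \<in> FA S" by (rule FA_scale)
    then show "\<exists>v\<in>FA S. v \<oplus>\<^bsub>free_alg S\<^esub> u = \<zero>\<^bsub>free_alg S\<^esub>"
      by (intro bexI[of _ "fscale (-1) u"]) (auto simp: fscale_def fun_eq_iff)
  qed (auto simp: FA_zero FA_add ac_simps)
  show "Group.monoid (free_alg S)"
    by (rule monoidI) (auto simp: FA_fmul FA_word fmul_assoc FA_finsupp fmul_one_left fmul_one_right)
qed (auto simp: fmul_add_left fmul_add_right)

lemma free_alg_minus: "u \<in> FA S \<Longrightarrow> v \<in> FA S \<Longrightarrow> u \<ominus>\<^bsub>free_alg S\<^esub> v = u - v"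
proof -
  interpret ring "free_alg S" by (rule ring_free_alg)
  assume u: "u \<in> FA S" and v: "v \<in> FA S"
  have "\<ominus>\<^bsub>free_alg S\<^esub> v = fscale (-1) v"
    by (rule minus_equality) (use v FA_scale[OF v, of "-1"] in \<open>auto simp: fscale_def fun_eq_iff\<close>)
  then show ?thesis
    unfolding a_minus_def by (auto simp: fscale_def fun_eq_iff)
qed

lemma free_alg_idealI:
  assumes "J \<subseteq> FA S" "0 \<in> J" "\<And>u v. u \<in> J \<Longrightarrow> v \<in> J \<Longrightarrow> u + v \<in> J"
    and "\<And>u x. u \<in> J \<Longrightarrow> x \<in> FA S \<Longrightarrow> fmul x u \<in> J" "\<And>u x. u \<in> J \<Longrightarrow> x \<in> FA S \<Longrightarrow> fmul u x \<in> J"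
  shows "ideal J (free_alg S)"
proof (rule idealI[OF ring_free_alg])
  interpret ring "free_alg S" by (rule ring_free_alg)
  show "subgroup J (add_monoid (free_alg S))"
  proof (rule group.subgroupI[OF a_group])
    fix u assume u: "u \<in> J"
    then have "fmul (fscale (-1) (word_ind [])) u \<in> J"
      by (intro assms FA_scale FA_word) auto
    then have "fscale (-1) u \<in> J"
      by (simp only: fmul_scale_left fmul_one_left)
    moreover have "\<ominus>\<^bsub>free_alg S\<^esub> u = fscale (-1) u"
      by (rule minus_equality)
        (use u assms(1) FA_scale[of u S "-1"] in \<open>auto simp: fscale_def fun_eq_iff\<close>)
    ultimately show "inv\<^bsub>add_monoid (free_alg S)\<^esub> u \<in> J"
      by (simp add: a_inv_def)
  qed (use assms in auto)
qed (use assms in auto)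

context
  fixes J :: "('a list \<Rightarrow> complex) set" and S :: "'a set"
  assumes ideal: "ideal J (free_alg S)"
begin

lemma free_alg_ideal_FA: "u \<in> J \<Longrightarrow> u \<in> FA S"
  using additive_subgroup.a_subset[OF ideal.axioms(1)[OF ideal]] by auto

lemma free_alg_ideal_fmul_left: "u \<in> J \<Longrightarrow> x \<in> FA S \<Longrightarrow> fmul x u \<in> J"
  using ideal.I_l_closed[OF ideal, of u x] by simp

lemma free_alg_ideal_fmul_right: "u \<in> J \<Longrightarrow> x \<in> FA S \<Longrightarrow> fmul u x \<in> J"
  using ideal.I_r_closed[OF ideal, of u x] by simp

lemma subspace_free_alg_ideal: "fun_vs.subspace J"
proof (rule fun_vs.subspaceI)
  show "0 \<in> J"
    using additive_subgroup.zero_closed[OF ideal.axioms(1)[OF ideal]] by simp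
  show "u + v \<in> J" if "u \<in> J" "v \<in> J" for u v
    using additive_subgroup.a_closed[OF ideal.axioms(1)[OF ideal] that] by simp
  show "fscale c u \<in> J" if "u \<in> J" for c u
    using free_alg_ideal_fmul_left[OF that, of "fscale c (word_ind [])"]
    by (simp add: FA_scale FA_word fmul_scale_left fmul_one_left)
qed

end

lemma FA_subset_if_left_closed:
  assumes W: "fun_vs.subspace W" and one: "word_ind [] \<in> W"
    and letter: "\<And>X u. X \<in> S \<Longrightarrow> u \<in> W \<Longrightarrow> fmul (word_ind [X]) u \<in> W"
  shows "FA S \<subseteq> W"
proof
  fix u assume u: "u \<in> FA S"
  have word: "word_ind w \<in> W" if "set w \<subseteq> S" for w
    using that
  proof (induction w)
    case (Cons X w)
    then have "fmul (word_ind [X]) (word_ind w) \<in> W"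
      by (intro letter) auto
    then show ?case by (simp add: fmul_word)
  qed (rule one)
  have "(\<Sum>w | u w \<noteq> 0. fscale (u w) (word_ind w)) \<in> W"
    by (intro fun_vs.subspace_sum[OF W] fun_vs.subspace_scale[OF W] word) (use u in \<open>auto simp: FA_iff\<close>)
  then show "u \<in> W"
    by (simp only: word_expansion[OF FA_finsupp[OF u], symmetric])
qed

subsection \<open>Functoriality\<close>

lemma push_words_nonzero:
  assumes "push_words h u w \<noteq> 0"
  obtains v where "u v \<noteq> 0" "w = map h v"
proof -
  have "{v. u v \<noteq> 0 \<and> map h v = w} \<noteq> {}"
    using assms unfolding push_words_def by (metis sum.empty)
  then show thesis using that by blast
qed

lemma finsupp_push: "finsupp u \<Longrightarrow> finsupp (push_words h u)"
  by (rule finite_subset[of _ "map h ` {w. u w \<noteq> 0}"]) (auto elim!: push_words_nonzero)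

lemma pairing_push:
  assumes "finsupp u"
  shows "pairing (push_words h u) \<alpha> = pairing u (\<lambda>w. \<alpha> (map h w))"
proof -
  let ?S = "{w. u w \<noteq> 0}"
  have "pairing (push_words h u) \<alpha> = (\<Sum>w\<in>map h ` ?S. push_words h u w * \<alpha> w)"
    by (rule pairing_superset) (use assms in \<open>auto elim!: push_words_nonzero\<close>)
  also have "\<dots> = (\<Sum>w\<in>map h ` ?S. \<Sum>v | v \<in> ?S \<and> map h v = w. u v * \<alpha> (map h v))"
    unfolding push_words_def sum_distrib_right by (intro sum.cong) auto
  also have "\<dots> = (\<Sum>v\<in>?S. u v * \<alpha> (map h v))"
    by (rule sum.group) (use assms in auto)
  finally show ?thesis by (simp add: pairing_def)
qed

lemma FA_push: "u \<in> FA S \<Longrightarrow> (\<And>X. X \<in> S \<Longrightarrow> h X \<in> T) \<Longrightarrow> push_words h u \<in> FA T"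
  unfolding FA_iff by (auto simp: finsupp_push elim!: push_words_nonzero) blast

lemma push_fmul:
  "finsupp u \<Longrightarrow> finsupp v \<Longrightarrow> push_words h (fmul u v) = fmul (push_words h u) (push_words h v)"
  by (rule pairing_ext) (simp_all add: finsupp_fmul finsupp_push pairing_push pairing_fmul)

lemma push_add: "finsupp u \<Longrightarrow> finsupp v \<Longrightarrow> push_words h (u + v) = push_words h u + push_words h v"
  by (rule pairing_ext) (simp_all add: finsupp_add finsupp_push pairing_push pairing_add del: plus_fun_apply)

lemma push_diff: "finsupp u \<Longrightarrow> finsupp v \<Longrightarrow> push_words h (u - v) = push_words h u - push_words h v"
  by (rule pairing_ext) (simp_all add: finsupp_diff finsupp_push pairing_push pairing_diff del: minus_apply)

lemma push_scale: "finsupp u \<Longrightarrow> push_words h (fscale c u) = fscale c (push_words h u)"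
  by (rule pairing_ext) (simp_all add: finsupp_scale finsupp_push pairing_push pairing_scale)

lemma push_word: "push_words h (word_ind w) = word_ind (map h w)"
  by (rule pairing_ext) (simp_all add: finsupp_word finsupp_push pairing_push)

lemma push_push: "finsupp u \<Longrightarrow> push_words h (push_words k u) = push_words (h \<circ> k) u"
  by (rule pairing_ext) (simp_all add: finsupp_push pairing_push)

lemma push_zero [simp]: "push_words h 0 = 0"
  by (auto simp: push_words_def)

lemma push_sum:
  "(\<And>i. i \<in> I \<Longrightarrow> finsupp (u i)) \<Longrightarrow> push_words h (\<Sum>i\<in>I. u i) = (\<Sum>i\<in>I. push_words h (u i))"
  by (induction I rule: infinite_finite_induct) (auto simp: push_add finsupp_sum simp del: plus_fun_apply)

subsection \<open>Functionals on the free algebra\<close>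

lemma linear_functional_pairing:
  assumes "Vector_Spaces.linear fscale (*) \<phi>" "finsupp u"
  shows "pairing u (\<lambda>w. \<phi> (word_ind w)) = \<phi> u"
proof -
  have "\<phi> u = \<phi> (\<Sum>w | u w \<noteq> 0. fscale (u w) (word_ind w))"
    by (rule arg_cong[OF word_expansion[OF assms(2)]])
  also have "\<dots> = (\<Sum>w | u w \<noteq> 0. u w * \<phi> (word_ind w))"
    by (simp add: functional.linear_sum[OF assms(1)] functional.linear_scale[OF assms(1)])
  finally show ?thesis by (simp add: pairing_def)
qed

lemma pairing_extends:
  assumes W: "fun_vs.subspace W" and \<phi>: "linear_on fscale (*) W \<phi>"
  obtains \<alpha> :: "'a list \<Rightarrow> complex" where "\<And>u. u \<in> W \<Longrightarrow> finsupp u \<Longrightarrow> pairing u \<alpha> = \<phi> u"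
proof -
  obtain \<psi> where \<psi>: "Vector_Spaces.linear fscale (*) \<psi>" "\<And>u. u \<in> W \<Longrightarrow> \<psi> u = \<phi> u"
    using functional.linear_on_extends[OF W \<phi>] by blast
  show thesis
    by (rule that[of "\<lambda>w. \<psi> (word_ind w)"]) (simp add: linear_functional_pairing[OF \<psi>(1)] \<psi>(2))
qed

lemma pairing_separates:
  assumes W: "fun_vs.subspace W" and x: "x \<notin> W" "finsupp x"
  obtains \<alpha> :: "'a list \<Rightarrow> complex" where
    "\<And>u. u \<in> W \<Longrightarrow> finsupp u \<Longrightarrow> pairing u \<alpha> = 0" "pairing x \<alpha> = 1"
proof -
  obtain B where B: "B \<subseteq> W" "fun_vs.independent B" "W \<subseteq> fun_vs.span B"
    using fun_vs.maximal_independent_subset[of W] by blast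
  have "x \<notin> fun_vs.span B"
    using fun_vs.span_minimal[OF B(1) W] x(1) by blast
  then have ind: "fun_vs.independent (insert x B)"
    using B(2) by (simp add: fun_vs.independent_insert)
  obtain \<psi> where \<psi>: "Vector_Spaces.linear fscale (*) \<psi>"
      "\<And>u. u \<in> insert x B \<Longrightarrow> \<psi> u = (if u = x then 1 else 0)"
    using functional.linear_independent_extend[OF ind, of "\<lambda>u. if u = x then 1 else 0"] by blast
  have "\<psi> u = 0" if "u \<in> fun_vs.span B" for u
    by (rule functional.linear_eq_0_on_span[OF \<psi>(1) _ that]) (use \<psi>(2) B(1) x(1) in auto)
  then have "pairing u (\<lambda>w. \<psi> (word_ind w)) = 0" if "u \<in> W" "finsupp u" for u
    using linear_functional_pairing[OF \<psi>(1) that(2)] that(1) B(3) by auto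
  moreover have "pairing x (\<lambda>w. \<psi> (word_ind w)) = 1"
    using linear_functional_pairing[OF \<psi>(1) x(2)] \<psi>(2) by auto
  ultimately show thesis using that by blast
qed

section \<open>Enveloping algebras\<close>

locale lie_subalg =
  fixes L :: "(complex^'n^'n) set"
  assumes zero_mem: "0 \<in> L"
    and lin_mem: "X \<in> L \<Longrightarrow> Y \<in> L \<Longrightarrow> msmult a X + msmult b Y \<in> L"
    and bracket_mem: "X \<in> L \<Longrightarrow> Y \<in> L \<Longrightarrow> bracket X Y \<in> L"
begin

lemma relations_cases:
  assumes "r \<in> uea_relations L"
  obtains (linear) a b X Y where "X \<in> L" "Y \<in> L"
      "r = word_ind [msmult a X + msmult b Y] - fscale a (word_ind [X]) - fscale b (word_ind [Y])"
    | (bracket) X Y where "X \<in> L" "Y \<in> L" "r = word_ind [X, Y] - word_ind [Y, X] - word_ind [bracket X Y]"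
  using assms that unfolding uea_relations_def fscale_def fun_diff_def by (elim UnE) (blast intro: that)+

lemma relations_subset: "uea_relations L \<subseteq> FA L"
proof
  fix r assume "r \<in> uea_relations L"
  then show "r \<in> FA L"
    by (cases rule: relations_cases) (auto intro!: FA_diff FA_scale FA_word lin_mem bracket_mem)
qed

lemma ideal_uea: "ideal (uea_ideal L) (free_alg L)"
  unfolding uea_ideal_def using relations_subset by (rule ring.genideal_ideal[OF ring_free_alg])

lemma relations_in_ideal: "uea_relations L \<subseteq> uea_ideal L"
  unfolding uea_ideal_def using relations_subset by (rule ring.genideal_self[OF ring_free_alg])

lemma uea_ideal_minimal:
  "ideal J (free_alg L) \<Longrightarrow> uea_relations L \<subseteq> J \<Longrightarrow> uea_ideal L \<subseteq> J"
  unfolding uea_ideal_def by (rule ring.genideal_minimal[OF ring_free_alg])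

lemmas uea_ideal_FA = free_alg_ideal_FA[OF ideal_uea]
  and uea_ideal_fmul_left = free_alg_ideal_fmul_left[OF ideal_uea]
  and uea_ideal_fmul_right = free_alg_ideal_fmul_right[OF ideal_uea]
  and subspace_uea_ideal = subspace_free_alg_ideal[OF ideal_uea]

lemmas uea_ideal_zero = fun_vs.subspace_0[OF subspace_uea_ideal]
  and uea_ideal_add = fun_vs.subspace_add[OF subspace_uea_ideal]
  and uea_ideal_diff = fun_vs.subspace_diff[OF subspace_uea_ideal]
  and uea_ideal_scale = fun_vs.subspace_scale[OF subspace_uea_ideal]

lemma linear_relation:
  assumes "X \<in> L" "Y \<in> L"
  shows "word_ind [msmult a X + msmult b Y] - fscale a (word_ind [X]) - fscale b (word_ind [Y]) \<in> uea_ideal L"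
  unfolding fscale_def fun_diff_def
  by (rule subsetD[OF relations_in_ideal, unfolded uea_relations_def], intro UnI1 CollectI exI conjI, rule refl)
    (fact assms)+

lemma bracket_relation:
  assumes "X \<in> L" "Y \<in> L"
  shows "word_ind [X, Y] - word_ind [Y, X] - word_ind [bracket X Y] \<in> uea_ideal L"
  unfolding fun_diff_def
  by (rule subsetD[OF relations_in_ideal, unfolded uea_relations_def], intro UnI2 CollectI exI conjI, rule refl)
    (fact assms)+

lemma add_relation:
  assumes "X \<in> L" "Y \<in> L"
  shows "word_ind [X + Y] - (word_ind [X] + word_ind [Y]) \<in> uea_ideal L"
proof -
  have "msmult 1 Z = Z" for Z :: "complex^'n^'n"
    by (simp add: msmult_def map_matrix_def vec_eq_iff)
  then show ?thesis
    using linear_relation[OF assms, of 1 1] by (simp only: fun_vs.scale_one diff_diff_eq)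
qed

lemma zero_letter: "word_ind [0] \<in> uea_ideal L"
proof -
  have "msmult 0 0 + msmult 0 0 = (0 :: complex^'n^'n)"
    by (simp add: msmult_def map_matrix_def vec_eq_iff)
  then show ?thesis
    using linear_relation[OF zero_mem zero_mem, of 0 0] by simp
qed

lemma class_eq_iff:
  assumes "u \<in> FA L" "v \<in> FA L"
  shows "uea_class L u = uea_class L v \<longleftrightarrow> u - v \<in> uea_ideal L"
  using ring.quotient_eq_iff_same_a_r_cos[OF ring_free_alg ideal_uea assms] free_alg_minus[OF assms]
  by (simp add: uea_class_def)

lemma carrier_uea: "carrier (uea L) = uea_class L ` FA L"
  by (auto simp: uea_def FactRing_def A_RCOSETS_def' uea_class_def)

lemma class_mem: "u \<in> FA L \<Longrightarrow> uea_class L u \<in> carrier (uea L)"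
  by (simp add: carrier_uea)

lemma mem_class_iff: "u \<in> FA L \<Longrightarrow> v \<in> uea_class L u \<longleftrightarrow> v \<in> FA L \<and> v - u \<in> uea_ideal L"
proof -
  assume u: "u \<in> FA L"
  have "v \<in> uea_class L u \<longleftrightarrow> (\<exists>i\<in>uea_ideal L. v = i + u)"
    by (auto simp: uea_class_def a_r_coset_def')
  also have "\<dots> \<longleftrightarrow> v \<in> FA L \<and> v - u \<in> uea_ideal L"
    using u uea_ideal_FA FA_add by (force simp: algebra_simps intro: bexI[of _ "v - u"])
  finally show ?thesis .
qed

lemma rep_mem_FA: "c \<in> carrier (uea L) \<Longrightarrow> rep c \<in> FA L"
  and class_rep: "c \<in> carrier (uea L) \<Longrightarrow> uea_class L (rep c) = c"
proof -
  assume "c \<in> carrier (uea L)"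
  then obtain u where u: "u \<in> FA L" "c = uea_class L u"
    by (auto simp: carrier_uea)
  have "u \<in> c"
    using u uea_ideal_zero by (simp add: mem_class_iff)
  then have "rep c \<in> c"
    unfolding rep_def using some_in_eq by fast
  then have "rep c \<in> FA L" "rep c - u \<in> uea_ideal L"
    using u by (auto simp: mem_class_iff)
  then show "rep c \<in> FA L" "uea_class L (rep c) = c"
    using u class_eq_iff by simp_all
qed

lemma rep_class: "u \<in> FA L \<Longrightarrow> rep (uea_class L u) \<in> FA L \<and> rep (uea_class L u) - u \<in> uea_ideal L"
  using class_rep[OF class_mem, of u] rep_mem_FA[OF class_mem, of u] class_eq_iff by simp

lemma class_mult:
  "u \<in> FA L \<Longrightarrow> v \<in> FA L \<Longrightarrow> uea_class L u \<otimes>\<^bsub>uea L\<^esub> uea_class L v = uea_class L (fmul u v)"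
  using ideal.rcoset_mult_add[OF ideal_uea, of u v] by (simp add: uea_def FactRing_def uea_class_def)

lemma class_add:
  "u \<in> FA L \<Longrightarrow> v \<in> FA L \<Longrightarrow> uea_class L u \<oplus>\<^bsub>uea L\<^esub> uea_class L v = uea_class L (u + v)"
  using ideal.a_rcos_sum[OF ideal_uea, of u v] by (simp add: uea_def FactRing_def uea_class_def)

lemma class_one: "\<one>\<^bsub>uea L\<^esub> = uea_class L (word_ind [])"
  by (simp add: uea_def FactRing_def uea_class_def)

end

subsection \<open>The dual of an enveloping algebra\<close>

definition uea_dual :: "(complex^'n^'n) set \<Rightarrow> ((complex^'n^'n) list \<Rightarrow> complex) set" where
  "uea_dual L = {\<alpha>. (\<forall>w. \<not> set w \<subseteq> L \<longrightarrow> \<alpha> w = 0) \<and> (\<forall>u\<in>uea_ideal L. pairing u \<alpha> = 0)}"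

lemma uea_dual_off: "\<alpha> \<in> uea_dual L \<Longrightarrow> \<not> set w \<subseteq> L \<Longrightarrow> \<alpha> w = 0"
  by (simp add: uea_dual_def)

lemma uea_dual_ideal: "\<alpha> \<in> uea_dual L \<Longrightarrow> u \<in> uea_ideal L \<Longrightarrow> pairing u \<alpha> = 0"
  by (simp add: uea_dual_def)

lemma subspace_uea_dual: "fun_vs.subspace (uea_dual L)"
  by (rule fun_vs.subspaceI)
    (auto simp: uea_dual_def fscale_def plus_fun_def zero_fun_def pairing_add_right pairing_mult_right pairing_zero_right)

context lie_subalg
begin

lemma uea_dual_append:
  assumes \<alpha>: "\<alpha> \<in> uea_dual L" and x: "set x \<subseteq> L"
  shows "(\<lambda>w. \<alpha> (w @ x)) \<in> uea_dual L"
  unfolding uea_dual_def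
proof (intro CollectI conjI allI impI ballI)
  fix u assume u: "u \<in> uea_ideal L"
  have "pairing (fmul u (word_ind x)) \<alpha> = 0"
    using u x by (intro uea_dual_ideal[OF \<alpha>] uea_ideal_fmul_right FA_word)
  then show "pairing u (\<lambda>w. \<alpha> (w @ x)) = 0"
    using FA_finsupp[OF uea_ideal_FA[OF u]] by (simp add: pairing_fmul finsupp_word)
qed (simp add: uea_dual_off[OF \<alpha>])

context
  fixes \<alpha> :: "(complex^'n^'n) list \<Rightarrow> complex" and w :: "(complex^'n^'n) list"
  assumes \<alpha>: "\<alpha> \<in> uea_dual L"
begin

lemma uea_dual_prepend_ideal:
  assumes u: "u \<in> uea_ideal L" and w: "set w \<subseteq> L"
  shows "pairing u (\<lambda>v. \<alpha> (w @ v)) = 0"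
proof -
  have "pairing (fmul (word_ind w) u) \<alpha> = 0"
    using u w by (intro uea_dual_ideal[OF \<alpha>] uea_ideal_fmul_left FA_word)
  then show ?thesis
    using FA_finsupp[OF uea_ideal_FA[OF u]] by (simp add: pairing_fmul finsupp_word)
qed

lemma uea_dual_letter_linear:
  assumes "X \<in> L" "Y \<in> L"
  shows "\<alpha> (w @ [msmult a X + msmult b Y]) = a * \<alpha> (w @ [X]) + b * \<alpha> (w @ [Y])"
proof (cases "set w \<subseteq> L")
  case True
  from uea_dual_prepend_ideal[OF linear_relation[OF assms, of a b] True] show ?thesis
    by (simp only: pairing_diff finsupp_diff finsupp_scale finsupp_word pairing_scale pairing_word)
      (simp add: algebra_simps)
qed (simp add: uea_dual_off[OF \<alpha>])

lemma uea_dual_letter_bracket: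
  assumes "X \<in> L" "Y \<in> L"
  shows "\<alpha> (w @ [bracket X Y]) = \<alpha> (w @ [X, Y]) - \<alpha> (w @ [Y, X])"
proof (cases "set w \<subseteq> L")
  case True
  from uea_dual_prepend_ideal[OF bracket_relation[OF assms] True] show ?thesis
    by (simp only: pairing_diff finsupp_diff finsupp_word pairing_word) (simp add: algebra_simps)
qed (simp add: uea_dual_off[OF \<alpha>])

lemma uea_dual_zero_letter: "\<alpha> (w @ [0]) = 0"
proof (cases "set w \<subseteq> L")
  case True
  from uea_dual_prepend_ideal[OF zero_letter True] show ?thesis by simp
qed (simp add: uea_dual_off[OF \<alpha>])

end

lemma uea_dual_restrict:
  assumes "\<And>u. u \<in> uea_ideal L \<Longrightarrow> pairing u \<alpha> = 0"
  obtains \<alpha>' where "\<alpha>' \<in> uea_dual L" "\<And>u. u \<in> FA L \<Longrightarrow> pairing u \<alpha>' = pairing u \<alpha>"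
proof -
  let ?\<alpha>' = "\<lambda>w. if set w \<subseteq> L then \<alpha> w else 0"
  have eq: "pairing u ?\<alpha>' = pairing u \<alpha>" if "u \<in> FA L" for u
    using that by (intro pairing_cong) (simp add: FA_iff)
  show thesis
    by (rule that[OF _ eq]) (use assms in \<open>auto simp: uea_dual_def eq uea_ideal_FA\<close>)
qed

lemma uea_dual_separates:
  assumes W: "fun_vs.subspace W" "uea_ideal L \<subseteq> W" and x: "x \<in> FA L" "x \<notin> W"
  obtains \<alpha> where "\<alpha> \<in> uea_dual L" "pairing x \<alpha> = 1" "\<And>u. u \<in> W \<Longrightarrow> u \<in> FA L \<Longrightarrow> pairing u \<alpha> = 0"
proof -
  obtain \<alpha> where \<alpha>: "\<And>u. u \<in> W \<Longrightarrow> finsupp u \<Longrightarrow> pairing u \<alpha> = 0" "pairing x \<alpha> = 1"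
    using pairing_separates[OF W(1) x(2) FA_finsupp[OF x(1)]] by blast
  have "pairing u \<alpha> = 0" if "u \<in> uea_ideal L" for u
    using \<alpha>(1) W(2) that FA_finsupp[OF uea_ideal_FA[OF that]] by blast
  then obtain \<alpha>' where \<alpha>': "\<alpha>' \<in> uea_dual L" "\<And>u. u \<in> FA L \<Longrightarrow> pairing u \<alpha>' = pairing u \<alpha>"
    using uea_dual_restrict by blast
  show thesis
  proof (rule that[OF \<alpha>'(1)])
    show "pairing x \<alpha>' = 1"
      using \<alpha>(2) \<alpha>'(2)[OF x(1)] by simp
    show "pairing u \<alpha>' = 0" if "u \<in> W" "u \<in> FA L" for u
      using \<alpha>(1)[OF that(1) FA_finsupp[OF that(2)]] \<alpha>'(2)[OF that(2)] by simp
  qed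
qed

lemma uea_ideal_if_dual_zero:
  assumes "u \<in> FA L" "\<And>\<alpha>. \<alpha> \<in> uea_dual L \<Longrightarrow> pairing u \<alpha> = 0"
  shows "u \<in> uea_ideal L"
proof (rule ccontr)
  assume "u \<notin> uea_ideal L"
  then obtain \<alpha> where "\<alpha> \<in> uea_dual L" "pairing u \<alpha> = 1"
    using uea_dual_separates[OF subspace_uea_ideal subset_refl assms(1)] by blast
  then show False using assms(2) by simp
qed

lemma uea_dual_family:
  assumes ind: "independent_mod (uea_ideal L) I b" and I: "finite I" "j \<in> I"
    and b: "\<And>i. i \<in> I \<Longrightarrow> b i \<in> FA L"
  obtains \<beta> where "\<beta> \<in> uea_dual L" "\<And>i. i \<in> I \<Longrightarrow> pairing (b i) \<beta> = (if i = j then 1 else 0)"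
proof -
  let ?W = "{x + y | x y. x \<in> fun_vs.span (b ` (I - {j})) \<and> y \<in> uea_ideal L}"
  have W: "fun_vs.subspace ?W"
    by (intro fun_vs.subspace_sums fun_vs.subspace_span subspace_uea_ideal)
  have ideal: "y \<in> ?W" if "y \<in> uea_ideal L" for y
    using that fun_vs.span_zero by (intro CollectI exI[of _ 0] exI[of _ y]) simp
  have others: "b i \<in> ?W" if "i \<in> I" "i \<noteq> j" for i
    using that uea_ideal_zero by (intro CollectI exI[of _ "b i"] exI[of _ 0]) (simp add: fun_vs.span_base)
  obtain \<beta> where "\<beta> \<in> uea_dual L" "pairing (b j) \<beta> = 1" "\<And>u. u \<in> ?W \<Longrightarrow> u \<in> FA L \<Longrightarrow> pairing u \<beta> = 0"
    using uea_dual_separates[OF W subsetI[OF ideal] b[OF I(2)] independent_mod_notin_span_plus[OF ind I]] by blast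
  then show thesis
    using others b by (intro that[of \<beta>]) auto
qed

end

text \<open>
  In the tensor product of two enveloping algebras, coefficients with respect to linearly
  independent elements are unique; equality of tensors is tested by pairs of functionals.
\<close>

lemma independent_coefficients_unique:
  assumes L: "lie_subalg L" and M: "lie_subalg M" and I: "finite I" "j \<in> I"
    and a: "\<And>i. i \<in> I \<Longrightarrow> a i \<in> FA L" "\<And>i. i \<in> I \<Longrightarrow> a' i \<in> FA L" and b: "\<And>i. i \<in> I \<Longrightarrow> b i \<in> FA M"
    and ind: "independent_mod (uea_ideal M) I b"
    and eq: "\<And>\<alpha> \<beta>. \<alpha> \<in> uea_dual L \<Longrightarrow> \<beta> \<in> uea_dual M \<Longrightarrow>
      (\<Sum>i\<in>I. pairing (a i) \<alpha> * pairing (b i) \<beta>) = (\<Sum>i\<in>I. pairing (a' i) \<alpha> * pairing (b i) \<beta>)"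
  shows "a j - a' j \<in> uea_ideal L"
proof (rule lie_subalg.uea_ideal_if_dual_zero[OF L])
  show "a j - a' j \<in> FA L"
    using a I(2) by (intro FA_diff)
  fix \<alpha> assume \<alpha>: "\<alpha> \<in> uea_dual L"
  obtain \<beta> where \<beta>: "\<beta> \<in> uea_dual M" "\<And>i. i \<in> I \<Longrightarrow> pairing (b i) \<beta> = (if i = j then 1 else 0)"
    using lie_subalg.uea_dual_family[OF M ind I b] by blast
  have "(\<Sum>i\<in>I. pairing (x i) \<alpha> * pairing (b i) \<beta>) = pairing (x j) \<alpha>" for x
    using I by (simp add: \<beta>(2) if_distrib[of "\<lambda>r. _ * r"] cong: if_cong)
  then have "pairing (a j) \<alpha> = pairing (a' j) \<alpha>"
    using eq[OF \<alpha> \<beta>(1)] by simp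
  then show "pairing (a j - a' j) \<alpha> = 0"
    by (simp add: pairing_diff[OF a(1)[OF I(2), THEN FA_finsupp] a(2)[OF I(2), THEN FA_finsupp]])
qed

subsection \<open>Actions of the enveloping algebra\<close>

lemma word_action_pairing: "word_action D u f g = pairing u (\<lambda>w. foldr D w f g)"
  by (simp add: word_action_def pairing_def)

lemma word_action_eq_sum: "word_action D u f = (\<Sum>w | u w \<noteq> 0. fscale (u w) (foldr D w f))"
  by (auto simp: word_action_def sum_fun_apply fscale_def)

lemma word_action_add: "finsupp u \<Longrightarrow> finsupp v \<Longrightarrow> word_action D (u + v) f = word_action D u f + word_action D v f"
  by (rule ext) (simp add: word_action_pairing pairing_add)

lemma word_action_diff: "finsupp u \<Longrightarrow> finsupp v \<Longrightarrow> word_action D (u - v) f = word_action D u f - word_action D v f"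
  by (rule ext) (simp add: word_action_pairing pairing_diff)

lemma word_action_scale: "word_action D (fscale c u) f = fscale c (word_action D u f)"
  by (rule ext) (simp add: word_action_pairing pairing_scale fscale_def[of c "word_action D u f"])

lemma word_action_word [simp]: "word_action D (word_ind w) f = foldr D w f"
  by (rule ext) (simp add: word_action_pairing)

lemma word_action_push: "finsupp u \<Longrightarrow> word_action D (push_words h u) f = word_action (D \<circ> h) u f"
  by (rule ext) (simp add: word_action_pairing pairing_push foldr_map)

lemma word_action_push_intertwine:
  assumes T: "Vector_Spaces.linear fscale fscale T" and u: "u \<in> FA S"
    and intertwine: "\<And>X f. X \<in> S \<Longrightarrow> D (h X) (T f) = T (E X f)"
  shows "word_action D (push_words h u) (T f) = T (word_action E u f)"
proof -
  have "foldr D (map h w) (T f) = T (foldr E w f)" if "set w \<subseteq> S" for w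
    using that by (induction w) (simp_all add: intertwine)
  then have "word_action (D \<circ> h) u (T f) = (\<Sum>w | u w \<noteq> 0. fscale (u w) (T (foldr E w f)))"
    unfolding word_action_eq_sum using u by (intro sum.cong) (auto simp: FA_iff foldr_map)
  then show ?thesis
    by (simp only: word_action_push[OF FA_finsupp[OF u]] word_action_eq_sum[of E]
        fun_pair.linear_sum[OF T] fun_pair.linear_scale[OF T])
qed

context lie_rep
begin

lemma foldr_closed: "set w \<subseteq> L \<Longrightarrow> f \<in> V \<Longrightarrow> foldr D w f \<in> V"
  by (induction w) (auto intro: D_closed)

lemma foldr_linear_on: "set w \<subseteq> L \<Longrightarrow> linear_on fscale fscale V (foldr D w)"
proof (induction w)
  case (Cons X w)
  then have "X \<in> L" "set w \<subseteq> L" "linear_on fscale fscale V (foldr D w)"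
    by auto
  then show ?case
    by (intro linear_onI) (simp_all only: foldr.simps comp_apply linear_on_add linear_on_scale
        linear_on_add[OF D_linear_on] linear_on_scale[OF D_linear_on] foldr_closed)
qed (simp add: linear_onI)

lemma word_action_closed: "u \<in> FA L \<Longrightarrow> f \<in> V \<Longrightarrow> word_action D u f \<in> V"
  unfolding word_action_eq_sum
  by (intro fun_vs.subspace_sum[OF subspace_V] fun_vs.subspace_scale[OF subspace_V] foldr_closed)
    (auto simp: FA_iff)

lemma word_action_linear_on:
  assumes "u \<in> FA L"
  shows "linear_on fscale fscale V (word_action D u)"
proof (rule linear_onI)
  have lin: "linear_on fscale fscale V (foldr D w)" if "u w \<noteq> 0" for w
    using assms that by (intro foldr_linear_on) (simp add: FA_iff)
  show "word_action D u (f + g) = word_action D u f + word_action D u g" if "f \<in> V" "g \<in> V" for f g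
    unfolding word_action_eq_sum sum.distrib[symmetric] fun_vs.scale_right_distrib[symmetric]
    by (rule sum.cong[OF refl]) (simp add: linear_on_add[OF lin that] del: plus_fun_apply)
  show "word_action D u (fscale c f) = fscale c (word_action D u f)" if "f \<in> V" for c f
    unfolding word_action_eq_sum fun_vs.scale_sum_right
    by (rule sum.cong[OF refl]) (simp add: linear_on_scale[OF lin that] mult.commute)
qed

lemma word_action_fmul:
  assumes u: "u \<in> FA L" and v: "v \<in> FA L" and f: "f \<in> V"
  shows "word_action D (fmul u v) f = word_action D u (word_action D v f)"
proof
  fix g
  have append: "foldr D a (word_action D v f) g = pairing v (\<lambda>b. foldr D (a @ b) f g)" if a: "set a \<subseteq> L" for a
  proof -
    have words: "foldr D w f \<in> V" if "v w \<noteq> 0" for w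
      using v f that by (intro foldr_closed) (auto simp: FA_iff)
    have "foldr D a (word_action D v f) = (\<Sum>w | v w \<noteq> 0. foldr D a (fscale (v w) (foldr D w f)))"
      unfolding word_action_eq_sum
      by (rule fun_pair.linear_on_sum[OF subspace_V foldr_linear_on[OF a]])
        (use words in \<open>simp add: fun_vs.subspace_scale[OF subspace_V]\<close>)
    also have "\<dots> = (\<Sum>w | v w \<noteq> 0. fscale (v w) (foldr D (a @ w) f))"
      by (rule sum.cong) (use words in \<open>auto simp: linear_on_scale[OF foldr_linear_on[OF a]]\<close>)
    finally show ?thesis
      by (simp add: sum_fun_apply pairing_def fscale_def)
  qed
  have "word_action D (fmul u v) f g = pairing u (\<lambda>a. pairing v (\<lambda>b. foldr D (a @ b) f g))"
    using u v by (simp only: word_action_pairing pairing_fmul FA_finsupp)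
  also have "\<dots> = pairing u (\<lambda>a. foldr D a (word_action D v f) g)"
    by (rule pairing_cong) (use u append in \<open>auto simp: FA_iff\<close>)
  finally show "word_action D (fmul u v) f g = word_action D u (word_action D v f) g"
    by (simp add: word_action_pairing)
qed

lemma word_action_relation:
  assumes "lie_subalg L" "r \<in> uea_relations L" "f \<in> V"
  shows "word_action D r f = 0"
proof -
  interpret lie_subalg L by fact
  show ?thesis
    using assms(2)
  proof (cases rule: relations_cases)
    case linear
    then show ?thesis
      using assms(3) by (simp only: word_action_diff finsupp_word finsupp_diff finsupp_scale word_action_scale
          word_action_word) (simp add: D_linear_left)
  next
    case bracket
    then show ?thesis
      using assms(3) by (simp only: word_action_diff finsupp_word finsupp_diff word_action_word)
        (simp add: D_bracket)
  qed
qed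

lemma word_action_ideal:
  assumes L: "lie_subalg L" and u: "u \<in> uea_ideal L" and f: "f \<in> V"
  shows "word_action D u f = 0"
proof -
  let ?J = "{u \<in> FA L. \<forall>f\<in>V. word_action D u f = 0}"
  have "word_action D x 0 = 0" if "x \<in> FA L" for x
    by (rule fun_pair.linear_on_0[OF subspace_V word_action_linear_on[OF that]])
  then have "fmul x u \<in> ?J \<and> fmul u x \<in> ?J" if "u \<in> ?J" "x \<in> FA L" for u x
    using that by (simp add: FA_fmul word_action_fmul word_action_closed)
  moreover have "word_action D 0 f = 0" for f
    using word_action_scale[of D 0 0 f] by simp
  ultimately have "ideal ?J (free_alg L)"
    by (intro free_alg_idealI) (auto simp: FA_zero FA_add word_action_add FA_finsupp)
  then have "uea_ideal L \<subseteq> ?J"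
    using word_action_relation[OF L] lie_subalg.relations_subset[OF L]
    by (intro lie_subalg.uea_ideal_minimal[OF L]) auto
  then show ?thesis using u f by auto
qed

lemma word_action_cong_ideal:
  assumes "lie_subalg L" "u \<in> FA L" "v \<in> FA L" "u - v \<in> uea_ideal L" "f \<in> V"
  shows "word_action D u f = word_action D v f"
  using word_action_ideal[OF assms(1,4,5)] assms(2,3)[THEN FA_finsupp]
  by (simp only: word_action_diff right_minus_eq)

lemma word_action_rep_class:
  assumes L: "lie_subalg L" and "u \<in> FA L" "f \<in> V"
  shows "word_action D (rep (uea_class L u)) f = word_action D u f"
  using lie_subalg.rep_class[OF L, of u] assms by (intro word_action_cong_ideal[OF L]) auto

end

section \<open>Homomorphisms of Lie algebras\<close>

definition lie_hom :: "(complex^'n^'n) set \<Rightarrow> (complex^'m^'m) set \<Rightarrow> (complex^'n^'n \<Rightarrow> complex^'m^'m) \<Rightarrow> bool" where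
  "lie_hom L M h \<longleftrightarrow> (\<forall>X\<in>L. h X \<in> M) \<and>
     (\<forall>X\<in>L. \<forall>Y\<in>L. \<forall>a b. h (msmult a X + msmult b Y) = msmult a (h X) + msmult b (h Y)) \<and>
     (\<forall>X\<in>L. \<forall>Y\<in>L. h (bracket X Y) = bracket (h X) (h Y))"

lemma lie_hom_push_FA: "lie_hom L M h \<Longrightarrow> u \<in> FA L \<Longrightarrow> push_words h u \<in> FA M"
  by (rule FA_push) (auto simp: lie_hom_def)

lemma lie_hom_push_relation:
  assumes L: "lie_subalg L" and M: "lie_subalg M" and h: "lie_hom L M h" and r: "r \<in> uea_relations L"
  shows "push_words h r \<in> uea_ideal M"
proof -
  interpret L: lie_subalg L by fact
  interpret M: lie_subalg M by fact
  have mem: "\<And>X. X \<in> L \<Longrightarrow> h X \<in> M" using h by (simp add: lie_hom_def)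
  show ?thesis
    using r
  proof (cases rule: L.relations_cases)
    case (linear a b X Y)
    then have "push_words h r = word_ind [msmult a (h X) + msmult b (h Y)] - fscale a (word_ind [h X]) - fscale b (word_ind [h Y])"
      using h by (simp only: push_diff finsupp_word finsupp_diff finsupp_scale push_scale push_word)
        (simp add: lie_hom_def)
    then show ?thesis using M.linear_relation[OF mem mem] linear by simp
  next
    case (bracket X Y)
    then have "push_words h r = word_ind [h X, h Y] - word_ind [h Y, h X] - word_ind [Defs.bracket (h X) (h Y)]"
      using h by (simp only: push_diff finsupp_word finsupp_diff push_word) (simp add: lie_hom_def)
    then show ?thesis using M.bracket_relation[OF mem mem] bracket by simp
  qed
qed

lemma lie_hom_push_ideal:
  assumes L: "lie_subalg L" and M: "lie_subalg M" and h: "lie_hom L M h" and u: "u \<in> uea_ideal L"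
  shows "push_words h u \<in> uea_ideal M"
proof -
  interpret L: lie_subalg L by fact
  interpret M: lie_subalg M by fact
  let ?J = "{u \<in> FA L. push_words h u \<in> uea_ideal M}"
  have "ideal ?J (free_alg L)"
  proof (rule free_alg_idealI)
    fix u x assume "u \<in> ?J" "x \<in> FA L"
    then show "fmul x u \<in> ?J" "fmul u x \<in> ?J"
      using lie_hom_push_FA[OF h] M.uea_ideal_fmul_left M.uea_ideal_fmul_right
      by (auto simp: FA_fmul push_fmul FA_finsupp)
  qed (auto simp: FA_zero FA_add push_add FA_finsupp M.uea_ideal_zero M.uea_ideal_add)
  then have "uea_ideal L \<subseteq> ?J"
    using lie_hom_push_relation[OF L M h] L.relations_subset by (intro L.uea_ideal_minimal) auto
  then show ?thesis using u by auto
qed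

lemma uea_map_class:
  assumes L: "lie_subalg L" and M: "lie_subalg M" and h: "lie_hom L M h" and u: "u \<in> FA L"
  shows "uea_map M h (uea_class L u) = uea_class M (push_words h u)"
proof -
  interpret L: lie_subalg L by fact
  interpret M: lie_subalg M by fact
  have rep: "rep (uea_class L u) \<in> FA L" "rep (uea_class L u) - u \<in> uea_ideal L"
    using L.rep_class[OF u] by auto
  then have "push_words h (rep (uea_class L u)) - push_words h u \<in> uea_ideal M"
    using lie_hom_push_ideal[OF L M h rep(2)] u by (simp add: push_diff FA_finsupp)
  then show ?thesis
    unfolding uea_map_def using M.class_eq_iff lie_hom_push_FA[OF h] rep(1) u by simp
qed

lemma (in lie_subalg) commutator_push_in_ideal:
  assumes h: "\<And>X. X \<in> S \<Longrightarrow> h X \<in> L" and y: "y \<in> FA L"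
    and letter: "\<And>X. X \<in> S \<Longrightarrow> fmul y (word_ind [h X]) - fmul (word_ind [h X]) y \<in> uea_ideal L"
    and u: "u \<in> FA S"
  shows "fmul y (push_words h u) - fmul (push_words h u) y \<in> uea_ideal L"
proof -
  define C where "C u = fmul y (push_words h u) - fmul (push_words h u) y" for u
  have C_add: "C (u + v) = C u + C v" if "u \<in> FA S" "v \<in> FA S" for u v
    by (simp only: C_def push_add[OF that[THEN FA_finsupp]] fmul_add_left fmul_add_right algebra_simps)
  have C_scale: "C (fscale c u) = fscale c (C u)" if "u \<in> FA S" for c u
    by (simp only: C_def push_scale[OF FA_finsupp[OF that]] fmul_scale_left fmul_scale_right
        fun_vs.scale_right_diff_distrib)
  have "FA S \<subseteq> {u \<in> FA S. C u \<in> uea_ideal L}"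
  proof (rule FA_subset_if_left_closed)
    show "fun_vs.subspace {u \<in> FA S. C u \<in> uea_ideal L}"
    proof (rule fun_vs.subspaceI)
      show "0 \<in> {u \<in> FA S. C u \<in> uea_ideal L}"
        using uea_ideal_zero FA_zero by (simp add: C_def)
    qed (auto simp: C_add C_scale uea_ideal_add uea_ideal_scale FA_add FA_scale simp del: plus_fun_apply)
    have "C (word_ind []) = 0"
      by (simp add: C_def push_word fmul_one_left fmul_one_right)
    then show "word_ind [] \<in> {u \<in> FA S. C u \<in> uea_ideal L}"
      using uea_ideal_zero by (simp add: FA_word)
  next
    fix X u assume X: "X \<in> S" and "u \<in> {u \<in> FA S. C u \<in> uea_ideal L}"
    then have u: "u \<in> FA S" "C u \<in> uea_ideal L" by auto
    let ?x = "word_ind [h X]" and ?v = "push_words h u"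
    have x: "?x \<in> FA L" and v: "?v \<in> FA L" and Xu: "fmul (word_ind [X]) u \<in> FA S"
      using X u h FA_push[OF u(1) h] by (auto intro!: FA_word FA_fmul)
    have "C (fmul (word_ind [X]) u) = fmul (fmul y ?x - fmul ?x y) ?v + fmul ?x (C u)"
      using x v y by (simp add: C_def push_fmul[OF finsupp_word FA_finsupp[OF u(1)]] push_word
          fmul_diff_left fmul_diff_right fmul_assoc FA_finsupp)
    also have "\<dots> \<in> uea_ideal L"
      by (intro uea_ideal_add uea_ideal_fmul_right[OF letter[OF X] v] uea_ideal_fmul_left[OF u(2) x])
    finally show "fmul (word_ind [X]) u \<in> {u \<in> FA S. C u \<in> uea_ideal L}"
      using Xu by simp
  qed
  then show ?thesis using u by (auto simp: C_def)
qed

section \<open>Invariants of the enveloping algebra and their characters\<close>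

lemma subspace_imp_lie_subalg:
  fixes \<gg> :: "(real^'n^'n) set"
  assumes sub: "subspace \<gg>" and br: "\<And>X Y. X \<in> \<gg> \<Longrightarrow> Y \<in> \<gg> \<Longrightarrow> bracket X Y \<in> \<gg>"
  shows "lie_subalg (complexification \<gg>)"
proof
  have "map_matrix Re (0 :: complex^'n^'n) = 0" "map_matrix Im (0 :: complex^'n^'n) = 0"
    by (simp_all add: map_matrix_def vec_eq_iff)
  then show "0 \<in> complexification \<gg>"
    using subspace_0[OF sub] by (simp add: complexification_def)
  fix X Y :: "complex^'n^'n" and a b
  assume "X \<in> complexification \<gg>" "Y \<in> complexification \<gg>"
  then have XY: "map_matrix Re X \<in> \<gg>" "map_matrix Im X \<in> \<gg>" "map_matrix Re Y \<in> \<gg>" "map_matrix Im Y \<in> \<gg>"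
    by (simp_all add: complexification_def)
  show "msmult a X + msmult b Y \<in> complexification \<gg>"
    unfolding complexification_def mem_Collect_eq map_matrix_Re_Im_linear
    by (intro conjI subspace_add[OF sub] subspace_mul[OF sub] XY)
  show "bracket X Y \<in> complexification \<gg>"
    unfolding complexification_def mem_Collect_eq map_matrix_Re_Im_bracket
    by (intro conjI subspace_add[OF sub] subspace_mul[OF sub] br XY)
qed

lemma matrix_mult_msmult:
  fixes X :: "complex^'n^'n"
  shows "A ** msmult a X = msmult a (A ** X)" "msmult a X ** B = msmult a (X ** B)"
  by (simp_all add: msmult_def map_matrix_def matrix_matrix_mult_def vec_eq_iff sum_distrib_left mult_ac)

lemma map_matrix_of_real_mult:
  "map_matrix complex_of_real (A ** B) = map_matrix complex_of_real A ** map_matrix complex_of_real B"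
  by (simp add: map_matrix_def matrix_matrix_mult_def vec_eq_iff)

lemma map_matrix_of_real_one: "map_matrix complex_of_real (mat 1) = mat 1"
  by (simp add: map_matrix_def mat_def vec_eq_iff)

lemma map_matrix_Re_Im_conj:
  "map_matrix Re (map_matrix complex_of_real g ** X ** map_matrix complex_of_real h) = g ** map_matrix Re X ** h"
  "map_matrix Im (map_matrix complex_of_real g ** X ** map_matrix complex_of_real h) = g ** map_matrix Im X ** h"
  by (simp_all add: map_matrix_def matrix_matrix_mult_def vec_eq_iff)

lemma Ad_one: "Ad (mat 1) X = X"
  by (simp add: Ad_def map_matrix_of_real_one)

lemma push_Ad_one: "finsupp u \<Longrightarrow> push_words (Ad (mat 1)) u = u"
  by (rule pairing_ext) (simp_all add: finsupp_push pairing_push Ad_one[abs_def] map_idI)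

context closed_linear_group
begin

abbreviation "\<gg> \<equiv> lie_algebra_C G"

sublocale U: lie_subalg \<gg>
  by (rule subspace_imp_lie_subalg[OF subspace_lie_algebra bracket_in_lie_algebra])

lemma lie_hom_Ad:
  assumes "g \<in> G"
  shows "lie_hom \<gg> \<gg> (Ad g)"
proof -
  let ?g = "map_matrix complex_of_real g" and ?h = "map_matrix complex_of_real (matrix_inv g)"
  have inv: "?h ** ?g = mat 1"
    using assms by (simp add: matrix_inv_mult_self map_matrix_of_real_one flip: map_matrix_of_real_mult)
  have prod: "?g ** X ** ?h ** (?g ** Y ** ?h) = ?g ** (X ** Y) ** ?h" for X Y
  proof -
    have "?g ** X ** ?h ** (?g ** Y ** ?h) = ?g ** X ** (?h ** ?g) ** Y ** ?h"
      by (simp only: matrix_mul_assoc)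
    then show ?thesis by (simp only: inv matrix_mul_rid matrix_mul_assoc)
  qed
  have "Ad g (bracket X Y) = bracket (Ad g X) (Ad g Y)" for X Y
    unfolding Ad_def bracket_def prod by (simp only: matrix_mult_diff)
  moreover have "Ad g (msmult a X + msmult b Y) = msmult a (Ad g X) + msmult b (Ad g Y)" for a b X Y
    unfolding Ad_def by (simp only: matrix_add_ldistrib matrix_add_rdistrib matrix_mult_msmult)
  moreover have "Ad g X \<in> \<gg>" if "X \<in> \<gg>" for X
    using that assms conj_in_lie_algebra unfolding complexification_def Ad_def mem_Collect_eq map_matrix_Re_Im_conj
    by simp
  ultimately show ?thesis by (simp add: lie_hom_def)
qed

definition invariants :: "((complex^'n^'n) list \<Rightarrow> complex) set" where
  "invariants = {u \<in> FA \<gg>. \<forall>g\<in>G. push_words (Ad g) u - u \<in> uea_ideal \<gg>}"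

lemma invariants_FA: "u \<in> invariants \<Longrightarrow> u \<in> FA \<gg>"
  by (simp add: invariants_def)

lemma class_in_Z_alg_iff:
  assumes u: "u \<in> FA \<gg>"
  shows "uea_class \<gg> u \<in> carrier (Z_alg G) \<longleftrightarrow> u \<in> invariants"
proof -
  have "uea_map \<gg> (Ad g) (uea_class \<gg> u) = uea_class \<gg> u \<longleftrightarrow> push_words (Ad g) u - u \<in> uea_ideal \<gg>"
    if "g \<in> G" for g
    using uea_map_class[OF U.lie_subalg_axioms U.lie_subalg_axioms lie_hom_Ad[OF that] u]
      U.class_eq_iff[OF lie_hom_push_FA[OF lie_hom_Ad[OF that] u] u] by simp
  then show ?thesis
    using U.class_mem[OF u] u by (simp add: Z_alg_def invariants_def)
qed

lemma class_invariant: "u \<in> invariants \<Longrightarrow> uea_class \<gg> u \<in> carrier (Z_alg G)"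
  using class_in_Z_alg_iff invariants_FA by blast

lemma Z_alg_ops:
  "mult (Z_alg G) = mult (U_alg G)" "add (Z_alg G) = add (U_alg G)" "one (Z_alg G) = one (U_alg G)"
  by (simp_all add: Z_alg_def)

lemma class_rep_Z_alg: "c \<in> carrier (Z_alg G) \<Longrightarrow> uea_class \<gg> (rep c) = c"
  by (simp add: Z_alg_def U.class_rep)

lemma rep_invariant: "c \<in> carrier (Z_alg G) \<Longrightarrow> rep c \<in> invariants"
  using class_in_Z_alg_iff[of "rep c"] class_rep_Z_alg by (simp add: Z_alg_def U.rep_mem_FA)

lemma uea_ideal_invariants: "u \<in> uea_ideal \<gg> \<Longrightarrow> u \<in> invariants"
  unfolding invariants_def
  using lie_hom_push_ideal[OF U.lie_subalg_axioms U.lie_subalg_axioms lie_hom_Ad] U.uea_ideal_diff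
  by (simp add: U.uea_ideal_FA)

lemma subspace_invariants: "fun_vs.subspace invariants"
proof (rule fun_vs.subspaceI)
  show "0 \<in> invariants"
    by (rule uea_ideal_invariants[OF U.uea_ideal_zero])
  fix u assume u: "u \<in> invariants"
  have "push_words (Ad g) (fscale c u) - fscale c u = fscale c (push_words (Ad g) u - u)" for g c
    unfolding push_scale[OF FA_finsupp[OF invariants_FA[OF u]]] by (simp only: fun_vs.scale_right_diff_distrib)
  then show "fscale c u \<in> invariants" for c
    using u by (simp add: invariants_def FA_scale U.uea_ideal_scale)
  fix v assume v: "v \<in> invariants"
  have split: "push_words (Ad g) (u + v) - (u + v) = (push_words (Ad g) u - u) + (push_words (Ad g) v - v)" for g
    unfolding push_add[OF u[THEN invariants_FA, THEN FA_finsupp] v[THEN invariants_FA, THEN FA_finsupp]]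
    by (simp only: algebra_simps)
  show "u + v \<in> invariants"
    using u v unfolding invariants_def mem_Collect_eq split by (intro conjI ballI FA_add U.uea_ideal_add) auto
qed

lemma invariants_fmul:
  assumes "u \<in> invariants" "v \<in> invariants"
  shows "fmul u v \<in> invariants"
proof -
  note u = assms(1)[unfolded invariants_def, simplified] and v = assms(2)[unfolded invariants_def, simplified]
  have "push_words (Ad g) (fmul u v) - fmul u v \<in> uea_ideal \<gg>" if "g \<in> G" for g
  proof -
    have "push_words (Ad g) (fmul u v) - fmul u v =
        fmul (push_words (Ad g) u - u) (push_words (Ad g) v) + fmul u (push_words (Ad g) v - v)"
      unfolding push_fmul[OF assms[THEN invariants_FA, THEN FA_finsupp]] fmul_diff_left fmul_diff_right
      by simp
    also have "\<dots> \<in> uea_ideal \<gg>"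
      using assms that by (intro U.uea_ideal_add U.uea_ideal_fmul_left U.uea_ideal_fmul_right
          lie_hom_push_FA[OF lie_hom_Ad]) (auto simp: invariants_def)
    finally show ?thesis .
  qed
  then show ?thesis
    using assms by (simp add: invariants_def FA_fmul)
qed

lemma invariants_one: "word_ind [] \<in> invariants"
  unfolding invariants_def using U.uea_ideal_zero by (simp add: FA_word push_word)

context
  fixes \<eta> assumes \<eta>: "Z_character G \<eta>"
begin

lemma Z_character_hom: "\<eta> \<in> ring_hom (Z_alg G) complex_ring"
  using \<eta> by (simp add: Z_character_def)

lemma Z_character_scalar: "\<eta> (uea_class \<gg> (fscale c (word_ind []))) = c"
  using \<eta> by (simp add: Z_character_def fscale_def)

lemma Z_character_one: "\<eta> (uea_class \<gg> (word_ind [])) = 1"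
  using Z_character_scalar[of 1] by simp

lemma Z_character_fmul:
  assumes "u \<in> invariants" "v \<in> invariants"
  shows "\<eta> (uea_class \<gg> (fmul u v)) = \<eta> (uea_class \<gg> u) * \<eta> (uea_class \<gg> v)"
  using ring_hom_mult[OF Z_character_hom assms[THEN class_invariant]] U.class_mult[OF assms[THEN invariants_FA]]
  by (simp add: Z_alg_ops complex_ring_def)

lemma Z_character_linear_on: "linear_on fscale (*) invariants (\<lambda>u. \<eta> (uea_class \<gg> u))"
proof (rule linear_onI)
  fix u assume u: "u \<in> invariants"
  show "\<eta> (uea_class \<gg> (u + v)) = \<eta> (uea_class \<gg> u) + \<eta> (uea_class \<gg> v)" if "v \<in> invariants" for v
    using ring_hom_add[OF Z_character_hom class_invariant[OF u] class_invariant[OF that]]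
      U.class_add[OF invariants_FA[OF u] invariants_FA[OF that]] by (simp add: Z_alg_ops complex_ring_def)
  show "\<eta> (uea_class \<gg> (fscale c u)) = c * \<eta> (uea_class \<gg> u)" for c
    using Z_character_fmul[OF fun_vs.subspace_scale[OF subspace_invariants invariants_one, of c] u]
    by (simp add: fmul_scale_left fmul_one_left Z_character_scalar)
qed

lemma Z_character_dual:
  obtains \<alpha> where "\<alpha> \<in> uea_dual \<gg>" "\<And>u. u \<in> invariants \<Longrightarrow> pairing u \<alpha> = \<eta> (uea_class \<gg> u)"
proof -
  obtain \<alpha> where "\<And>u. u \<in> invariants \<Longrightarrow> finsupp u \<Longrightarrow> pairing u \<alpha> = \<eta> (uea_class \<gg> u)"
    using pairing_extends[OF subspace_invariants Z_character_linear_on] by blast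
  then have \<alpha>: "pairing u \<alpha> = \<eta> (uea_class \<gg> u)" if "u \<in> invariants" for u
    using that FA_finsupp[OF invariants_FA] by blast
  have "pairing u \<alpha> = 0" if u: "u \<in> uea_ideal \<gg>" for u
  proof -
    have "uea_class \<gg> u = uea_class \<gg> 0"
      using U.class_eq_iff[OF U.uea_ideal_FA[OF u] FA_zero] u by simp
    then have "pairing u \<alpha> = pairing 0 \<alpha>"
      using \<alpha> uea_ideal_invariants u U.uea_ideal_zero by metis
    then show ?thesis by simp
  qed
  then obtain \<alpha>' where "\<alpha>' \<in> uea_dual \<gg>" "\<And>u. u \<in> FA \<gg> \<Longrightarrow> pairing u \<alpha>' = pairing u \<alpha>"
    using U.uea_dual_restrict by blast
  then show thesis using that \<alpha> invariants_FA by metis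
qed

end

context
  fixes \<Phi> :: "((complex^'n^'n) list \<Rightarrow> complex) \<Rightarrow> complex"
  assumes linear: "linear_on fscale (*) (FA \<gg>) \<Phi>" and ideal: "\<And>u. u \<in> uea_ideal \<gg> \<Longrightarrow> \<Phi> u = 0"
begin

lemma functional_rep_class:
  assumes u: "u \<in> FA \<gg>"
  shows "\<Phi> (rep (uea_class \<gg> u)) = \<Phi> u"
proof -
  have "rep (uea_class \<gg> u) - u \<in> uea_ideal \<gg>"
    using U.rep_class[OF u] by simp
  then have "\<Phi> (u + (rep (uea_class \<gg> u) - u)) = \<Phi> u"
    by (simp only: linear_on_add[OF linear u U.uea_ideal_FA] ideal add_0_right)
  then show ?thesis
    by (simp only: add_diff_cancel_left' add_diff_eq)
qed

lemma Z_character_of_functional: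
  assumes mult: "\<And>u v. u \<in> invariants \<Longrightarrow> v \<in> invariants \<Longrightarrow> \<Phi> (fmul u v) = \<Phi> u * \<Phi> v"
    and one: "\<Phi> (word_ind []) = 1"
  shows "Z_character G (\<lambda>c. \<Phi> (rep c))"
proof -
  have scalar: "\<Phi> (rep (uea_class \<gg> (fscale c (word_ind [])))) = c" for c
    using functional_rep_class[OF FA_scale[OF FA_word]] linear_on_scale[OF linear FA_word] one by simp
  have "(\<lambda>c. \<Phi> (rep c)) \<in> ring_hom (Z_alg G) complex_ring"
  proof (rule ring_hom_memI)
    fix c d assume Z: "c \<in> carrier (Z_alg G)" "d \<in> carrier (Z_alg G)"
    note inv = rep_invariant[OF Z(1)] rep_invariant[OF Z(2)]
    note classes = class_rep_Z_alg[OF Z(1), symmetric] class_rep_Z_alg[OF Z(2), symmetric]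
    have "c \<otimes>\<^bsub>Z_alg G\<^esub> d = uea_class \<gg> (fmul (rep c) (rep d))"
      using U.class_mult[OF inv[THEN invariants_FA]] by (simp add: Z_alg_ops flip: classes)
    then show "\<Phi> (rep (c \<otimes>\<^bsub>Z_alg G\<^esub> d)) = \<Phi> (rep c) \<otimes>\<^bsub>complex_ring\<^esub> \<Phi> (rep d)"
      using functional_rep_class[OF FA_fmul[OF inv[THEN invariants_FA]]] mult[OF inv]
      by (simp add: complex_ring_def)
    have "c \<oplus>\<^bsub>Z_alg G\<^esub> d = uea_class \<gg> (rep c + rep d)"
      using U.class_add[OF inv[THEN invariants_FA]] by (simp add: Z_alg_ops flip: classes)
    then show "\<Phi> (rep (c \<oplus>\<^bsub>Z_alg G\<^esub> d)) = \<Phi> (rep c) \<oplus>\<^bsub>complex_ring\<^esub> \<Phi> (rep d)"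
      using functional_rep_class[OF FA_add[OF inv[THEN invariants_FA]]]
        linear_on_add[OF linear inv[THEN invariants_FA]] by (simp add: complex_ring_def)
  next
    show "\<Phi> (rep \<one>\<^bsub>Z_alg G\<^esub>) = \<one>\<^bsub>complex_ring\<^esub>"
      using functional_rep_class[OF FA_word] one by (simp add: Z_alg_ops U.class_one complex_ring_def)
  qed (simp add: complex_ring_def)
  then show ?thesis
    using scalar by (simp add: Z_character_def fscale_def)
qed

end

lemma eigenfunction_iff_invariants:
  assumes rep: "lie_rep \<gg> D V" and f: "f \<in> V"
  shows "(\<forall>u\<in>carrier (Z_alg G). word_action D (rep u) f = fscale (\<eta> u) f) \<longleftrightarrow>
    (\<forall>a\<in>invariants. word_action D a f = fscale (\<eta> (uea_class \<gg> a)) f)"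
proof (intro iffI ballI)
  fix a assume "\<forall>u\<in>carrier (Z_alg G). word_action D (rep u) f = fscale (\<eta> u) f" and a: "a \<in> invariants"
  then show "word_action D a f = fscale (\<eta> (uea_class \<gg> a)) f"
    using lie_rep.word_action_rep_class[OF rep U.lie_subalg_axioms invariants_FA[OF a] f] class_invariant[OF a]
    by auto
next
  fix u assume "\<forall>a\<in>invariants. word_action D a f = fscale (\<eta> (uea_class \<gg> a)) f" and u: "u \<in> carrier (Z_alg G)"
  then show "word_action D (rep u) f = fscale (\<eta> u) f"
    using rep_invariant[OF u] class_rep_Z_alg[OF u] by auto
qed

end

section \<open>Block matrices and product groups\<close>

definition upper_left :: "'a^('n::finite + 'm::finite)^('n + 'm) \<Rightarrow> 'a^'n^'n" where
  "upper_left Z = (\<chi> i j. Z $ Inl i $ Inl j)"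

definition lower_right :: "'a^('n::finite + 'm::finite)^('n + 'm) \<Rightarrow> 'a^'m^'m" where
  "lower_right Z = (\<chi> i j. Z $ Inr i $ Inr j)"

lemma blk_nth [simp]:
  "blk A B $ Inl i $ Inl j = A $ i $ j" "blk A B $ Inr k $ Inr l = B $ k $ l"
  "blk A B $ Inl i $ Inr l = 0" "blk A B $ Inr k $ Inl j = 0"
  by (simp_all add: blk_def)

lemma upper_left_lower_right_nth [simp]: "upper_left Z $ i $ j = Z $ Inl i $ Inl j" "lower_right Z $ k $ l = Z $ Inr k $ Inr l"
  by (simp_all add: upper_left_def lower_right_def)

lemma all_sum_iff: "(\<forall>x :: 'a + 'b. P x) \<longleftrightarrow> (\<forall>x. P (Inl x)) \<and> (\<forall>x. P (Inr x))"
  by (metis sum.exhaust)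

lemma sum_UNIV_Plus:
  "(\<Sum>i\<in>(UNIV :: ('n::finite + 'm::finite) set). f i) = (\<Sum>i\<in>UNIV. f (Inl i)) + (\<Sum>i\<in>UNIV. f (Inr i))"
proof -
  have "(\<Sum>i\<in>UNIV <+> UNIV. f i) = (\<Sum>i\<in>UNIV. f (Inl i)) + (\<Sum>i\<in>UNIV. f (Inr i))"
    by (subst sum.Plus) (simp_all add: o_def)
  then show ?thesis by simp
qed

lemmas blk_eq_simps = vec_eq_iff all_sum_iff

lemma upper_left_blk [simp]: "upper_left (blk A B) = A" and lower_right_blk [simp]: "lower_right (blk A B) = B"
  by (simp_all add: vec_eq_iff)

lemma blk_eq_iff [simp]: "blk A B = blk C D \<longleftrightarrow> A = C \<and> B = D"
  by (metis upper_left_blk lower_right_blk)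

lemma blk_mult: "blk A B ** blk C D = blk (A ** C) (B ** D)"
  for A C :: "'a::semiring_1^'n^'n" and B D :: "'a^'m^'m"
  by (simp add: blk_eq_simps matrix_matrix_mult_def sum_UNIV_Plus)

lemma upper_left_blk_mult: "upper_left (blk A B ** C) = A ** upper_left C" and lower_right_blk_mult: "lower_right (blk A B ** C) = B ** lower_right C"
  for A :: "'a::semiring_1^'n^'n" and B :: "'a^'m^'m"
  by (simp_all add: vec_eq_iff matrix_matrix_mult_def sum_UNIV_Plus)

lemma blk_one [simp]: "blk (mat 1) (mat 1) = mat 1"
  by (simp add: blk_eq_simps mat_def)

lemma upper_left_one [simp]: "upper_left (mat 1) = mat 1" and lower_right_one [simp]: "lower_right (mat 1) = mat 1"
  by (simp_all add: vec_eq_iff mat_def)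

lemma blk_zero [simp]: "blk 0 0 = 0"
  by (simp add: blk_eq_simps)

lemma blk_add: "blk A B + blk C D = blk (A + C) (B + D)"
  for A C :: "'a::monoid_add^'n^'n" and B D :: "'a^'m^'m"
  by (simp add: blk_eq_simps)

lemma blk_scaleR: "c *\<^sub>R blk A B = blk (c *\<^sub>R A) (c *\<^sub>R B)"
  for A :: "real^'n^'n" and B :: "real^'m^'m"
  by (simp add: blk_eq_simps)

lemma blk_msmult: "msmult c (blk A B) = blk (msmult c A) (msmult c B)"
  by (simp add: blk_eq_simps msmult_def map_matrix_def)

lemma blk_bracket: "bracket (blk A B) (blk C D) = blk (bracket A C) (bracket B D)"
  for A C :: "'a::ring_1^'n^'n" and B D :: "'a^'m^'m"
  unfolding bracket_def blk_mult by (simp add: blk_eq_simps)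

lemma map_matrix_zero: "f 0 = 0 \<Longrightarrow> map_matrix f 0 = 0"
  by (simp add: map_matrix_def vec_eq_iff)

lemma map_matrix_blk: "f 0 = 0 \<Longrightarrow> map_matrix f (blk A B) = blk (map_matrix f A) (map_matrix f B)"
  by (simp add: blk_eq_simps map_matrix_def)

lemma invertible_blk:
  fixes A :: "real^'n^'n" and B :: "real^'m^'m"
  shows "invertible (blk A B) \<longleftrightarrow> invertible A \<and> invertible B"
proof
  assume "invertible (blk A B)"
  then obtain C where "blk A B ** C = mat 1"
    using invertible_right_inverse by blast
  then have "A ** upper_left C = mat 1" "B ** lower_right C = mat 1"
    using upper_left_blk_mult[of A B C] lower_right_blk_mult[of A B C] by simp_all
  then show "invertible A \<and> invertible B"
    unfolding invertible_right_inverse by auto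
next
  assume "invertible A \<and> invertible B"
  then have "blk A B ** blk (matrix_inv A) (matrix_inv B) = mat 1"
    by (simp add: blk_mult matrix_inv_mult_self)
  then show "invertible (blk A B)"
    unfolding invertible_right_inverse by (rule exI)
qed

lemma matrix_inv_blk:
  fixes A :: "real^'n^'n" and B :: "real^'m^'m"
  assumes "invertible A" "invertible B"
  shows "matrix_inv (blk A B) = blk (matrix_inv A) (matrix_inv B)"
  by (rule matrix_inv_unique) (simp add: blk_mult matrix_inv_mult_self assms)

lemma mpow_blk: "mpow (blk A B) k = blk (mpow A k) (mpow B k)"
  by (induction k) (simp_all add: blk_mult)

lemma bounded_linear_blk_left: "bounded_linear (\<lambda>A :: real^'n^'n. blk A (0 :: real^'m^'m))"
  by (rule linear_conv_bounded_linear[THEN iffD1], rule linearI) (simp_all add: blk_add blk_scaleR)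

lemma bounded_linear_blk_right: "bounded_linear (\<lambda>B :: real^'m^'m. blk (0 :: real^'n^'n) B)"
  by (rule linear_conv_bounded_linear[THEN iffD1], rule linearI) (simp_all add: blk_add blk_scaleR)

lemma bounded_linear_upper_left: "bounded_linear (upper_left :: real^('n::finite + 'm::finite)^('n + 'm) \<Rightarrow> real^'n^'n)"
  by (rule linear_conv_bounded_linear[THEN iffD1], rule linearI) (simp_all add: vec_eq_iff)

lemma bounded_linear_lower_right: "bounded_linear (lower_right :: real^('n::finite + 'm::finite)^('n + 'm) \<Rightarrow> real^'m^'m)"
  by (rule linear_conv_bounded_linear[THEN iffD1], rule linearI) (simp_all add: vec_eq_iff)

lemma tendsto_blk:
  fixes f :: "'a \<Rightarrow> real^'n^'n" and g :: "'a \<Rightarrow> real^'m^'m"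
  assumes "(f \<longlongrightarrow> A) F" "(g \<longlongrightarrow> B) F"
  shows "((\<lambda>x. blk (f x) (g x)) \<longlongrightarrow> blk A B) F"
proof -
  have "((\<lambda>x. blk (f x) (0 :: real^'m^'m) + blk (0 :: real^'n^'n) (g x)) \<longlongrightarrow> blk A 0 + blk 0 B) F"
    by (intro tendsto_add bounded_linear.tendsto[OF bounded_linear_blk_left]
        bounded_linear.tendsto[OF bounded_linear_blk_right] assms)
  then show ?thesis by (simp add: blk_add)
qed

lemma has_vector_derivative_blk:
  fixes f :: "real \<Rightarrow> real^'n^'n" and g :: "real \<Rightarrow> real^'m^'m"
  assumes "(f has_vector_derivative A) F" "(g has_vector_derivative B) F"
  shows "((\<lambda>x. blk (f x) (g x)) has_vector_derivative blk A B) F"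
proof -
  have "((\<lambda>x. blk (f x) (0 :: real^'m^'m) + blk (0 :: real^'n^'n) (g x)) has_vector_derivative blk A 0 + blk 0 B) F"
    by (intro has_vector_derivative_add bounded_linear.has_vector_derivative[OF bounded_linear_blk_left]
        bounded_linear.has_vector_derivative[OF bounded_linear_blk_right] assms)
  then show ?thesis by (simp add: blk_add)
qed

lemma mexp_blk:
  fixes X :: "real^'n^'n" and Y :: "real^'m^'m"
  shows "mexp (blk X Y) = blk (mexp X) (mexp Y)"
proof (rule sums_unique2[OF mexp_sums])
  have "(\<lambda>k. blk (mpow X k /\<^sub>R fact k) (0 :: real^'m^'m) + blk (0 :: real^'n^'n) (mpow Y k /\<^sub>R fact k)) sums
      (blk (mexp X) 0 + blk 0 (mexp Y))"
    by (intro sums_add bounded_linear.sums[OF bounded_linear_blk_left]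
        bounded_linear.sums[OF bounded_linear_blk_right] mexp_sums)
  then show "(\<lambda>k. mpow (blk X Y) k /\<^sub>R fact k) sums blk (mexp X) (mexp Y)"
    by (simp add: blk_add blk_scaleR mpow_blk)
qed

lemma blk_in_prod_group [simp]: "blk g h \<in> prod_group G H \<longleftrightarrow> g \<in> G \<and> h \<in> H"
  by (auto simp: prod_group_def)

lemma prod_group_cases:
  assumes "x \<in> prod_group G H"
  obtains g h where "g \<in> G" "h \<in> H" "x = blk g h"
  using assms by (auto simp: prod_group_def)

lemma blk_corners_prod_group: "x \<in> prod_group G H \<Longrightarrow> blk (upper_left x) (lower_right x) = x"
  by (auto simp: prod_group_def)

locale group_pair =
  G: closed_linear_group G + H: closed_linear_group H
  for G :: "(real^'n^'n) set" and H :: "(real^'m^'m) set"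
begin

abbreviation "GH \<equiv> prod_group G H"

sublocale GH: closed_linear_group GH
proof
  show "GH \<subseteq> carrier GL"
    by (auto simp: prod_group_def invertible_blk)
  fix x y assume "x \<in> GH" "y \<in> GH"
  then show "x \<otimes>\<^bsub>GL\<^esub> y \<in> GH"
    by (auto simp: prod_group_def blk_mult)
next
  have "blk (mat 1 :: real^'n^'n) (mat 1 :: real^'m^'m) \<in> GH" unfolding blk_in_prod_group by simp
  then show "\<one>\<^bsub>GL\<^esub> \<in> GH" by simp
next
  fix x assume "x \<in> GH"
  then show "inv\<^bsub>GL\<^esub> x \<in> GH"
    by (auto simp: prod_group_def inv_GL invertible_blk matrix_inv_blk)
next
  fix x l assume x: "\<And>n. x n \<in> GH" and lim: "x \<longlonglongrightarrow> l" and l: "invertible l"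
  have corners: "(\<lambda>n. upper_left (x n)) \<longlonglongrightarrow> upper_left l" "(\<lambda>n. lower_right (x n)) \<longlonglongrightarrow> lower_right l"
    using lim by (rule bounded_linear.tendsto[OF bounded_linear_upper_left]
        bounded_linear.tendsto[OF bounded_linear_lower_right])+
  then have "x \<longlonglongrightarrow> blk (upper_left l) (lower_right l)"
    using tendsto_blk by (fastforce simp: blk_corners_prod_group[OF x])
  then have eq: "l = blk (upper_left l) (lower_right l)"
    using lim LIMSEQ_unique by blast
  then have inv: "invertible (upper_left l)" "invertible (lower_right l)"
    using l invertible_blk by metis+
  have "upper_left (x n) \<in> G" "lower_right (x n) \<in> H" for n
    using x[of n] by (auto simp: prod_group_def)
  then have "upper_left l \<in> G" "lower_right l \<in> H"
    using G.closed[OF _ corners(1) inv(1)] H.closed[OF _ corners(2) inv(2)] by blast+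
  then show "l \<in> GH"
    by (subst eq) simp
qed

lemma lie_algebra_prod: "Z \<in> lie_algebra GH \<longleftrightarrow> (\<exists>X\<in>lie_algebra G. \<exists>Y\<in>lie_algebra H. Z = blk X Y)"
proof
  assume Z: "Z \<in> lie_algebra GH"
  have deriv: "((\<lambda>t. mexp (t *\<^sub>R Z)) has_vector_derivative Z) (at 0)"
    by (rule mexp_has_vector_derivative)
  have "((\<lambda>t. blk (upper_left (mexp (t *\<^sub>R Z))) (lower_right (mexp (t *\<^sub>R Z)))) has_vector_derivative
      blk (upper_left Z) (lower_right Z)) (at 0)"
    by (intro has_vector_derivative_blk deriv bounded_linear.has_vector_derivative[OF bounded_linear_upper_left]
        bounded_linear.has_vector_derivative[OF bounded_linear_lower_right])
  then have "((\<lambda>t. mexp (t *\<^sub>R Z)) has_vector_derivative blk (upper_left Z) (lower_right Z)) (at 0)"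
    by (simp only: blk_corners_prod_group[OF GH.mexp_mem[OF Z]])
  then have eq: "Z = blk (upper_left Z) (lower_right Z)"
    by (rule vector_derivative_unique_at[OF deriv])
  have "blk (mexp (t *\<^sub>R upper_left Z)) (mexp (t *\<^sub>R lower_right Z)) \<in> GH" for t
  proof -
    have "mexp (t *\<^sub>R blk (upper_left Z) (lower_right Z)) \<in> GH"
      using GH.mexp_mem[OF Z, of t] eq by simp
    then show ?thesis by (simp only: blk_scaleR mexp_blk)
  qed
  then have "upper_left Z \<in> lie_algebra G" "lower_right Z \<in> lie_algebra H"
    by (auto simp: lie_algebra_def)
  then show "\<exists>X\<in>lie_algebra G. \<exists>Y\<in>lie_algebra H. Z = blk X Y"
    using eq by blast
qed (auto simp: lie_algebra_def blk_scaleR mexp_blk)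

abbreviation "\<gg> \<equiv> lie_algebra_C G"
abbreviation "\<hh> \<equiv> lie_algebra_C H"
abbreviation "\<pp> \<equiv> lie_algebra_C GH"

lemma blk_in_\<pp>_iff: "blk X Y \<in> \<pp> \<longleftrightarrow> X \<in> \<gg> \<and> Y \<in> \<hh>"
  by (auto simp: complexification_def map_matrix_blk lie_algebra_prod)

lemma \<pp>_cases:
  assumes "Z \<in> \<pp>"
  obtains X Y where "X \<in> \<gg>" "Y \<in> \<hh>" "Z = blk X Y"
proof -
  obtain X\<^sub>r Y\<^sub>r X\<^sub>i Y\<^sub>i where re: "map_matrix Re Z = blk X\<^sub>r Y\<^sub>r" and im: "map_matrix Im Z = blk X\<^sub>i Y\<^sub>i"
    using assms unfolding complexification_def lie_algebra_prod by blast
  have entry: "Z $ p $ q = Complex (blk X\<^sub>r Y\<^sub>r $ p $ q) (blk X\<^sub>i Y\<^sub>i $ p $ q)" for p q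
    unfolding re[symmetric] im[symmetric] by (simp add: map_matrix_def)
  have "Z = blk (upper_left Z) (lower_right Z)"
    unfolding blk_eq_simps by (intro conjI allI) (simp_all add: entry zero_complex.code)
  then show thesis
    using assms that blk_in_\<pp>_iff by metis
qed

lemma lie_hom_left: "lie_hom \<gg> \<pp> (\<lambda>X. blk X 0)"
  by (auto simp: lie_hom_def blk_in_\<pp>_iff H.U.zero_mem blk_msmult blk_add blk_bracket)
    (simp_all add: msmult_def map_matrix_def bracket_def vec_eq_iff matrix_matrix_mult_def)

lemma lie_hom_right: "lie_hom \<hh> \<pp> (\<lambda>Y. blk 0 Y)"
  by (auto simp: lie_hom_def blk_in_\<pp>_iff G.U.zero_mem blk_msmult blk_add blk_bracket)
    (simp_all add: msmult_def map_matrix_def bracket_def vec_eq_iff matrix_matrix_mult_def)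

lemma Ad_blk:
  assumes "g \<in> G" "h \<in> H"
  shows "Ad (blk g h) (blk X Y) = blk (Ad g X) (Ad h Y)"
  using assms by (simp add: Ad_def matrix_inv_blk map_matrix_blk blk_mult)

end

section \<open>The enveloping algebra of a product\<close>

context group_pair
begin

abbreviation "\<iota>\<^sub>1 \<equiv> push_words (\<lambda>X. blk X (0 :: complex^'m^'m))"
abbreviation "\<iota>\<^sub>2 \<equiv> push_words (\<lambda>Y. blk (0 :: complex^'n^'n) Y)"

abbreviation tensor (infixl "\<star>" 70) where
  "a \<star> b \<equiv> fmul (\<iota>\<^sub>1 a) (\<iota>\<^sub>2 b)"

lemmas \<iota>\<^sub>1_FA = lie_hom_push_FA[OF lie_hom_left]
  and \<iota>\<^sub>2_FA = lie_hom_push_FA[OF lie_hom_right]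
  and \<iota>\<^sub>1_ideal = lie_hom_push_ideal[OF G.U.lie_subalg_axioms GH.U.lie_subalg_axioms lie_hom_left]
  and \<iota>\<^sub>2_ideal = lie_hom_push_ideal[OF H.U.lie_subalg_axioms GH.U.lie_subalg_axioms lie_hom_right]

lemma tensor_FA: "a \<in> FA \<gg> \<Longrightarrow> b \<in> FA \<hh> \<Longrightarrow> a \<star> b \<in> FA \<pp>"
  by (intro FA_fmul \<iota>\<^sub>1_FA \<iota>\<^sub>2_FA)

lemma tensor_linear_left: "linear_on fscale fscale (FA \<gg>) (\<lambda>a. a \<star> b)"
  by (intro linear_onI)
    (simp_all only: push_add[OF FA_finsupp FA_finsupp] push_scale[OF FA_finsupp] fmul_add_left fmul_scale_left)

lemma tensor_linear_right: "linear_on fscale fscale (FA \<hh>) (\<lambda>b. a \<star> b)"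
  by (intro linear_onI)
    (simp_all only: push_add[OF FA_finsupp FA_finsupp] push_scale[OF FA_finsupp] fmul_add_right fmul_scale_right)

lemma tensor_ideal_left: "a \<in> uea_ideal \<gg> \<Longrightarrow> b \<in> FA \<hh> \<Longrightarrow> a \<star> b \<in> uea_ideal \<pp>"
  by (intro GH.U.uea_ideal_fmul_right \<iota>\<^sub>1_ideal \<iota>\<^sub>2_FA)

lemma tensor_ideal_right: "a \<in> FA \<gg> \<Longrightarrow> b \<in> uea_ideal \<hh> \<Longrightarrow> a \<star> b \<in> uea_ideal \<pp>"
  by (intro GH.U.uea_ideal_fmul_left \<iota>\<^sub>2_ideal \<iota>\<^sub>1_FA)

lemma left_letter_eq_tensor: "word_ind [blk X 0] = word_ind [X] \<star> word_ind []"
  by (simp add: push_word fmul_word)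

lemma right_letter_eq_tensor: "word_ind [blk 0 Y] = word_ind [] \<star> word_ind [Y]"
  by (simp add: push_word fmul_word)

lemma letters_commute:
  assumes "X \<in> \<gg>" "Y \<in> \<hh>"
  shows "fmul (word_ind [blk 0 Y]) (word_ind [blk X 0]) - fmul (word_ind [blk X 0]) (word_ind [blk 0 Y]) \<in> uea_ideal \<pp>"
proof -
  have "bracket (blk 0 Y) (blk X 0) = 0"
    by (simp add: blk_bracket) (simp add: bracket_def vec_eq_iff matrix_matrix_mult_def flip: blk_zero)
  then have "word_ind [blk 0 Y, blk X 0] - word_ind [blk X 0, blk 0 Y] - word_ind [0] \<in> uea_ideal \<pp>"
    using GH.U.bracket_relation[of "blk 0 Y" "blk X 0"] assms by (simp add: blk_in_\<pp>_iff G.U.zero_mem H.U.zero_mem)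
  from GH.U.uea_ideal_add[OF this GH.U.zero_letter] show ?thesis
    by (simp add: fmul_word)
qed

lemma \<iota>\<^sub>1_\<iota>\<^sub>2_commute:
  assumes u: "u \<in> FA \<gg>" and v: "v \<in> FA \<hh>"
  shows "u \<star> v - fmul (\<iota>\<^sub>2 v) (\<iota>\<^sub>1 u) \<in> uea_ideal \<pp>"
proof (rule GH.U.commutator_push_in_ideal[OF _ \<iota>\<^sub>1_FA[OF u] _ v])
  fix Y assume Y: "Y \<in> \<hh>"
  then show mem: "blk 0 Y \<in> \<pp>"
    by (simp add: blk_in_\<pp>_iff G.U.zero_mem)
  have "fmul (word_ind [blk 0 Y]) (\<iota>\<^sub>1 u) - fmul (\<iota>\<^sub>1 u) (word_ind [blk 0 Y]) \<in> uea_ideal \<pp>"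
    by (rule GH.U.commutator_push_in_ideal[OF _ _ letters_commute[OF _ Y] u])
      (use mem in \<open>auto simp: blk_in_\<pp>_iff H.U.zero_mem intro!: FA_word\<close>)
  from fun_vs.subspace_neg[OF GH.U.subspace_uea_ideal this]
  show "fmul (\<iota>\<^sub>1 u) (word_ind [blk 0 Y]) - fmul (word_ind [blk 0 Y]) (\<iota>\<^sub>1 u) \<in> uea_ideal \<pp>"
    by (simp only: minus_diff_eq)
qed

lemma tensor_mult:
  assumes "a \<in> FA \<gg>" "b \<in> FA \<hh>" "a' \<in> FA \<gg>" "b' \<in> FA \<hh>"
  shows "fmul a a' \<star> fmul b b' - fmul (a \<star> b) (a' \<star> b') \<in> uea_ideal \<pp>"
proof -
  note FA = \<iota>\<^sub>1_FA[OF assms(1)] \<iota>\<^sub>2_FA[OF assms(2)] \<iota>\<^sub>1_FA[OF assms(3)] \<iota>\<^sub>2_FA[OF assms(4)]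
  have "fmul a a' \<star> fmul b b' - fmul (a \<star> b) (a' \<star> b') =
      fmul (\<iota>\<^sub>1 a) (fmul (a' \<star> b - fmul (\<iota>\<^sub>2 b) (\<iota>\<^sub>1 a')) (\<iota>\<^sub>2 b'))"
    using FA[THEN FA_finsupp] assms[THEN FA_finsupp]
    by (simp add: push_fmul fmul_assoc fmul_diff_left fmul_diff_right finsupp_fmul)
  also have "\<dots> \<in> uea_ideal \<pp>"
    by (intro GH.U.uea_ideal_fmul_left[OF _ FA(1)] GH.U.uea_ideal_fmul_right[OF _ FA(4)]
        \<iota>\<^sub>1_\<iota>\<^sub>2_commute assms)
  finally show ?thesis .
qed

subsection \<open>Decomposition into tensors\<close>

definition tensor_span :: "((complex^('n + 'm)^('n + 'm)) list \<Rightarrow> complex) set" where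
  "tensor_span = {x + y | x y. x \<in> fun_vs.span {a \<star> b | a b. a \<in> FA \<gg> \<and> b \<in> FA \<hh>} \<and> y \<in> uea_ideal \<pp>}"

lemma subspace_tensor_span: "fun_vs.subspace tensor_span"
  unfolding tensor_span_def by (intro fun_vs.subspace_sums fun_vs.subspace_span GH.U.subspace_uea_ideal)

lemma ideal_in_tensor_span: "y \<in> uea_ideal \<pp> \<Longrightarrow> y \<in> tensor_span"
  unfolding tensor_span_def by (intro CollectI exI[of _ 0] exI[of _ y]) (simp add: fun_vs.span_zero)

lemma tensor_in_tensor_span:
  assumes "a \<in> FA \<gg>" "b \<in> FA \<hh>"
  shows "a \<star> b \<in> tensor_span"
proof -
  have "a \<star> b \<in> fun_vs.span {a \<star> b | a b. a \<in> FA \<gg> \<and> b \<in> FA \<hh>}"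
    by (rule fun_vs.span_base) (use assms in blast)
  then show ?thesis
    unfolding tensor_span_def using GH.U.uea_ideal_zero
    by (intro CollectI exI[of _ "a \<star> b"] exI[of _ 0]) simp
qed

lemma tensor_span_subset_FA: "tensor_span \<subseteq> FA \<pp>"
proof -
  have "fun_vs.span {a \<star> b | a b. a \<in> FA \<gg> \<and> b \<in> FA \<hh>} \<subseteq> FA \<pp>"
    by (rule fun_vs.span_minimal[OF _ subspace_FA]) (auto intro: tensor_FA)
  then show ?thesis
    unfolding tensor_span_def using FA_add GH.U.uea_ideal_FA by blast
qed

lemma tensor_fmul_tensor_span:
  assumes c: "c \<in> FA \<gg>" and d: "d \<in> FA \<hh>" and u: "u \<in> tensor_span"
  shows "fmul (c \<star> d) u \<in> tensor_span"
proof -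
  have cd: "c \<star> d \<in> FA \<pp>" by (rule tensor_FA[OF c d])
  obtain x y where x: "x \<in> fun_vs.span {a \<star> b | a b. a \<in> FA \<gg> \<and> b \<in> FA \<hh>}" and y: "y \<in> uea_ideal \<pp>"
    and u: "u = x + y"
    using u unfolding tensor_span_def by blast
  have "fmul (c \<star> d) x \<in> tensor_span"
    using x
  proof (induction rule: fun_vs.span_induct_alt)
    case base
    show ?case by (simp only: fmul_zero fun_vs.subspace_0[OF subspace_tensor_span])
  next
    case (step k x y)
    then obtain a b where ab: "a \<in> FA \<gg>" "b \<in> FA \<hh>" "x = a \<star> b" by blast
    have "fmul (c \<star> d) x = fmul c a \<star> fmul d b - (fmul c a \<star> fmul d b - fmul (c \<star> d) (a \<star> b))"
      using ab(3) by simp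
    also have "\<dots> \<in> tensor_span"
      by (intro fun_vs.subspace_diff[OF subspace_tensor_span] tensor_in_tensor_span FA_fmul
          ideal_in_tensor_span tensor_mult c d ab)
    finally show ?case
      using step(2) by (simp only: fmul_add_right fmul_scale_right
          fun_vs.subspace_add[OF subspace_tensor_span] fun_vs.subspace_scale[OF subspace_tensor_span])
  qed
  then show ?thesis
    unfolding u fmul_add_right
    by (rule fun_vs.subspace_add[OF subspace_tensor_span _ ideal_in_tensor_span[OF GH.U.uea_ideal_fmul_left[OF y cd]]])
qed

lemma FA_in_tensor_span: "FA \<pp> \<subseteq> tensor_span"
proof (rule FA_subset_if_left_closed[OF subspace_tensor_span])
  have "word_ind [] \<star> word_ind [] \<in> tensor_span"
    by (intro tensor_in_tensor_span FA_word) auto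
  then show "word_ind [] \<in> tensor_span"
    by (simp only: push_word list.map fmul_one_left)
next
  fix Z u assume "Z \<in> \<pp>" and u: "u \<in> tensor_span"
  then obtain X Y where XY: "X \<in> \<gg>" "Y \<in> \<hh>" and Z: "Z = blk X Y" using \<pp>_cases by blast
  let ?x = "word_ind [blk X 0]" and ?y = "word_ind [blk 0 Y]"
  have "word_ind [blk X 0 + blk 0 Y] - (?x + ?y) \<in> uea_ideal \<pp>"
    using XY by (intro GH.U.add_relation) (simp_all add: blk_in_\<pp>_iff G.U.zero_mem H.U.zero_mem)
  then have "fmul (word_ind [Z] - (?x + ?y)) u \<in> uea_ideal \<pp>"
    using GH.U.uea_ideal_fmul_right subsetD[OF tensor_span_subset_FA u] by (simp add: blk_add Z del: minus_apply)
  moreover have "fmul ?x u \<in> tensor_span" "fmul ?y u \<in> tensor_span"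
    unfolding left_letter_eq_tensor right_letter_eq_tensor
    using XY by (intro tensor_fmul_tensor_span[OF _ _ u] FA_word; simp)+
  ultimately have "fmul (word_ind [Z] - (?x + ?y)) u + (fmul ?x u + fmul ?y u) \<in> tensor_span"
    by (intro fun_vs.subspace_add[OF subspace_tensor_span ideal_in_tensor_span]
        fun_vs.subspace_add[OF subspace_tensor_span])
  then show "fmul (word_ind [Z]) u \<in> tensor_span"
    by (simp only: fmul_diff_left fmul_add_left diff_add_cancel)
qed

definition tensor_decomposition ::
  "nat set \<Rightarrow> (nat \<Rightarrow> (complex^'n^'n) list \<Rightarrow> complex) \<Rightarrow> (nat \<Rightarrow> (complex^'m^'m) list \<Rightarrow> complex)
    \<Rightarrow> ((complex^('n + 'm)^('n + 'm)) list \<Rightarrow> complex) \<Rightarrow> bool" where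
  "tensor_decomposition I a b z \<longleftrightarrow> finite I \<and> (\<forall>i\<in>I. a i \<in> FA \<gg> \<and> b i \<in> FA \<hh>) \<and>
     z - (\<Sum>i\<in>I. a i \<star> b i) \<in> uea_ideal \<pp>"

lemma tensor_decompositionD:
  assumes "tensor_decomposition I a b z"
  shows "finite I" "\<And>i. i \<in> I \<Longrightarrow> a i \<in> FA \<gg>" "\<And>i. i \<in> I \<Longrightarrow> b i \<in> FA \<hh>"
    "z - (\<Sum>i\<in>I. a i \<star> b i) \<in> uea_ideal \<pp>"
  using assms by (simp_all add: tensor_decomposition_def del: minus_apply)

lemma tensor_decomposition_cong:
  assumes dec: "tensor_decomposition I a b z" and z': "z' - z \<in> uea_ideal \<pp>"
  shows "tensor_decomposition I a b z'"
proof -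
  have "z' - (\<Sum>i\<in>I. a i \<star> b i) \<in> uea_ideal \<pp>"
    using GH.U.uea_ideal_add[OF z' tensor_decompositionD(4)[OF dec]] by (simp only: diff_add_cancel add_diff_eq)
  then show ?thesis
    using dec by (simp add: tensor_decomposition_def)
qed

lemma tensor_decomposition_exists:
  assumes "z \<in> FA \<pp>"
  shows "\<exists>I a b. tensor_decomposition I a b z"
proof -
  obtain x y where x: "x \<in> fun_vs.span {a \<star> b | a b. a \<in> FA \<gg> \<and> b \<in> FA \<hh>}" and y: "y \<in> uea_ideal \<pp>"
    and z: "z = x + y"
    using FA_in_tensor_span assms unfolding tensor_span_def by blast
  have "\<exists>n a b. (\<forall>i<n. a i \<in> FA \<gg> \<and> b i \<in> FA \<hh>) \<and> x = (\<Sum>i<(n::nat). a i \<star> b i)"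
    using x
  proof (induction rule: fun_vs.span_induct_alt)
    case base
    show ?case by (intro exI[of _ 0]) simp
  next
    case (step c x y)
    then obtain a\<^sub>0 b\<^sub>0 n a b where x: "a\<^sub>0 \<in> FA \<gg>" "b\<^sub>0 \<in> FA \<hh>" "x = a\<^sub>0 \<star> b\<^sub>0"
      and y: "\<forall>i<(n::nat). a i \<in> FA \<gg> \<and> b i \<in> FA \<hh>" "y = (\<Sum>i<n. a i \<star> b i)"
      by blast
    have "fscale c x + y = (\<Sum>i<Suc n. (a(n := fscale c a\<^sub>0)) i \<star> (b(n := b\<^sub>0)) i)"
      using linear_on_scale[OF tensor_linear_left x(1), of c b\<^sub>0] by (simp add: x(3) y(2) add.commute)
    then show ?case
      using x y(1)
      by (intro exI[of _ "Suc n"] exI[of _ "a(n := fscale c a\<^sub>0)"] exI[of _ "b(n := b\<^sub>0)"])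
        (auto simp: FA_scale less_Suc_eq)
  qed
  then obtain n a b where ab: "\<forall>i<n. a i \<in> FA \<gg> \<and> b i \<in> FA \<hh>" "x = (\<Sum>i<(n::nat). a i \<star> b i)"
    by blast
  have "tensor_decomposition {..<n} a b z"
    using y by (simp add: tensor_decomposition_def ab z)
  then show ?thesis by blast
qed

lemma tensor_decomposition_eliminate_right:
  assumes dec: "tensor_decomposition I a b z" and j: "j \<in> I" "c j \<noteq> 0"
    and rel: "(\<Sum>i\<in>I. fscale (c i) (b i)) \<in> uea_ideal \<hh>"
  shows "tensor_decomposition (I - {j}) (\<lambda>i. a i - fscale (c i / c j) (a j)) b z"
proof -
  note dec = tensor_decompositionD[OF dec]
  have "(\<Sum>i\<in>I. a i \<star> b i) - (\<Sum>i\<in>I - {j}. (a i - fscale (c i / c j) (a j)) \<star> b i) \<in> uea_ideal \<pp>"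
    by (rule bilinear_sum_eliminate[where B="\<lambda>a b. a \<star> b", OF subspace_FA subspace_FA
          GH.U.subspace_uea_ideal tensor_linear_left tensor_linear_right])
      (use dec(1-3) j tensor_ideal_right[OF dec(2)[OF j(1)] rel] in auto)
  from GH.U.uea_ideal_add[OF dec(4) this] show ?thesis
    using dec(1-3) j(1) by (simp add: tensor_decomposition_def FA_diff FA_scale del: minus_apply plus_fun_apply)
qed

lemma tensor_decomposition_eliminate_left:
  assumes dec: "tensor_decomposition I a b z" and j: "j \<in> I" "c j \<noteq> 0"
    and rel: "(\<Sum>i\<in>I. fscale (c i) (a i)) \<in> uea_ideal \<gg>"
  shows "tensor_decomposition (I - {j}) a (\<lambda>i. b i - fscale (c i / c j) (b j)) z"
proof -
  note dec = tensor_decompositionD[OF dec]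
  have "(\<Sum>i\<in>I. a i \<star> b i) - (\<Sum>i\<in>I - {j}. a i \<star> (b i - fscale (c i / c j) (b j))) \<in> uea_ideal \<pp>"
    by (rule bilinear_sum_eliminate[where B="\<lambda>b a. a \<star> b", OF subspace_FA subspace_FA
          GH.U.subspace_uea_ideal tensor_linear_right tensor_linear_left])
      (use dec(1-3) j tensor_ideal_left[OF rel dec(3)[OF j(1)]] in auto)
  from GH.U.uea_ideal_add[OF dec(4) this] show ?thesis
    using dec(1-3) j(1) by (simp add: tensor_decomposition_def FA_diff FA_scale del: minus_apply plus_fun_apply)
qed

lemma independent_tensor_decomposition_exists:
  assumes "z \<in> FA \<pp>"
  obtains I a b where "tensor_decomposition I a b z"
    "independent_mod (uea_ideal \<gg>) I a" "independent_mod (uea_ideal \<hh>) I b"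
proof -
  define dec where "dec = (\<lambda>(I, a, b). tensor_decomposition I a b z)"
  have "\<exists>t. dec t"
    using tensor_decomposition_exists[OF assms] by (auto simp: dec_def)
  then obtain t where "dec t" and "\<And>t'. dec t' \<Longrightarrow> card (fst t) \<le> card (fst t')"
    using ex_has_least_nat[of dec _ "\<lambda>t. card (fst t)"] by blast
  then obtain I a b where t: "tensor_decomposition I a b z" and min: "\<And>I' a' b'. tensor_decomposition I' a' b' z \<Longrightarrow> card I \<le> card I'"
    unfolding dec_def by (cases t) force
  have no_smaller: "\<not> tensor_decomposition (I - {j}) a' b' z" if "j \<in> I" for j a' b'
    using min[of "I - {j}"] card_Diff1_less[OF tensor_decompositionD(1)[OF t] that] by fastforce
  show thesis
  proof (rule that[OF t])
    show "independent_mod (uea_ideal \<gg>) I a" "independent_mod (uea_ideal \<hh>) I b"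
      unfolding independent_mod_def
      using tensor_decomposition_eliminate_left[OF t] tensor_decomposition_eliminate_right[OF t] no_smaller by blast+
  qed
qed

end

subsection \<open>Tensor products of functionals\<close>

context group_pair
begin

text \<open>
  \<open>U(\<gg> \<oplus> \<hh>)\<close> acts by right translation on the linear functionals of \<open>U(\<gg>) \<otimes> U(\<hh>)\<close>, which are
  functions on pairs of words; evaluation at the pair of empty words turns \<open>\<alpha> \<otimes> \<beta>\<close> into a functional
  on \<open>U(\<gg> \<oplus> \<hh>)\<close>.
\<close>
definition tensor_op :: "complex^('n + 'm)^('n + 'm) \<Rightarrow> ((complex^'n^'n) list \<times> (complex^'m^'m) list \<Rightarrow> complex)
    \<Rightarrow> (complex^'n^'n) list \<times> (complex^'m^'m) list \<Rightarrow> complex" where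
  "tensor_op Z T = (\<lambda>(a, b). T (a @ [upper_left Z], b) + T (a, b @ [lower_right Z]))"

definition tensor_dual :: "((complex^'n^'n) list \<times> (complex^'m^'m) list \<Rightarrow> complex) set" where
  "tensor_dual = {T. (\<forall>b. (\<lambda>a. T (a, b)) \<in> uea_dual \<gg>) \<and> (\<forall>a. (\<lambda>b. T (a, b)) \<in> uea_dual \<hh>)}"

lemma tensor_dual_left: "T \<in> tensor_dual \<Longrightarrow> (\<lambda>a. T (a, b)) \<in> uea_dual \<gg>"
  and tensor_dual_right: "T \<in> tensor_dual \<Longrightarrow> (\<lambda>b. T (a, b)) \<in> uea_dual \<hh>"
  by (simp_all add: tensor_dual_def)

lemma subspace_tensor_dual: "fun_vs.subspace tensor_dual"
proof -
  have "fun_vs.subspace {T. (\<lambda>a. T (a, b)) \<in> uea_dual \<gg>}" for b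
    using fun_vs.subspace_0[OF subspace_uea_dual[of \<gg>]] fun_vs.subspace_add[OF subspace_uea_dual[of \<gg>]]
      fun_vs.subspace_scale[OF subspace_uea_dual[of \<gg>]]
    by (auto simp: fun_vs.subspace_def plus_fun_def zero_fun_def fscale_def)
  moreover have "fun_vs.subspace {T. (\<lambda>b. T (a, b)) \<in> uea_dual \<hh>}" for a
    using fun_vs.subspace_0[OF subspace_uea_dual[of \<hh>]] fun_vs.subspace_add[OF subspace_uea_dual[of \<hh>]]
      fun_vs.subspace_scale[OF subspace_uea_dual[of \<hh>]]
    by (auto simp: fun_vs.subspace_def plus_fun_def zero_fun_def fscale_def)
  moreover have "tensor_dual = (\<Inter>b. {T. (\<lambda>a. T (a, b)) \<in> uea_dual \<gg>}) \<inter> (\<Inter>a. {T. (\<lambda>b. T (a, b)) \<in> uea_dual \<hh>})"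
    by (auto simp: tensor_dual_def)
  ultimately show ?thesis
    by (auto intro!: fun_vs.subspace_inter fun_vs.subspace_Inter)
qed

lemma tensor_op_closed:
  assumes T: "T \<in> tensor_dual" and X: "X \<in> \<gg>" and Y: "Y \<in> \<hh>"
  shows "tensor_op (blk X Y) T \<in> tensor_dual"
  unfolding tensor_dual_def
proof (intro CollectI conjI allI)
  fix b
  have "(\<lambda>a. T (a @ [X], b)) + (\<lambda>a. T (a, b @ [Y])) \<in> uea_dual \<gg>"
    using G.U.uea_dual_append[OF tensor_dual_left[OF T], of "[X]"] tensor_dual_left[OF T] X
    by (intro fun_vs.subspace_add[OF subspace_uea_dual]) auto
  then show "(\<lambda>a. tensor_op (blk X Y) T (a, b)) \<in> uea_dual \<gg>"
    by (simp add: tensor_op_def plus_fun_def)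
next
  fix a
  have "(\<lambda>b. T (a @ [X], b)) + (\<lambda>b. T (a, b @ [Y])) \<in> uea_dual \<hh>"
    using H.U.uea_dual_append[OF tensor_dual_right[OF T], of "[Y]"] tensor_dual_right[OF T] Y
    by (intro fun_vs.subspace_add[OF subspace_uea_dual]) auto
  then show "(\<lambda>b. tensor_op (blk X Y) T (a, b)) \<in> uea_dual \<hh>"
    by (simp add: tensor_op_def plus_fun_def)
qed

lemma lie_rep_tensor: "lie_rep \<pp> tensor_op tensor_dual"
proof
  fix Z T assume Z: "Z \<in> \<pp>" and T: "T \<in> tensor_dual"
  show "tensor_op Z T \<in> tensor_dual"
    by (rule \<pp>_cases[OF Z]) (simp add: tensor_op_closed[OF T])
next
  fix Z Z' T c d assume mem: "Z \<in> \<pp>" "Z' \<in> \<pp>" and T: "T \<in> tensor_dual"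
  obtain X Y where "X \<in> \<gg>" "Y \<in> \<hh>" "Z = blk X Y"
    using \<pp>_cases[OF mem(1)] .
  moreover obtain X' Y' where "X' \<in> \<gg>" "Y' \<in> \<hh>" "Z' = blk X' Y'"
    using \<pp>_cases[OF mem(2)] .
  ultimately have XY: "X \<in> \<gg>" "X' \<in> \<gg>" "Y \<in> \<hh>" "Y' \<in> \<hh>" and Z: "Z = blk X Y" "Z' = blk X' Y'"
    by simp_all
  note left = tensor_dual_left[OF T] and right = tensor_dual_right[OF T]
  show "tensor_op (msmult c Z + msmult d Z') T = fscale c (tensor_op Z T) + fscale d (tensor_op Z' T)"
    by (auto simp: tensor_op_def Z blk_msmult blk_add fscale_def algebra_simps
        G.U.uea_dual_letter_linear[OF left XY(1,2)] H.U.uea_dual_letter_linear[OF right XY(3,4)])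
  show "tensor_op (bracket Z Z') T = tensor_op Z (tensor_op Z' T) - tensor_op Z' (tensor_op Z T)"
    by (auto simp: tensor_op_def Z blk_bracket
        G.U.uea_dual_letter_bracket[OF left XY(1,2)] H.U.uea_dual_letter_bracket[OF right XY(3,4)])
qed (auto simp: subspace_tensor_dual tensor_op_def fscale_def algebra_simps intro!: linear_onI)

lemma foldr_tensor_left:
  assumes T: "T \<in> tensor_dual"
  shows "foldr tensor_op (map (\<lambda>X. blk X 0) w) T (a, b) = T (a @ w, b)"
proof (induction w arbitrary: a b)
  case (Cons X w)
  then show ?case
    using H.U.uea_dual_zero_letter[OF tensor_dual_right[OF T]] by (simp add: tensor_op_def[of "blk X 0"])
qed simp

lemma foldr_tensor_right:
  assumes T: "T \<in> tensor_dual"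
  shows "foldr tensor_op (map (\<lambda>Y. blk 0 Y) w) T (a, b) = T (a, b @ w)"
proof (induction w arbitrary: a b)
  case (Cons Y w)
  then show ?case
    using G.U.uea_dual_zero_letter[OF tensor_dual_left[OF T]] by (simp add: tensor_op_def[of "blk 0 Y"])
qed simp

lemma word_action_tensor_left:
  assumes "T \<in> tensor_dual" "finsupp u"
  shows "word_action tensor_op (\<iota>\<^sub>1 u) T (a, b) = pairing u (\<lambda>w. T (a @ w, b))"
  using assms by (simp add: word_action_pairing pairing_push foldr_tensor_left)

lemma word_action_tensor_right:
  assumes "T \<in> tensor_dual" "finsupp v"
  shows "word_action tensor_op (\<iota>\<^sub>2 v) T (a, b) = pairing v (\<lambda>w. T (a, b @ w))"
  using assms by (simp add: word_action_pairing pairing_push foldr_tensor_right)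

definition tensor_functional ::
  "((complex^'n^'n) list \<Rightarrow> complex) \<Rightarrow> ((complex^'m^'m) list \<Rightarrow> complex)
    \<Rightarrow> ((complex^('n + 'm)^('n + 'm)) list \<Rightarrow> complex) \<Rightarrow> complex" where
  "tensor_functional \<alpha> \<beta> z = word_action tensor_op z (\<lambda>(a, b). \<alpha> a * \<beta> b) ([], [])"

lemma tensor_functional_linear_on: "linear_on fscale (*) (FA \<pp>) (tensor_functional \<alpha> \<beta>)"
  by (intro linear_onI)
    (simp_all add: tensor_functional_def word_action_add word_action_scale FA_finsupp fscale_def[of _ "word_action _ _ _"])

context
  fixes \<alpha> \<beta>
  assumes \<alpha>: "\<alpha> \<in> uea_dual \<gg>" and \<beta>: "\<beta> \<in> uea_dual \<hh>"
begin

lemma product_in_tensor_dual: "(\<lambda>(a, b). \<alpha> a * \<beta> b) \<in> tensor_dual"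
proof -
  have "(\<lambda>a. \<alpha> a * \<beta> b) \<in> uea_dual \<gg>" for b
    using fun_vs.subspace_scale[OF subspace_uea_dual \<alpha>, of "\<beta> b"] by (simp add: fscale_def mult.commute)
  moreover have "(\<lambda>b. \<alpha> a * \<beta> b) \<in> uea_dual \<hh>" for a
    using fun_vs.subspace_scale[OF subspace_uea_dual \<beta>, of "\<alpha> a"] by (simp add: fscale_def)
  ultimately show ?thesis by (simp add: tensor_dual_def)
qed

lemma tensor_functional_ideal: "z \<in> uea_ideal \<pp> \<Longrightarrow> tensor_functional \<alpha> \<beta> z = 0"
  unfolding tensor_functional_def
  using lie_rep.word_action_ideal[OF lie_rep_tensor GH.U.lie_subalg_axioms _ product_in_tensor_dual] by simp

lemma tensor_functional_cong:
  assumes "z \<in> FA \<pp>" "z - z' \<in> uea_ideal \<pp>"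
  shows "tensor_functional \<alpha> \<beta> z' = tensor_functional \<alpha> \<beta> z"
proof -
  have diff: "z' - z \<in> uea_ideal \<pp>"
    using fun_vs.subspace_neg[OF GH.U.subspace_uea_ideal assms(2)] by (simp only: minus_diff_eq)
  have "tensor_functional \<alpha> \<beta> (z + (z' - z)) = tensor_functional \<alpha> \<beta> z"
    by (simp only: linear_on_add[OF tensor_functional_linear_on assms(1) GH.U.uea_ideal_FA[OF diff]]
        tensor_functional_ideal[OF diff] add_0_right)
  then show ?thesis
    by (simp only: add_diff_cancel_left' add_diff_eq)
qed

lemma tensor_functional_tensor:
  assumes a: "a \<in> FA \<gg>" and b: "b \<in> FA \<hh>"
  shows "tensor_functional \<alpha> \<beta> (a \<star> b) = pairing a \<alpha> * pairing b \<beta>"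
proof -
  interpret lie_rep \<pp> tensor_op tensor_dual by (rule lie_rep_tensor)
  let ?T = "\<lambda>(a, b). \<alpha> a * \<beta> b"
  have "tensor_functional \<alpha> \<beta> (a \<star> b) = word_action tensor_op (\<iota>\<^sub>1 a) (word_action tensor_op (\<iota>\<^sub>2 b) ?T) ([], [])"
    unfolding tensor_functional_def by (simp only: word_action_fmul[OF \<iota>\<^sub>1_FA[OF a] \<iota>\<^sub>2_FA[OF b] product_in_tensor_dual])
  also have "\<dots> = pairing a (\<lambda>w. pairing b (\<lambda>w'. \<alpha> w * \<beta> w'))"
    by (simp add: word_action_tensor_left[OF word_action_closed[OF \<iota>\<^sub>2_FA[OF b] product_in_tensor_dual] FA_finsupp[OF a]]
        word_action_tensor_right[OF product_in_tensor_dual FA_finsupp[OF b]])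
  also have "\<dots> = pairing a \<alpha> * pairing b \<beta>"
    by (simp add: pairing_mult_right mult.commute[of _ "pairing b \<beta>"])
  finally show ?thesis .
qed

lemma tensor_functional_decomposition:
  assumes dec: "tensor_decomposition I a b z" and z: "z \<in> FA \<pp>"
  shows "tensor_functional \<alpha> \<beta> z = (\<Sum>i\<in>I. pairing (a i) \<alpha> * pairing (b i) \<beta>)"
proof -
  note dec = tensor_decompositionD[OF dec]
  have "tensor_functional \<alpha> \<beta> z = tensor_functional \<alpha> \<beta> (\<Sum>i\<in>I. a i \<star> b i)"
    by (rule tensor_functional_cong[OF z dec(4), symmetric])
  also have "\<dots> = (\<Sum>i\<in>I. pairing (a i) \<alpha> * pairing (b i) \<beta>)"
    using dec(2,3) by (simp add: functional.linear_on_sum[OF subspace_FA tensor_functional_linear_on]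
        tensor_FA tensor_functional_tensor)
  finally show ?thesis .
qed

lemma tensor_decompositions_pairing_eq:
  assumes "tensor_decomposition I a b z" "tensor_decomposition J a' b' z" "z \<in> FA \<pp>"
  shows "(\<Sum>i\<in>I. pairing (a i) \<alpha> * pairing (b i) \<beta>) = (\<Sum>j\<in>J. pairing (a' j) \<alpha> * pairing (b' j) \<beta>)"
  using tensor_functional_decomposition[OF assms(1,3)] tensor_functional_decomposition[OF assms(2,3)] by simp

end

subsection \<open>Invariants of the product\<close>

lemma push_Ad_tensor:
  assumes gh: "g \<in> G" "h \<in> H" and a: "a \<in> FA \<gg>" and b: "b \<in> FA \<hh>"
  shows "push_words (Ad (blk g h)) (a \<star> b) = push_words (Ad g) a \<star> push_words (Ad h) b"
proof -
  have "Ad (blk g h) (blk X 0) = blk (Ad g X) 0" "Ad (blk g h) (blk 0 Y) = blk 0 (Ad h Y)" for X Y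
    using Ad_blk[OF gh, of X 0] Ad_blk[OF gh, of 0 Y] by (simp_all add: Ad_def)
  then show ?thesis
    using a b by (simp add: push_fmul push_push finsupp_push FA_finsupp comp_def)
qed

lemma tensor_decomposition_Ad:
  assumes dec: "tensor_decomposition I a b z" and z: "z \<in> GH.invariants" and gh: "g \<in> G" "h \<in> H"
  shows "tensor_decomposition I (\<lambda>i. push_words (Ad g) (a i)) (\<lambda>i. push_words (Ad h) (b i)) z"
proof -
  let ?Ad = "push_words (Ad (blk g h))"
  note mem = tensor_decompositionD(2,3)[OF dec]
  have fin: "finsupp z" "\<And>i. i \<in> I \<Longrightarrow> finsupp (a i \<star> b i)"
    using FA_finsupp[OF GH.invariants_FA[OF z]] FA_finsupp[OF tensor_FA[OF mem]] by auto
  have "?Ad (z - (\<Sum>i\<in>I. a i \<star> b i)) \<in> uea_ideal \<pp>"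
    by (rule lie_hom_push_ideal[OF GH.U.lie_subalg_axioms GH.U.lie_subalg_axioms GH.lie_hom_Ad
          tensor_decompositionD(4)[OF dec]]) (simp add: gh)
  moreover have "?Ad (z - (\<Sum>i\<in>I. a i \<star> b i)) = ?Ad z - (\<Sum>i\<in>I. push_words (Ad g) (a i) \<star> push_words (Ad h) (b i))"
    using fin push_Ad_tensor[OF gh mem] by (simp only: push_diff finsupp_sum push_sum cong: sum.cong)
  ultimately have "tensor_decomposition I (\<lambda>i. push_words (Ad g) (a i)) (\<lambda>i. push_words (Ad h) (b i)) (?Ad z)"
    using tensor_decompositionD(1)[OF dec] lie_hom_push_FA[OF G.lie_hom_Ad[OF gh(1)] mem(1)]
      lie_hom_push_FA[OF H.lie_hom_Ad[OF gh(2)] mem(2)] by (simp add: tensor_decomposition_def)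
  moreover have "z - ?Ad z \<in> uea_ideal \<pp>"
    using z gh fun_vs.subspace_neg[OF GH.U.subspace_uea_ideal, of "?Ad z - z"]
    by (simp add: GH.invariants_def del: minus_apply)
  ultimately show ?thesis
    by (rule tensor_decomposition_cong)
qed

lemma invariant_tensor_decomposition_exists:
  assumes z: "z \<in> GH.invariants"
  obtains I a b where "tensor_decomposition I a b z"
    "\<And>i. i \<in> I \<Longrightarrow> a i \<in> G.invariants" "\<And>i. i \<in> I \<Longrightarrow> b i \<in> H.invariants"
proof -
  have zFA: "z \<in> FA \<pp>" by (rule GH.invariants_FA[OF z])
  obtain I a b where dec: "tensor_decomposition I a b z"
    and ind: "independent_mod (uea_ideal \<gg>) I a" "independent_mod (uea_ideal \<hh>) I b"
    using independent_tensor_decomposition_exists[OF zFA] .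
  note mem = tensor_decompositionD(2,3)[OF dec] and fin = tensor_decompositionD(1)[OF dec]
  have "push_words (Ad g) (a j) - a j \<in> uea_ideal \<gg>" if "j \<in> I" "g \<in> G" for g j
  proof (rule independent_coefficients_unique[OF G.U.lie_subalg_axioms H.U.lie_subalg_axioms fin that(1) _ _ _ ind(2)])
    have Ad: "tensor_decomposition I (\<lambda>i. push_words (Ad g) (a i)) (\<lambda>i. push_words (Ad (mat 1)) (b i)) z"
      by (rule tensor_decomposition_Ad[OF dec z that(2) H.one_mem])
    show "(\<Sum>i\<in>I. pairing (push_words (Ad g) (a i)) \<alpha> * pairing (b i) \<beta>) = (\<Sum>i\<in>I. pairing (a i) \<alpha> * pairing (b i) \<beta>)"
      if "\<alpha> \<in> uea_dual \<gg>" "\<beta> \<in> uea_dual \<hh>" for \<alpha> \<beta>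
      using tensor_decompositions_pairing_eq[OF that Ad dec zFA]
      by (simp add: push_Ad_one[OF FA_finsupp[OF mem(2)]] cong: sum.cong)
  qed (use mem lie_hom_push_FA[OF G.lie_hom_Ad[OF that(2)]] in auto)
  then have a: "a i \<in> G.invariants" if "i \<in> I" for i
    using mem(1) that by (simp add: G.invariants_def)
  have "push_words (Ad h) (b j) - b j \<in> uea_ideal \<hh>" if "j \<in> I" "h \<in> H" for h j
  proof (rule independent_coefficients_unique[OF H.U.lie_subalg_axioms G.U.lie_subalg_axioms fin that(1) _ _ _ ind(1)])
    have Ad: "tensor_decomposition I (\<lambda>i. push_words (Ad (mat 1)) (a i)) (\<lambda>i. push_words (Ad h) (b i)) z"
      by (rule tensor_decomposition_Ad[OF dec z G.one_mem that(2)])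
    show "(\<Sum>i\<in>I. pairing (push_words (Ad h) (b i)) \<beta> * pairing (a i) \<alpha>) = (\<Sum>i\<in>I. pairing (b i) \<beta> * pairing (a i) \<alpha>)"
      if "\<beta> \<in> uea_dual \<hh>" "\<alpha> \<in> uea_dual \<gg>" for \<alpha> \<beta>
      using tensor_decompositions_pairing_eq[OF that(2,1) Ad dec zFA]
      by (simp add: push_Ad_one[OF FA_finsupp[OF mem(1)]] mult.commute cong: sum.cong)
  qed (use mem lie_hom_push_FA[OF H.lie_hom_Ad[OF that(2)]] in auto)
  then have "b i \<in> H.invariants" if "i \<in> I" for i
    using mem(2) that by (simp add: H.invariants_def)
  with dec a show thesis by (rule that)
qed

lemma tensor_invariant:
  assumes a: "a \<in> G.invariants" and b: "b \<in> H.invariants"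
  shows "a \<star> b \<in> GH.invariants"
  unfolding GH.invariants_def
proof (intro CollectI conjI ballI)
  note FA = G.invariants_FA[OF a] H.invariants_FA[OF b]
  show "a \<star> b \<in> FA \<pp>" by (rule tensor_FA[OF FA])
  fix x assume "x \<in> GH"
  then obtain g h where x: "g \<in> G" "h \<in> H" "x = blk g h" by (rule prod_group_cases)
  let ?a = "push_words (Ad g) a" and ?b = "push_words (Ad h) b"
  have Ad_FA: "?a \<in> FA \<gg>" "?b \<in> FA \<hh>"
    by (rule lie_hom_push_FA[OF G.lie_hom_Ad[OF x(1)] FA(1)] lie_hom_push_FA[OF H.lie_hom_Ad[OF x(2)] FA(2)])+
  have "push_words (Ad x) (a \<star> b) - a \<star> b = (?a - a) \<star> ?b + a \<star> (?b - b)"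
    unfolding x(3) push_Ad_tensor[OF x(1,2) FA] push_diff[OF Ad_FA(1)[THEN FA_finsupp] FA(1)[THEN FA_finsupp]]
      push_diff[OF Ad_FA(2)[THEN FA_finsupp] FA(2)[THEN FA_finsupp]] fmul_diff_left fmul_diff_right
    by simp
  also have "\<dots> \<in> uea_ideal \<pp>"
    using a b x by (intro GH.U.uea_ideal_add tensor_ideal_left tensor_ideal_right Ad_FA FA)
      (simp_all add: G.invariants_def H.invariants_def)
  finally show "push_words (Ad x) (a \<star> b) - a \<star> b \<in> uea_ideal \<pp>" .
qed

lemma prod_invariants_induct [consumes 1, case_names ideal tensor add]:
  assumes z: "z \<in> GH.invariants"
    and ideal: "\<And>y. y \<in> uea_ideal \<pp> \<Longrightarrow> P y"
    and tensor: "\<And>a b. a \<in> G.invariants \<Longrightarrow> b \<in> H.invariants \<Longrightarrow> P (a \<star> b)"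
    and add: "\<And>x y. x \<in> GH.invariants \<Longrightarrow> y \<in> GH.invariants \<Longrightarrow> P x \<Longrightarrow> P y \<Longrightarrow> P (x + y)"
  shows "P z"
proof -
  obtain I a b where dec: "tensor_decomposition I a b z"
    and ab: "\<And>i. i \<in> I \<Longrightarrow> a i \<in> G.invariants" "\<And>i. i \<in> I \<Longrightarrow> b i \<in> H.invariants"
    using invariant_tensor_decomposition_exists[OF z] by blast
  have sum: "(\<Sum>i\<in>J. a i \<star> b i) \<in> GH.invariants \<and> P (\<Sum>i\<in>J. a i \<star> b i)" if "finite J" "J \<subseteq> I" for J
    using that
  proof (induction J rule: finite_induct)
    case empty
    show ?case
      unfolding sum.empty by (intro conjI GH.uea_ideal_invariants ideal GH.U.uea_ideal_zero)
  next
    case (insert i J)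
    then have i: "i \<in> I" and J: "(\<Sum>i\<in>J. a i \<star> b i) \<in> GH.invariants" "P (\<Sum>i\<in>J. a i \<star> b i)"
      by auto
    note i = tensor_invariant[OF ab(1)[OF i] ab(2)[OF i]] tensor[OF ab(1)[OF i] ab(2)[OF i]]
    show ?case
      unfolding sum.insert[OF insert.hyps]
      by (intro conjI fun_vs.subspace_add[OF GH.subspace_invariants] add i J)
  qed
  note rest = tensor_decompositionD(4)[OF dec]
  have "P (z - (\<Sum>i\<in>I. a i \<star> b i) + (\<Sum>i\<in>I. a i \<star> b i))"
    using sum[OF tensor_decompositionD(1)[OF dec] subset_refl]
    by (intro add[OF GH.uea_ideal_invariants[OF rest] _ ideal[OF rest]]) simp_all
  then show ?thesis
    by (simp only: diff_add_cancel)
qed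

subsection \<open>The product character\<close>

lemma tensor_functional_fmul_tensor:
  assumes "\<alpha> \<in> uea_dual \<gg>" "\<beta> \<in> uea_dual \<hh>" "a \<in> FA \<gg>" "b \<in> FA \<hh>" "a' \<in> FA \<gg>" "b' \<in> FA \<hh>"
  shows "tensor_functional \<alpha> \<beta> (fmul (a \<star> b) (a' \<star> b')) = pairing (fmul a a') \<alpha> * pairing (fmul b b') \<beta>"
  using tensor_functional_cong[OF assms(1,2) _ tensor_mult[OF assms(3-6)]]
    tensor_functional_tensor[OF assms(1,2), of "fmul a a'" "fmul b b'"] assms(3-6)
  by (simp add: tensor_FA FA_fmul)

context
  fixes \<alpha> \<beta>
  assumes \<alpha>: "\<alpha> \<in> uea_dual \<gg>" and \<beta>: "\<beta> \<in> uea_dual \<hh>"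
    and \<alpha>_mult: "\<And>u v. u \<in> G.invariants \<Longrightarrow> v \<in> G.invariants \<Longrightarrow> pairing (fmul u v) \<alpha> = pairing u \<alpha> * pairing v \<alpha>"
    and \<beta>_mult: "\<And>u v. u \<in> H.invariants \<Longrightarrow> v \<in> H.invariants \<Longrightarrow> pairing (fmul u v) \<beta> = pairing u \<beta> * pairing v \<beta>"
begin

lemma tensor_functional_tensor_mult:
  assumes ab: "a \<in> G.invariants" "b \<in> H.invariants" and z: "z \<in> GH.invariants"
  shows "tensor_functional \<alpha> \<beta> (fmul (a \<star> b) z) = tensor_functional \<alpha> \<beta> (a \<star> b) * tensor_functional \<alpha> \<beta> z"
  using z
proof (induction rule: prod_invariants_induct)
  case (ideal y)
  then have "fmul (a \<star> b) y \<in> uea_ideal \<pp>"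
    using ab by (intro GH.U.uea_ideal_fmul_left tensor_FA G.invariants_FA H.invariants_FA)
  then show ?case by (simp add: tensor_functional_ideal[OF \<alpha> \<beta>] ideal)
next
  case (tensor a' b')
  then show ?case
    using ab by (simp add: tensor_functional_fmul_tensor[OF \<alpha> \<beta>] tensor_functional_tensor[OF \<alpha> \<beta>]
        G.invariants_FA H.invariants_FA \<alpha>_mult \<beta>_mult)
next
  case (add x y)
  then show ?case
    using ab by (simp add: fmul_add_right linear_on_add[OF tensor_functional_linear_on] FA_fmul tensor_FA
        GH.invariants_FA G.invariants_FA H.invariants_FA distrib_left del: plus_fun_apply)
qed

lemma tensor_functional_mult:
  assumes z: "z \<in> GH.invariants" and z': "z' \<in> GH.invariants"
  shows "tensor_functional \<alpha> \<beta> (fmul z z') = tensor_functional \<alpha> \<beta> z * tensor_functional \<alpha> \<beta> z'"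
  using z
proof (induction rule: prod_invariants_induct)
  case (ideal y)
  then have "fmul y z' \<in> uea_ideal \<pp>"
    by (intro GH.U.uea_ideal_fmul_right GH.invariants_FA[OF z'])
  then show ?case by (simp add: tensor_functional_ideal[OF \<alpha> \<beta>] ideal)
next
  case (tensor a b)
  then show ?case by (rule tensor_functional_tensor_mult[OF _ _ z'])
next
  case (add x y)
  then show ?case
    by (simp add: fmul_add_left linear_on_add[OF tensor_functional_linear_on] FA_fmul GH.invariants_FA z'
        distrib_right del: plus_fun_apply)
qed

end

lemma prod_character_exists:
  assumes \<eta>: "Z_character G \<eta>" and \<eta>': "Z_character H \<eta>'"
  shows "\<exists>\<psi>. Z_character GH \<psi> \<and> (\<forall>u\<in>carrier (Z_alg G). \<forall>v\<in>carrier (Z_alg H).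
     \<psi> (uea_map \<pp> (\<lambda>X. blk X 0) u \<otimes>\<^bsub>U_alg GH\<^esub> uea_map \<pp> (\<lambda>Y. blk 0 Y) v) = \<eta> u * \<eta>' v)"
proof -
  obtain \<alpha> where \<alpha>: "\<alpha> \<in> uea_dual \<gg>" "\<And>u. u \<in> G.invariants \<Longrightarrow> pairing u \<alpha> = \<eta> (uea_class \<gg> u)"
    using G.Z_character_dual[OF \<eta>] by blast
  obtain \<beta> where \<beta>: "\<beta> \<in> uea_dual \<hh>" "\<And>u. u \<in> H.invariants \<Longrightarrow> pairing u \<beta> = \<eta>' (uea_class \<hh> u)"
    using H.Z_character_dual[OF \<eta>'] by blast
  let ?\<Phi> = "tensor_functional \<alpha> \<beta>"
  note linear = tensor_functional_linear_on[of \<alpha> \<beta>] and ideal = tensor_functional_ideal[OF \<alpha>(1) \<beta>(1)]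
  have tensor: "?\<Phi> (a \<star> b) = \<eta> (uea_class \<gg> a) * \<eta>' (uea_class \<hh> b)"
    if "a \<in> G.invariants" "b \<in> H.invariants" for a b
    using that by (simp add: tensor_functional_tensor[OF \<alpha>(1) \<beta>(1)] G.invariants_FA H.invariants_FA \<alpha>(2) \<beta>(2))
  have "?\<Phi> (word_ind []) = 1"
    using tensor[OF G.invariants_one H.invariants_one]
    by (simp add: push_word fmul_one_left G.Z_character_one[OF \<eta>] H.Z_character_one[OF \<eta>'])
  moreover have "?\<Phi> (fmul z z') = ?\<Phi> z * ?\<Phi> z'" if "z \<in> GH.invariants" "z' \<in> GH.invariants" for z z'
    using that by (intro tensor_functional_mult[OF \<alpha>(1) \<beta>(1)])
      (simp_all add: \<alpha>(2) \<beta>(2) G.invariants_fmul H.invariants_fmul G.Z_character_fmul[OF \<eta>] H.Z_character_fmul[OF \<eta>'])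
  ultimately have "Z_character GH (\<lambda>c. ?\<Phi> (rep c))"
    by (intro GH.Z_character_of_functional[OF linear ideal])
  moreover have "?\<Phi> (rep (uea_map \<pp> (\<lambda>X. blk X 0) u \<otimes>\<^bsub>U_alg GH\<^esub> uea_map \<pp> (\<lambda>Y. blk 0 Y) v)) = \<eta> u * \<eta>' v"
    if uv: "u \<in> carrier (Z_alg G)" "v \<in> carrier (Z_alg H)" for u v
  proof -
    note inv = G.rep_invariant[OF uv(1)] H.rep_invariant[OF uv(2)]
    note FA = G.invariants_FA[OF inv(1)] H.invariants_FA[OF inv(2)]
    have "uea_map \<pp> (\<lambda>X. blk X 0) u \<otimes>\<^bsub>U_alg GH\<^esub> uea_map \<pp> (\<lambda>Y. blk 0 Y) v = uea_class \<pp> (rep u \<star> rep v)"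
      unfolding uea_map_def by (rule GH.U.class_mult[OF \<iota>\<^sub>1_FA[OF FA(1)] \<iota>\<^sub>2_FA[OF FA(2)]])
    then show ?thesis
      using GH.functional_rep_class[OF linear ideal tensor_FA[OF FA]] tensor[OF inv]
      by (simp add: G.class_rep_Z_alg[OF uv(1)] H.class_rep_Z_alg[OF uv(2)])
  qed
  ultimately show ?thesis by blast
qed

context
  fixes \<eta> \<eta>'
  assumes \<eta>: "Z_character G \<eta>" and \<eta>': "Z_character H \<eta>'"
begin

lemma Z_character_prod_character: "Z_character GH (prod_character G H \<eta> \<eta>')"
  unfolding prod_character_def using someI_ex[OF prod_character_exists[OF \<eta> \<eta>']] by blast

lemma prod_character_tensor:
  assumes a: "a \<in> G.invariants" and b: "b \<in> H.invariants"
  shows "prod_character G H \<eta> \<eta>' (uea_class \<pp> (a \<star> b)) = \<eta> (uea_class \<gg> a) * \<eta>' (uea_class \<hh> b)"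
proof -
  note FA = G.invariants_FA[OF a] H.invariants_FA[OF b]
  have "prod_character G H \<eta> \<eta>' (uea_map \<pp> (\<lambda>X. blk X 0) (uea_class \<gg> a) \<otimes>\<^bsub>U_alg GH\<^esub>
      uea_map \<pp> (\<lambda>Y. blk 0 Y) (uea_class \<hh> b)) = \<eta> (uea_class \<gg> a) * \<eta>' (uea_class \<hh> b)"
    unfolding prod_character_def
    using someI_ex[OF prod_character_exists[OF \<eta> \<eta>']] G.class_invariant[OF a] H.class_invariant[OF b] by blast
  then show ?thesis
    by (simp only: uea_map_class[OF G.U.lie_subalg_axioms GH.U.lie_subalg_axioms lie_hom_left FA(1)]
        uea_map_class[OF H.U.lie_subalg_axioms GH.U.lie_subalg_axioms lie_hom_right FA(2)]
        GH.U.class_mult[OF \<iota>\<^sub>1_FA[OF FA(1)] \<iota>\<^sub>2_FA[OF FA(2)]])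
qed

end

end

section \<open>Pulling back along the multiplication map\<close>

lemma smooth_pullback:
  fixes A :: "(real^'n^'n) set" and B :: "(real^'m^'m) set" and \<phi> :: "real^'m^'m \<Rightarrow> real^'n^'n"
  assumes f: "f \<in> smooth_functions A" and V: "open V" "B \<subseteq> V" "\<And>k. Ck_on k V \<phi>"
    and \<phi>: "\<And>x. x \<in> B \<Longrightarrow> \<phi> x \<in> A"
  shows "(\<lambda>x. if x \<in> B then f (\<phi> x) else 0) \<in> smooth_functions B"
  unfolding smooth_functions_iff
proof (intro conjI allI impI ballI)
  fix x assume x: "x \<in> B"
  obtain U F where "local_extension A f (\<phi> x) U F"
    using f \<phi>[OF x] unfolding smooth_functions_iff by blast
  then have U: "open U" "\<phi> x \<in> U" "\<And>k. Ck_on k U F" and F: "\<And>y. y \<in> U \<Longrightarrow> y \<in> A \<Longrightarrow> f y = F y"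
    by (auto simp: local_extension_def)
  define W where "W = V \<inter> \<phi> -` U"
  have W: "open W" "x \<in> W"
    using continuous_open_preimage[OF Ck_on_continuous[OF V(3)] V(1) U(1)] V(2) U(2) x
    by (auto simp: W_def)
  have "Ck_on k W (\<lambda>y. F (\<phi> y))" for k
    by (rule Ck_on_compose[OF U(1) W(1) _ Ck_on_subset[OF V(3)] U(3)]) (auto simp: W_def)
  then have "local_extension B (\<lambda>x. if x \<in> B then f (\<phi> x) else 0) x W (\<lambda>y. F (\<phi> y))"
    using W F \<phi> by (auto simp: local_extension_def W_def)
  then show "\<exists>U F. local_extension B (\<lambda>x. if x \<in> B then f (\<phi> x) else 0) x U F" by blast
qed simp

locale subgroup_pair = group_pair G H for G H :: "(real^'n^'n) set" +
  assumes sub: "H \<subseteq> G"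
begin

definition mult_pullback :: "(real^'n^'n \<Rightarrow> complex) \<Rightarrow> real^('n + 'n)^('n + 'n) \<Rightarrow> complex" where
  "mult_pullback f x = (if x \<in> GH then f (lower_right x ** matrix_inv (upper_left x)) else 0)"

definition section_pullback :: "(real^('n + 'n)^('n + 'n) \<Rightarrow> complex) \<Rightarrow> real^'n^'n \<Rightarrow> complex" where
  "section_pullback F x = (if x \<in> G then F (blk (matrix_inv x) (mat 1)) else 0)"

lemma mult_pullback_blk: "g \<in> G \<Longrightarrow> h \<in> H \<Longrightarrow> mult_pullback f (blk g h) = f (h ** matrix_inv g)"
  by (simp add: mult_pullback_def)

lemma mult_pullback_off: "x \<notin> GH \<Longrightarrow> mult_pullback f x = 0"
  by (simp add: mult_pullback_def)

lemma linear_mult_pullback: "Vector_Spaces.linear fscale fscale mult_pullback"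
  by (auto simp: Vector_Spaces.linear_iff fun_vs.vector_space_axioms mult_pullback_def fscale_def)

lemma mult_pullback_smooth:
  assumes "f \<in> smooth_functions G"
  shows "mult_pullback f \<in> smooth_functions GH"
proof -
  let ?V = "{x :: real^('n + 'n)^('n + 'n). invertible (upper_left x)}"
  have V: "open ?V"
    using open_vimage[OF open_invertible linear_continuous_on[OF bounded_linear_upper_left]]
    by (simp add: vimage_def)
  have "Ck_on k ?V (\<lambda>x. lower_right x ** matrix_inv (upper_left x))" for k
    by (intro Ck_on_bilinear[OF V matrix_mult.bounded_bilinear_axioms] Ck_on_bounded_linear[OF V] bounded_linear_lower_right
        Ck_on_compose[OF open_invertible V _ Ck_on_bounded_linear[OF V bounded_linear_upper_left] Ck_on_matrix_inv]) simp
  then have "(\<lambda>x. if x \<in> GH then f (lower_right x ** matrix_inv (upper_left x)) else 0) \<in> smooth_functions GH"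
    using sub by (intro smooth_pullback[OF assms V]) (auto elim!: prod_group_cases)
  then show ?thesis
    by (simp add: mult_pullback_def[abs_def])
qed

lemma section_pullback_smooth:
  assumes "F \<in> smooth_functions GH"
  shows "section_pullback F \<in> smooth_functions G"
proof -
  have "Ck_on k {x :: real^'n^'n. invertible x} (\<lambda>x. blk (matrix_inv x) (0 :: real^'n^'n) + blk (0 :: real^'n^'n) (mat 1))" for k
    by (intro Ck_on_add[OF open_invertible] Ck_on_compose_linear[OF open_invertible bounded_linear_blk_left]
        Ck_on_matrix_inv Ck_on_const[OF open_invertible])
  then have "Ck_on k {x :: real^'n^'n. invertible x} (\<lambda>x. blk (matrix_inv x) (mat 1 :: real^'n^'n))" for k
    by (simp add: blk_add)
  then have "(\<lambda>x. if x \<in> G then F (blk (matrix_inv x) (mat 1)) else 0) \<in> smooth_functions G"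
    by (intro smooth_pullback[OF assms open_invertible]) auto
  then show ?thesis
    by (simp add: section_pullback_def[abs_def])
qed

lemma mult_pullback_inj_on: "inj_on mult_pullback (smooth_functions G)"
proof (intro inj_onI ext)
  fix f f' x assume f: "f \<in> smooth_functions G" "f' \<in> smooth_functions G" and eq: "mult_pullback f = mult_pullback f'"
  show "f x = f' x"
  proof (cases "x \<in> G")
    case True
    then have "mult_pullback f (blk (matrix_inv x) (mat 1)) = f x" for f
      by (simp add: mult_pullback_blk matrix_inv_matrix_inv)
    then show ?thesis using eq by metis
  qed (simp add: smooth_functions_off[OF f(1)] smooth_functions_off[OF f(2)])
qed

subsection \<open>The differential operators on the pullback\<close>

lemma mult_pullback_translate:
  assumes k: "k \<in> G" "k' \<in> H"
  shows "mult_pullback f (blk k k' ** x) = mult_pullback (\<lambda>y. f (k' ** y ** matrix_inv k)) x"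
proof (cases "x \<in> GH")
  case True
  then obtain g h where "g \<in> G" "h \<in> H" "x = blk g h" by (rule prod_group_cases)
  then show ?thesis
    using k by (simp add: blk_mult mult_pullback_blk matrix_inv_mult matrix_mul_assoc)
next
  case False
  then have "blk k k' ** x \<notin> GH"
    using k GH.mult_mem_cancel_left[of "blk k k'" x] by simp
  then show ?thesis
    using False by (simp add: mult_pullback_off)
qed

lemma L_real_mult_pullback_left:
  assumes X: "X \<in> lie_algebra G"
  shows "L_real (blk X 0) (mult_pullback f) = mult_pullback (R_real X f)"
proof
  fix x
  have "mult_pullback f (mexp ((- t) *\<^sub>R blk X 0) ** x) = mult_pullback (\<lambda>y. f (y ** mexp (t *\<^sub>R X))) x" for t
    using mult_pullback_translate[OF G.mexp_mem[OF X] H.one_mem, of f "- t" x]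
    by (simp add: blk_scaleR mexp_blk matrix_inv_mexp del: scaleR_minus_left) simp
  then show "L_real (blk X 0) (mult_pullback f) x = mult_pullback (R_real X f) x"
    by (simp add: L_real_def R_real_def mult_pullback_def)
qed

lemma L_real_mult_pullback_right:
  assumes Y: "Y \<in> lie_algebra H"
  shows "L_real (blk 0 Y) (mult_pullback f) = mult_pullback (L_real Y f)"
proof
  fix x
  have "mult_pullback f (mexp ((- t) *\<^sub>R blk 0 Y) ** x) = mult_pullback (\<lambda>y. f (mexp ((- t) *\<^sub>R Y) ** y)) x" for t
    using mult_pullback_translate[OF G.one_mem H.mexp_mem[OF Y], of f "- t" x]
    by (simp add: blk_scaleR mexp_blk del: scaleR_minus_left)
  then show "L_real (blk 0 Y) (mult_pullback f) x = mult_pullback (L_real Y f) x"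
    by (simp add: L_real_def mult_pullback_def)
qed

lemma L_lie_mult_pullback_left:
  "X \<in> \<gg> \<Longrightarrow> L_lie (blk X 0) (mult_pullback f) = mult_pullback (R_lie X f)"
  by (simp add: L_lie_complexify R_lie_complexify complexify_action_def complexification_def map_matrix_blk
      map_matrix_zero L_real_mult_pullback_left fun_pair.linear_add[OF linear_mult_pullback] fun_pair.linear_scale[OF linear_mult_pullback])

lemma L_lie_mult_pullback_right:
  "Y \<in> \<hh> \<Longrightarrow> L_lie (blk 0 Y) (mult_pullback f) = mult_pullback (L_lie Y f)"
  by (simp add: L_lie_complexify complexify_action_def complexification_def map_matrix_blk
      map_matrix_zero L_real_mult_pullback_right fun_pair.linear_add[OF linear_mult_pullback] fun_pair.linear_scale[OF linear_mult_pullback])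

sublocale RG: lie_rep \<gg> R_lie "smooth_functions G"
  by (rule G.lie_rep_R[OF G.subspace_lie_algebra G.bracket_in_lie_algebra subset_refl])

sublocale LH: lie_rep \<hh> L_lie "smooth_functions G"
  by (rule G.lie_rep_L[OF H.subspace_lie_algebra H.bracket_in_lie_algebra]) (use sub in \<open>auto simp: lie_algebra_def\<close>)

sublocale LGH: lie_rep \<pp> L_lie "smooth_functions GH"
  by (rule GH.lie_rep_L[OF GH.subspace_lie_algebra GH.bracket_in_lie_algebra subset_refl])

lemma word_action_tensor_mult_pullback:
  assumes f: "f \<in> smooth_functions G" and a: "a \<in> FA \<gg>" and b: "b \<in> FA \<hh>"
  shows "word_action L_lie (a \<star> b) (mult_pullback f) = mult_pullback (word_action R_lie a (word_action L_lie b f))"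
proof -
  have left: "word_action L_lie (\<iota>\<^sub>1 a) (mult_pullback f) = mult_pullback (word_action R_lie a f)" for f
    by (rule word_action_push_intertwine[OF linear_mult_pullback a]) (rule L_lie_mult_pullback_left)
  have right: "word_action L_lie (\<iota>\<^sub>2 b) (mult_pullback f) = mult_pullback (word_action L_lie b f)" for f
    by (rule word_action_push_intertwine[OF linear_mult_pullback b]) (rule L_lie_mult_pullback_right)
  show ?thesis
    by (simp only: LGH.word_action_fmul[OF \<iota>\<^sub>1_FA[OF a] \<iota>\<^sub>2_FA[OF b] mult_pullback_smooth[OF f]] left right)
qed

context
  fixes \<eta> \<eta>' f
  assumes \<eta>: "Z_character G \<eta>" and \<eta>': "Z_character H \<eta>'" and f: "f \<in> smooth_functions G"
begin

lemma eigenfunction_if_mult_pullback: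
  assumes eigen: "\<And>z. z \<in> GH.invariants \<Longrightarrow>
      word_action L_lie z (mult_pullback f) = fscale (prod_character G H \<eta> \<eta>' (uea_class \<pp> z)) (mult_pullback f)"
    and a: "a \<in> G.invariants" and b: "b \<in> H.invariants"
  shows "word_action R_lie a (word_action L_lie b f) = fscale (\<eta> (uea_class \<gg> a) * \<eta>' (uea_class \<hh> b)) f"
proof (rule inj_onD[OF mult_pullback_inj_on])
  note FA = G.invariants_FA[OF a] H.invariants_FA[OF b]
  show "mult_pullback (word_action R_lie a (word_action L_lie b f)) =
      mult_pullback (fscale (\<eta> (uea_class \<gg> a) * \<eta>' (uea_class \<hh> b)) f)"
    using eigen[OF tensor_invariant[OF a b]]
    by (simp only: word_action_tensor_mult_pullback[OF f FA] prod_character_tensor[OF \<eta> \<eta>' a b]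
        fun_pair.linear_scale[OF linear_mult_pullback])
  show "word_action R_lie a (word_action L_lie b f) \<in> smooth_functions G"
    by (intro RG.word_action_closed LH.word_action_closed FA f)
  show "fscale (\<eta> (uea_class \<gg> a) * \<eta>' (uea_class \<hh> b)) f \<in> smooth_functions G"
    by (rule smooth_functions_scale[OF f])
qed

lemma mult_pullback_eigenfunction:
  assumes R: "\<And>a. a \<in> G.invariants \<Longrightarrow> word_action R_lie a f = fscale (\<eta> (uea_class \<gg> a)) f"
    and L: "\<And>b. b \<in> H.invariants \<Longrightarrow> word_action L_lie b f = fscale (\<eta>' (uea_class \<hh> b)) f"
    and z: "z \<in> GH.invariants"
  shows "word_action L_lie z (mult_pullback f) = fscale (prod_character G H \<eta> \<eta>' (uea_class \<pp> z)) (mult_pullback f)"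
  using z
proof (induction rule: prod_invariants_induct)
  case (ideal y)
  have "prod_character G H \<eta> \<eta>' (uea_class \<pp> y) = prod_character G H \<eta> \<eta>' (uea_class \<pp> 0)"
    using GH.U.class_eq_iff[OF GH.U.uea_ideal_FA[OF ideal] FA_zero] ideal by simp
  also have "\<dots> = 0"
    by (rule functional.linear_on_0[OF GH.subspace_invariants GH.Z_character_linear_on[OF Z_character_prod_character[OF \<eta> \<eta>']]])
  finally show ?case
    using LGH.word_action_ideal[OF GH.U.lie_subalg_axioms ideal mult_pullback_smooth[OF f]] by simp
next
  case (tensor a b)
  note FA = G.invariants_FA[OF tensor(1)] H.invariants_FA[OF tensor(2)]
  have "word_action R_lie a (word_action L_lie b f) = fscale (\<eta> (uea_class \<gg> a) * \<eta>' (uea_class \<hh> b)) f"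
    by (simp add: L tensor linear_on_scale[OF RG.word_action_linear_on[OF FA(1)] f] R mult.commute)
  then show ?case
    by (simp only: word_action_tensor_mult_pullback[OF f FA] prod_character_tensor[OF \<eta> \<eta>' tensor]
        fun_pair.linear_scale[OF linear_mult_pullback])
next
  case (add x y)
  then show ?case
    by (simp only: word_action_add[OF GH.invariants_FA[THEN FA_finsupp] GH.invariants_FA[THEN FA_finsupp]]
        linear_on_add[OF GH.Z_character_linear_on[OF Z_character_prod_character[OF \<eta> \<eta>']]] fun_vs.scale_left_distrib)
qed

lemma mult_pullback_eigenfunction_iff:
  "(\<forall>u\<in>carrier (Z_alg GH). L_act u (mult_pullback f) = fscale (prod_character G H \<eta> \<eta>' u) (mult_pullback f)) \<longleftrightarrow>
    (\<forall>u\<in>carrier (Z_alg G). R_act u f = fscale (\<eta> u) f) \<and> (\<forall>v\<in>carrier (Z_alg H). L_act v f = fscale (\<eta>' v) f)"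
  unfolding R_act_def L_act_def
    G.eigenfunction_iff_invariants[OF RG.lie_rep_axioms f] H.eigenfunction_iff_invariants[OF LH.lie_rep_axioms f]
    GH.eigenfunction_iff_invariants[OF LGH.lie_rep_axioms mult_pullback_smooth[OF f]]
proof (intro iffI conjI ballI)
  assume eigen: "\<forall>z\<in>GH.invariants. word_action L_lie z (mult_pullback f) =
      fscale (prod_character G H \<eta> \<eta>' (uea_class \<pp> z)) (mult_pullback f)"
  show "word_action R_lie a f = fscale (\<eta> (uea_class \<gg> a)) f" if "a \<in> G.invariants" for a
    using eigenfunction_if_mult_pullback[OF _ that H.invariants_one] eigen by (simp add: H.Z_character_one[OF \<eta>'])
  show "word_action L_lie b f = fscale (\<eta>' (uea_class \<hh> b)) f" if "b \<in> H.invariants" for b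
    using eigenfunction_if_mult_pullback[OF _ G.invariants_one that] eigen by (simp add: G.Z_character_one[OF \<eta>])
qed (use mult_pullback_eigenfunction in blast)

end

subsection \<open>Functions on the homogeneous space\<close>

abbreviation "\<Delta> \<equiv> diag_group H"

lemma coset_iff: "y \<in> blk g h <#\<^bsub>GL\<^esub> \<Delta> \<longleftrightarrow> (\<exists>x\<in>H. y = blk (g ** x) (h ** x))"
  by (auto simp: l_coset_def diag_group_def blk_mult)

lemma coset_space_iff: "c \<in> coset_space GH \<Delta> \<longleftrightarrow> (\<exists>g\<in>G. \<exists>h\<in>H. c = blk g h <#\<^bsub>GL\<^esub> \<Delta>)"
  by (auto simp: coset_space_def prod_group_def)

lemma coset_mult:
  assumes "x \<in> H"
  shows "blk (g ** x) (h ** x) <#\<^bsub>GL\<^esub> \<Delta> = blk g h <#\<^bsub>GL\<^esub> \<Delta>"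
proof (intro Set.set_eqI iffI)
  fix y
  assume "y \<in> blk (g ** x) (h ** x) <#\<^bsub>GL\<^esub> \<Delta>"
  then show "y \<in> blk g h <#\<^bsub>GL\<^esub> \<Delta>"
    using assms H.mult_mem unfolding coset_iff by (metis matrix_mul_assoc)
next
  fix y
  assume "y \<in> blk g h <#\<^bsub>GL\<^esub> \<Delta>"
  then obtain z where z: "z \<in> H" "y = blk (g ** z) (h ** z)" unfolding coset_iff by blast
  have xz: "x ** (matrix_inv x ** z) = z"
    using assms by (simp add: matrix_mul_assoc matrix_inv_mult_self)
  have "y = blk (g ** x ** (matrix_inv x ** z)) (h ** x ** (matrix_inv x ** z))"
    unfolding z(2) matrix_mul_assoc[symmetric] xz ..
  then show "y \<in> blk (g ** x) (h ** x) <#\<^bsub>GL\<^esub> \<Delta>"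
    using assms z(1) unfolding coset_iff by (intro bexI[of _ "matrix_inv x ** z"]) auto
qed

lemma left_translate_coset:
  assumes "k \<in> G" "k' \<in> H"
  shows "matrix_inv (blk k k') <#\<^bsub>GL\<^esub> (blk g h <#\<^bsub>GL\<^esub> \<Delta>) = blk (matrix_inv k ** g) (matrix_inv k' ** h) <#\<^bsub>GL\<^esub> \<Delta>"
  unfolding matrix_inv_blk[OF G.invertible[OF assms(1)] H.invertible[OF assms(2)]]
  by (auto simp: l_coset_def diag_group_def blk_mult matrix_mul_assoc)

lemma phi_pullback_coset:
  assumes gh: "g \<in> G" "h \<in> H"
  shows "phi_pullback G H f (blk g h <#\<^bsub>GL\<^esub> \<Delta>) = f (h ** matrix_inv g)"
proof -
  let ?c = "blk g h <#\<^bsub>GL\<^esub> \<Delta>"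
  let ?p = "SOME p. case p of (g, h) \<Rightarrow> blk g h \<in> ?c"
  have "blk g h \<in> ?c"
    unfolding coset_iff by (intro bexI[of _ "mat 1"]) auto
  then have "case (g, h) of (g, h) \<Rightarrow> blk g h \<in> ?c" by simp
  then have "case ?p of (g, h) \<Rightarrow> blk g h \<in> ?c" by (rule someI)
  then obtain g' h' x where p: "?p = (g', h')" and x: "x \<in> H" "g' = g ** x" "h' = h ** x"
    unfolding coset_iff by (auto split: prod.splits)
  have xG: "x \<in> G" using x(1) sub by blast
  have "h ** x ** matrix_inv (g ** x) = h ** (x ** matrix_inv x) ** matrix_inv g"
    unfolding matrix_inv_mult[OF G.invertible[OF gh(1)] G.invertible[OF xG]] by (simp only: matrix_mul_assoc)
  then have "phi ?p = h ** matrix_inv g"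
    unfolding p phi_def using xG by (simp add: x(2,3) matrix_inv_mult_self)
  moreover have "?c \<in> coset_space GH \<Delta>" using gh coset_space_iff by blast
  ultimately show ?thesis by (simp add: phi_pullback_def)
qed

lemma lift_phi_pullback: "lift_fun GH \<Delta> (phi_pullback G H f) = mult_pullback f"
proof
  fix x
  show "lift_fun GH \<Delta> (phi_pullback G H f) x = mult_pullback f x"
  proof (cases "x \<in> GH")
    case True
    then obtain g h where "g \<in> G" "h \<in> H" "x = blk g h" by (rule prod_group_cases)
    then show ?thesis by (simp add: lift_fun_def phi_pullback_coset mult_pullback_blk)
  qed (simp add: lift_fun_def mult_pullback_off)
qed

lemma phi_pullback_off: "c \<notin> coset_space GH \<Delta> \<Longrightarrow> phi_pullback G H f c = 0"
  by (simp add: phi_pullback_def)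

lemma linear_phi_pullback: "Vector_Spaces.linear fscale fscale (phi_pullback G H)"
  by (auto simp: Vector_Spaces.linear_iff fun_vs.vector_space_axioms phi_pullback_def fscale_def)

lemma phi_pullback_inj_on: "inj_on (phi_pullback G H) (smooth_functions G)"
  using mult_pullback_inj_on lift_phi_pullback unfolding inj_on_def by metis

lemma phi_pullback_section_pullback:
  assumes F: "F \<in> smooth_functions_quot GH \<Delta>"
  shows "phi_pullback G H (section_pullback (lift_fun GH \<Delta> F)) = F"
proof
  fix c
  show "phi_pullback G H (section_pullback (lift_fun GH \<Delta> F)) c = F c"
  proof (cases "c \<in> coset_space GH \<Delta>")
    case True
    then obtain g h where gh: "g \<in> G" "h \<in> H" "c = blk g h <#\<^bsub>GL\<^esub> \<Delta>" unfolding coset_space_iff by blast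
    have hG: "h \<in> G" using gh sub by blast
    have "matrix_inv (h ** matrix_inv g) = g ** matrix_inv h"
      using gh hG by (simp add: matrix_inv_mult invertible_matrix_inv matrix_inv_matrix_inv)
    then have "phi_pullback G H (section_pullback (lift_fun GH \<Delta> F)) c = F (blk (g ** matrix_inv h) (mat 1) <#\<^bsub>GL\<^esub> \<Delta>)"
      unfolding gh(3) phi_pullback_coset[OF gh(1,2)] using gh hG by (simp add: section_pullback_def lift_fun_def)
    also have "blk (g ** matrix_inv h) (mat 1) <#\<^bsub>GL\<^esub> \<Delta> = c"
      using coset_mult[OF gh(2), of "g ** matrix_inv h" "mat 1"] hG
      unfolding gh(3) by (simp add: matrix_inv_mult_self flip: matrix_mul_assoc)
    finally show ?thesis .
  next
    case False
    then show ?thesis using F by (simp add: smooth_functions_quot_def phi_pullback_off)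
  qed
qed

lemma phi_pullback_translate:
  assumes "k \<in> G" "k' \<in> H" "g \<in> G" "h \<in> H"
  shows "phi_pullback G H f (matrix_inv (blk k k') <#\<^bsub>GL\<^esub> (blk g h <#\<^bsub>GL\<^esub> \<Delta>)) =
    f (matrix_inv k' ** (h ** matrix_inv g) ** k)"
proof -
  have "matrix_inv (matrix_inv k ** g) = matrix_inv g ** k"
    using assms by (simp add: matrix_inv_mult invertible_matrix_inv matrix_inv_matrix_inv)
  then show ?thesis
    using assms by (simp add: left_translate_coset phi_pullback_coset matrix_mul_assoc)
qed

lemma phi_pullback_fixed_by_iff:
  assumes k: "k \<in> G" "k' \<in> H"
  shows "(\<forall>c\<in>coset_space GH \<Delta>. phi_pullback G H f (matrix_inv (blk k k') <#\<^bsub>GL\<^esub> c) = phi_pullback G H f c) \<longleftrightarrow>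
    (\<forall>g\<in>G. f (matrix_inv k' ** g ** k) = f g)" (is "?fixed \<longleftrightarrow> ?invariant")
proof (intro iffI ballI)
  fix x assume fixed: ?fixed and x: "x \<in> G"
  then have "blk (matrix_inv x) (mat 1) <#\<^bsub>GL\<^esub> \<Delta> \<in> coset_space GH \<Delta>"
    unfolding coset_space_iff by (intro bexI[of _ "matrix_inv x"] bexI[of _ "mat 1"]) auto
  with fixed show "f (matrix_inv k' ** x ** k) = f x"
    using phi_pullback_translate[OF k, of "matrix_inv x" "mat 1" f] x
    by (simp add: phi_pullback_coset matrix_inv_matrix_inv)
next
  fix c assume inv: ?invariant and "c \<in> coset_space GH \<Delta>"
  then obtain g h where gh: "g \<in> G" "h \<in> H" "c = blk g h <#\<^bsub>GL\<^esub> \<Delta>"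
    unfolding coset_space_iff by blast
  then have "h ** matrix_inv g \<in> G"
    using sub by auto
  with inv gh show "phi_pullback G H f (matrix_inv (blk k k') <#\<^bsub>GL\<^esub> c) = phi_pullback G H f c"
    by (simp add: phi_pullback_translate[OF k] phi_pullback_coset)
qed

lemma phi_pullback_fixed_iff:
  assumes K: "linear_group K" "K \<subseteq> G"
  shows "(\<forall>k\<in>prod_group K (K \<inter> H). \<forall>c\<in>coset_space GH \<Delta>.
      phi_pullback G H f (matrix_inv k <#\<^bsub>GL\<^esub> c) = phi_pullback G H f c) \<longleftrightarrow>
    (\<forall>k'\<in>K \<inter> H. \<forall>k\<in>K. \<forall>g\<in>G. f (k' ** g ** k) = f g)" (is "?fixed \<longleftrightarrow> ?bi_invariant")
proof -
  interpret K: linear_group K by fact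
  have "?fixed \<longleftrightarrow> (\<forall>k\<in>K. \<forall>k'\<in>K \<inter> H. \<forall>c\<in>coset_space GH \<Delta>.
      phi_pullback G H f (matrix_inv (blk k k') <#\<^bsub>GL\<^esub> c) = phi_pullback G H f c)"
    by (auto simp: prod_group_def)
  also have "\<dots> \<longleftrightarrow> (\<forall>k\<in>K. \<forall>k'\<in>K \<inter> H. \<forall>g\<in>G. f (matrix_inv k' ** g ** k) = f g)"
    using K(2) by (intro ball_cong refl phi_pullback_fixed_by_iff) auto
  also have "\<dots> \<longleftrightarrow> ?bi_invariant"
  proof (intro iffI ballI)
    fix k' k g assume inv: "\<forall>k\<in>K. \<forall>k'\<in>K \<inter> H. \<forall>g\<in>G. f (matrix_inv k' ** g ** k) = f g"
      and mem: "k' \<in> K \<inter> H" "k \<in> K" "g \<in> G"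
    have "f (matrix_inv (matrix_inv k') ** g ** k) = f g"
      using mem by (intro inv[rule_format]) auto
    then show "f (k' ** g ** k) = f g"
      using mem by (simp add: matrix_inv_matrix_inv)
  qed auto
  finally show ?thesis .
qed

subsection \<open>Shintani functions\<close>

lemma Sh_iff:
  "f \<in> Sh G H K \<eta> \<eta>' \<longleftrightarrow> f \<in> smooth_functions G \<and>
     (\<forall>k'\<in>K \<inter> H. \<forall>k\<in>K. \<forall>g\<in>G. f (k' ** g ** k) = f g) \<and>
     (\<forall>u\<in>carrier (Z_alg G). R_act u f = fscale (\<eta> u) f) \<and> (\<forall>v\<in>carrier (Z_alg H). L_act v f = fscale (\<eta>' v) f)"
  by (simp add: Sh_def fscale_def)

lemma subspace_Sh: "fun_vs.subspace (Sh G H K \<eta> \<eta>')"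
proof -
  let ?S = "smooth_functions G"
  have R: "fun_vs.subspace {f \<in> ?S. R_act u f = fscale (\<eta> u) f}" if "u \<in> carrier (Z_alg G)" for u
    unfolding R_act_def using G.invariants_FA[OF G.rep_invariant[OF that]]
    by (intro fun_vs.subspace_eigenspace subspace_smooth_functions RG.word_action_linear_on)
  have L: "fun_vs.subspace {f \<in> ?S. L_act v f = fscale (\<eta>' v) f}" if "v \<in> carrier (Z_alg H)" for v
    unfolding L_act_def using H.invariants_FA[OF H.rep_invariant[OF that]]
    by (intro fun_vs.subspace_eigenspace subspace_smooth_functions LH.word_action_linear_on)
  have bi_invariant: "fun_vs.subspace {f. \<forall>k'\<in>K \<inter> H. \<forall>k\<in>K. \<forall>g\<in>G. f (k' ** g ** k) = f g}"
    by (rule fun_vs.subspaceI) (auto simp: fscale_def)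
  have "Sh G H K \<eta> \<eta>' = ?S \<inter> {f. \<forall>k'\<in>K \<inter> H. \<forall>k\<in>K. \<forall>g\<in>G. f (k' ** g ** k) = f g} \<inter>
      (\<Inter>u\<in>carrier (Z_alg G). {f \<in> ?S. R_act u f = fscale (\<eta> u) f}) \<inter>
      (\<Inter>v\<in>carrier (Z_alg H). {f \<in> ?S. L_act v f = fscale (\<eta>' v) f})"
    unfolding set_eq_iff Sh_iff by blast
  then show ?thesis
    using R L by (auto intro!: fun_vs.subspace_inter fun_vs.subspace_Inter subspace_smooth_functions bi_invariant)
qed

context
  fixes K \<eta> \<eta>'
  assumes K: "linear_group K" "K \<subseteq> G" and \<eta>: "Z_character G \<eta>" "Z_character H \<eta>'"
begin

lemma phi_pullback_in_Hom_iff: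
  assumes f: "f \<in> smooth_functions G"
  shows "phi_pullback G H f \<in> Hom_trivial G H K \<eta> \<eta>' \<longleftrightarrow> f \<in> Sh G H K \<eta> \<eta>'"
  unfolding Hom_trivial_def fixed_vectors_def eigen_functions_quot_def smooth_functions_quot_def mem_Collect_eq
    lift_phi_pullback phi_pullback_fixed_iff[OF K] Sh_iff
  using mult_pullback_eigenfunction_iff[OF \<eta> f] f mult_pullback_smooth[OF f] phi_pullback_off by (auto simp: fscale_def)

lemma phi_pullback_image: "phi_pullback G H ` Sh G H K \<eta> \<eta>' = Hom_trivial G H K \<eta> \<eta>'"
proof (intro Set.set_eqI iffI)
  fix F assume "F \<in> phi_pullback G H ` Sh G H K \<eta> \<eta>'"
  then show "F \<in> Hom_trivial G H K \<eta> \<eta>'"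
    using phi_pullback_in_Hom_iff by (auto simp: Sh_iff)
next
  fix F assume F: "F \<in> Hom_trivial G H K \<eta> \<eta>'"
  let ?f = "section_pullback (lift_fun GH \<Delta> F)"
  have quot: "F \<in> smooth_functions_quot GH \<Delta>"
    using F unfolding Hom_trivial_def fixed_vectors_def eigen_functions_quot_def by blast
  then have smooth: "?f \<in> smooth_functions G"
    by (intro section_pullback_smooth) (simp add: smooth_functions_quot_def)
  have "?f \<in> Sh G H K \<eta> \<eta>'"
    using F unfolding phi_pullback_in_Hom_iff[OF smooth, symmetric] phi_pullback_section_pullback[OF quot] .
  then show "F \<in> phi_pullback G H ` Sh G H K \<eta> \<eta>'"
    by (metis phi_pullback_section_pullback[OF quot] imageI)
qed

lemma phi_pullback_isomorphism:
  "linear_isomorphism (phi_pullback G H) (Sh G H K \<eta> \<eta>') (Hom_trivial G H K \<eta> \<eta>')"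
  unfolding linear_isomorphism_def
proof (intro conjI ballI allI)
  show "fun_vs.subspace (Sh G H K \<eta> \<eta>')"
    by (rule subspace_Sh)
  then show "fun_vs.subspace (Hom_trivial G H K \<eta> \<eta>')"
    unfolding phi_pullback_image[symmetric] by (rule fun_pair.linear_subspace_image[OF linear_phi_pullback])
  show "bij_betw (phi_pullback G H) (Sh G H K \<eta> \<eta>') (Hom_trivial G H K \<eta> \<eta>')"
    unfolding bij_betw_def
    by (intro conjI phi_pullback_image inj_on_subset[OF phi_pullback_inj_on]) (auto simp: Sh_iff)
qed (simp_all only: fun_pair.linear_add[OF linear_phi_pullback] fun_pair.linear_scale[OF linear_phi_pullback])

end

end

theorem lemma5p5:
  fixes G G' K \<jj> \<jj>' :: "(real^'n^'n) set"
    and \<Lambda> \<Lambda>' :: "(complex^'n^'n \<Rightarrow> complex) set"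
    and \<eta> \<eta>' :: "((complex^'n^'n) list \<Rightarrow> complex) set \<Rightarrow> complex"
  assumes "real_reductive_linear_group G"
    and "algebraic_reductive_subgroup G' G"
    and "maximal_compact_subgroup K G"
    and "maximal_compact_subgroup (K \<inter> G') G'"
    and "cartan_subalgebra \<jj> (lie_algebra G)"
    and "cartan_subalgebra \<jj>' (lie_algebra G')"
    and "\<Lambda> \<in> hc_parameters G \<jj>"
    and "\<Lambda>' \<in> hc_parameters G' \<jj>'"
    and "infinitesimal_character G \<jj> \<Lambda> \<eta>"
    and "infinitesimal_character G' \<jj>' \<Lambda>' \<eta>'"
  shows "(\<forall>f\<in>Sh G G' K \<eta> \<eta>'. \<forall>g\<in>G. \<forall>h\<in>G'.
            phi_pullback G G' f (blk g h <#\<^bsub>GL\<^esub> diag_group G') = f (phi (g, h))) \<and>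
         linear_isomorphism (phi_pullback G G') (Sh G G' K \<eta> \<eta>') (Hom_trivial G G' K \<eta> \<eta>')"
proof -
  have "closed_linear_group G" "closed_linear_group G'"
    using assms(1,2) by (auto intro: real_reductive_linear_group_closed algebraic_reductive_subgroup_imp_real_reductive)
  moreover have "G' \<subseteq> G"
    using assms(2) by (auto simp: algebraic_reductive_subgroup_def)
  ultimately interpret subgroup_pair G G'
    by (intro subgroup_pair.intro group_pair.intro subgroup_pair_axioms.intro)
  have "linear_group K" "K \<subseteq> G"
    using assms(3) by (auto simp: maximal_compact_subgroup_def linear_group_def)
  moreover have "Z_character G \<eta>" "Z_character G' \<eta>'"
    using assms(9,10) by (simp_all add: infinitesimal_character_def)
  ultimately have "linear_isomorphism (phi_pullback G G') (Sh G G' K \<eta> \<eta>') (Hom_trivial G G' K \<eta> \<eta>')"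
    by (rule phi_pullback_isomorphism)
  moreover have "phi_pullback G G' f (blk g h <#\<^bsub>GL\<^esub> diag_group G') = f (phi (g, h))"
    if "g \<in> G" "h \<in> G'" for f g h
    unfolding phi_pullback_coset[OF that] by (simp add: phi_def)
  ultimately show ?thesis by blast
qed

end
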